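(* Let $\mathcal{C}_s$ be the class of all submodular functions $\{0,1\}^n\to[0,1]$. There exists an algorithm that learns $\mathcal{C}_s$ agnostically with excess $\ell_2$-error $\epsilon$ over the uniform distribution and runs in time $n^{O(\log(1/\epsilon)/\epsilon^{4/5})}$.
   Context: $f$ is submodular if $f(A\cup B)+f(A\cap B)\le f(A)+f(B)$ for all $A,B\subseteq[n]$. For a distribution $\mathcal{P}$ on $\{0,1\}^n\times[0,1]$ and a class $\mathcal{F}$, $\mathrm{opt}(\mathcal{P},\mathcal{F})=\inf_{f\in\mathcal{F}}\sqrt{\mathbb{E}_{(x,\ell)\sim\mathcal{P}}[(\ell-f(x))^2]}$. An algorithm learns $\mathcal{F}$ agnostically with excess $\ell_2$-error over the uniform distribution if for every $\epsilon>0$ and every distribution $\mathcal{P}$ on $\{0,1\}^n\times[0,1]$ whose marginal on $\{0,1\}^n$ is uniform, given independent random examples from $\mathcal{P}$, with probability at least $2/3$ it outputs $h$ with $\sqrt{\mathbb{E}_{(x,\ell)\sim\mathcal{P}}[(h(x)-\ell)^2]}\le\mathrm{opt}(\mathcal{P},\mathcal{F})+\epsilon$. *)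

theory Defs
  imports "HOL-Probability.Probability"
begin

text \<open>
  Points of \<open>{0,1}\<^sup>n\<close> are identified with subsets of \<open>{..<n}\<close>, so a function on the cube is
  a set function, of which only the values on \<open>Pow {..<n}\<close> matter.
\<close>

definition submodular :: "nat \<Rightarrow> (nat set \<Rightarrow> real) \<Rightarrow> bool" where
  "submodular n f \<longleftrightarrow>
     (\<forall>A B. A \<subseteq> {..<n} \<longrightarrow> B \<subseteq> {..<n} \<longrightarrow> f (A \<union> B) + f (A \<inter> B) \<le> f A + f B)"

definition submodular_class :: "nat \<Rightarrow> (nat set \<Rightarrow> real) set" where
  "submodular_class n = {f. submodular n f \<and> (\<forall>A. A \<subseteq> {..<n} \<longrightarrow> f A \<in> {0..1})}"


type_synonym labelled = "nat set \<times> real"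

definition labelled_space :: "nat \<Rightarrow> labelled measure" where
  "labelled_space n = count_space (Pow {..<n}) \<Otimes>\<^sub>M restrict_space borel {0..1}"

definition uniform_marginal :: "nat \<Rightarrow> labelled measure \<Rightarrow> bool" where
  "uniform_marginal n P \<longleftrightarrow>
     prob_space P \<and> sets P = sets (labelled_space n) \<and>
     distr P (count_space (Pow {..<n})) fst = uniform_count_measure (Pow {..<n})"

definition l2_error :: "labelled measure \<Rightarrow> (nat set \<Rightarrow> real) \<Rightarrow> real" where
  "l2_error P h = sqrt (\<integral>z. (snd z - h (fst z))\<^sup>2 \<partial>P)"

definition opt :: "labelled measure \<Rightarrow> (nat set \<Rightarrow> real) set \<Rightarrow> real" where
  "opt P F = (INF f\<in>F. l2_error P f)"


text \<open>
  The machine model is a real random access machine with an example oracle, presented as a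
  structured language. A program uses finitely many arrays of naturals and of reals, named by
  constants and of unbounded length; a scalar is an array used at index 0.

  Every command and every test costs one unit. The expressions in a program have bounded size,
  so this agrees up to a constant factor with charging each operation separately.
  Unit cost is harmless on naturals because only addition and truncated subtraction are
  available: after \<open>t\<close> steps numbers have \<open>O(t)\<close> bits. Reals support exact field operations and
  comparison. There is no rounding or other conversion from reals to naturals, and the only
  real constants are integers, so no information can be hidden in a real constant.
\<close>

datatype nexp =
    NLit nat
  | NMem nat nexp
  | NAdd nexp nexp
  | NSub nexp nexp

datatype rexp =
    RLit int
  | RMem nat nexp
  | RAdd rexp rexp
  | RSub rexp rexp
  | RMul rexp rexp
  | RDiv rexp rexp
  | Label

datatype bexp =
    NLess nexp nexp
  | RLess rexp rexp
  | Bit nexp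
  | BNot bexp
  | BAnd bexp bexp

datatype com =
    Skip
  | NStore nat nexp nexp
  | RStore nat nexp rexp
  | Draw
  | Seq com com
  | Cond bexp com com
  | While bexp com

text \<open>
  \<open>current\<close> is the example drawn last, accessed through \<open>Bit\<close> and \<open>Label\<close>;
  \<open>pending\<close> is the stream of examples not yet drawn.
\<close>

record state =
  nmem :: "nat \<Rightarrow> nat \<Rightarrow> nat"
  rmem :: "nat \<Rightarrow> nat \<Rightarrow> real"
  current :: labelled
  pending :: "nat \<Rightarrow> labelled"

fun nval :: "state \<Rightarrow> nexp \<Rightarrow> nat" where
  "nval s (NLit k) = k"
| "nval s (NMem a e) = nmem s a (nval s e)"
| "nval s (NAdd e1 e2) = nval s e1 + nval s e2"
| "nval s (NSub e1 e2) = nval s e1 - nval s e2"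

fun rval :: "state \<Rightarrow> rexp \<Rightarrow> real" where
  "rval s (RLit k) = of_int k"
| "rval s (RMem a e) = rmem s a (nval s e)"
| "rval s (RAdd e1 e2) = rval s e1 + rval s e2"
| "rval s (RSub e1 e2) = rval s e1 - rval s e2"
| "rval s (RMul e1 e2) = rval s e1 * rval s e2"
| "rval s (RDiv e1 e2) = rval s e1 / rval s e2"
| "rval s Label = snd (current s)"

fun bval :: "state \<Rightarrow> bexp \<Rightarrow> bool" where
  "bval s (NLess e1 e2) \<longleftrightarrow> nval s e1 < nval s e2"
| "bval s (RLess e1 e2) \<longleftrightarrow> rval s e1 < rval s e2"
| "bval s (Bit e) \<longleftrightarrow> nval s e \<in> fst (current s)"
| "bval s (BNot b) \<longleftrightarrow> \<not> bval s b"
| "bval s (BAnd b1 b2) \<longleftrightarrow> bval s b1 \<and> bval s b2"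

definition nstore :: "nat \<Rightarrow> nat \<Rightarrow> nat \<Rightarrow> state \<Rightarrow> state" where
  "nstore a i v s = s\<lparr>nmem := (nmem s)(a := (nmem s a)(i := v))\<rparr>"

definition rstore :: "nat \<Rightarrow> nat \<Rightarrow> real \<Rightarrow> state \<Rightarrow> state" where
  "rstore a i v s = s\<lparr>rmem := (rmem s)(a := (rmem s a)(i := v))\<rparr>"

definition draw :: "state \<Rightarrow> state" where
  "draw s = s\<lparr>current := pending s 0, pending := (\<lambda>i. pending s (Suc i))\<rparr>"

text \<open>
  \<open>exec c s t s'\<close>: started in \<open>s\<close>, the command \<open>c\<close> halts in \<open>s'\<close> after time \<open>t\<close>.
\<close>

inductive exec :: "com \<Rightarrow> state \<Rightarrow> nat \<Rightarrow> state \<Rightarrow> bool" where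
  Skip: "exec Skip s 1 s"
| NStore: "exec (NStore a i e) s 1 (nstore a (nval s i) (nval s e) s)"
| RStore: "exec (RStore a i e) s 1 (rstore a (nval s i) (rval s e) s)"
| Draw: "exec Draw s 1 (draw s)"
| Seq: "exec c1 s t1 s1 \<Longrightarrow> exec c2 s1 t2 s2 \<Longrightarrow> exec (Seq c1 c2) s (t1 + t2) s2"
| CondTrue: "bval s b \<Longrightarrow> exec c1 s t s1 \<Longrightarrow> exec (Cond b c1 c2) s (1 + t) s1"
| CondFalse: "\<not> bval s b \<Longrightarrow> exec c2 s t s1 \<Longrightarrow> exec (Cond b c1 c2) s (1 + t) s1"
| WhileFalse: "\<not> bval s b \<Longrightarrow> exec (While b c) s 1 s"
| WhileTrue: "bval s b \<Longrightarrow> exec c s t1 s1 \<Longrightarrow> exec (While b c) s1 t2 s2 \<Longrightarrow>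
    exec (While b c) s (1 + t1 + t2) s2"

lemma exec_deterministic:
  "exec c s t s1 \<Longrightarrow> exec c s t' s2 \<Longrightarrow> t' = t \<and> s2 = s1"
proof (induction arbitrary: t' s2 rule: exec.induct)
  case (Seq c1 s t1 s1 c2 t2 s3)
  from Seq.prems show ?case by cases (use Seq.IH in blast)
next
  case (WhileTrue s b c t1 s1 t2 s3)
  from WhileTrue.prems show ?case by cases (use WhileTrue.IH WhileTrue.hyps in blast)+
next
  case (CondTrue s b c1 t s1 c2)
  from CondTrue.prems show ?case by cases (use CondTrue.IH CondTrue.hyps in blast)+
next
  case (CondFalse s b c2 t s1 c1)
  from CondFalse.prems show ?case by cases (use CondFalse.IH CondFalse.hyps in blast)+
qed (auto elim: exec.cases)

text \<open>
  A learner consists of a training program, which sees \<open>n\<close>, \<open>\<epsilon>\<close> and the example stream, and an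
  evaluation program. The memory contents left by training are the representation of the output
  hypothesis \<open>h\<close>; running the evaluation program on them computes \<open>h x\<close>. During evaluation the
  oracle returns only the query point \<open>x\<close> (with dummy label 0), so no further examples are seen.
\<close>

type_synonym learner = "com \<times> com"

definition train_state :: "nat \<Rightarrow> real \<Rightarrow> (nat \<Rightarrow> labelled) \<Rightarrow> state" where
  "train_state n \<epsilon> \<omega> =
     \<lparr>nmem = (\<lambda>a i. if a = 0 \<and> i = 0 then n else 0),
      rmem = (\<lambda>a i. if a = 0 \<and> i = 0 then \<epsilon> else 0),
      current = ({}, 0), pending = \<omega>\<rparr>"

definition query_state :: "state \<Rightarrow> nat set \<Rightarrow> state" where
  "query_state s x = s\<lparr>current := (x, 0), pending := (\<lambda>_. (x, 0))\<rparr>"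

definition outputs ::
  "learner \<Rightarrow> nat \<Rightarrow> real \<Rightarrow> (nat \<Rightarrow> labelled) \<Rightarrow> (nat set \<Rightarrow> real) \<Rightarrow> bool" where
  "outputs L n \<epsilon> \<omega> h \<longleftrightarrow>
     (\<exists>t s. exec (fst L) (train_state n \<epsilon> \<omega>) t s \<and>
        (\<forall>x\<in>Pow {..<n}. \<exists>t' s'. exec (snd L) (query_state s x) t' s' \<and> rmem s' 0 0 = h x))"

definition halts_within :: "learner \<Rightarrow> nat \<Rightarrow> real \<Rightarrow> (nat \<Rightarrow> labelled) \<Rightarrow> real \<Rightarrow> bool" where
  "halts_within L n \<epsilon> \<omega> T \<longleftrightarrow>
     (\<exists>t s. exec (fst L) (train_state n \<epsilon> \<omega>) t s \<and> real t \<le> T \<and>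
        (\<forall>x\<in>Pow {..<n}. \<exists>t' s'. exec (snd L) (query_state s x) t' s' \<and> real t' \<le> T))"

definition learns_agnostically :: "learner \<Rightarrow> (nat \<Rightarrow> (nat set \<Rightarrow> real) set) \<Rightarrow> bool" where
  "learns_agnostically L F \<longleftrightarrow>
     (\<forall>n \<epsilon> P. n \<ge> 1 \<longrightarrow> \<epsilon> > 0 \<longrightarrow> uniform_marginal n P \<longrightarrow>
        measure (Pi\<^sub>M UNIV (\<lambda>_::nat. P))
          {\<omega> \<in> space (Pi\<^sub>M UNIV (\<lambda>_::nat. P)).
             \<exists>h. outputs L n \<epsilon> \<omega> h \<and> l2_error P h \<le> opt P (F n) + \<epsilon>} \<ge> 2 / 3)"

text \<open>
  The time bound is worst case over all example streams. The dimension \<open>n = 1\<close> is excluded since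
  there any bound of the form \<open>n powr k\<close> is 1.
\<close>

definition runs_in_time :: "learner \<Rightarrow> (nat \<Rightarrow> real \<Rightarrow> real) \<Rightarrow> bool" where
  "runs_in_time L T \<longleftrightarrow>
     (\<forall>n \<epsilon> \<omega>. n \<ge> 2 \<longrightarrow> \<epsilon> > 0 \<longrightarrow> (\<forall>i. \<omega> i \<in> space (labelled_space n)) \<longrightarrow>
        halts_within L n \<epsilon> \<omega> (T n \<epsilon>))"

text \<open>
  For \<open>\<epsilon> \<le> 1/2\<close> the maximum is the second argument. It only matters for larger \<open>\<epsilon>\<close>, where
  \<open>ln (1/\<epsilon>)\<close> tends to 0 or becomes negative.
\<close>

definition learning_exponent :: "real \<Rightarrow> real" where
  "learning_exponent \<epsilon> = max 1 (ln (1 / \<epsilon>) / \<epsilon> powr (4 / 5))"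

end

theory Submission imports Defs begin

text \<open>
  Writing \<open>h\<^sub>i\<^sub>j\<close> for the second differences of \<open>f\<close>, the Fourier weight above level \<open>d\<close> is at most
  \<open>\<Sum>\<^sub>i\<^sub>j E h\<^sub>i\<^sub>j\<^sup>2 / (16 d\<^sup>2)\<close>. If \<open>f\<close> is submodular with values in \<open>[0,1]\<close> and all marginal gains are at most
  \<open>\<alpha>\<close> in absolute value, this sum is \<open>O(\<surd>\<alpha>)\<close>. To see this, leave a random set \<open>J\<close> of coordinates
  free and fix the others. Gains are decreasing, so on the resulting subcube \<open>|h\<^sub>i\<^sub>j|\<close> is bounded by
  the spread \<open>b\<^sub>i\<close> of the \<open>i\<close>-th gain between the bottom and the top of the subcube, and by \<open>b\<^sub>j\<close>.
  With weights \<open>w\<^sub>i = \<surd>b\<^sub>i\<close> this gives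
  \<open>\<Sum> E h\<^sub>i\<^sub>j\<^sup>2 \<le> - \<Sum> w\<^sub>i w\<^sub>j E h\<^sub>i\<^sub>j = - 2 \<Sum>\<^sub>i w\<^sub>i E (g\<^sub>i \<Sum>\<^sub>j w\<^sub>j r\<^sub>j)\<close>, where the \<open>g\<^sub>i\<close> are the gains and the
  \<open>r\<^sub>j\<close> are random signs. Here \<open>w\<^sub>i \<le> \<surd>(2\<alpha>)\<close>, the gains have total absolute value \<open>O(1)\<close>, and the
  random sum has second moment \<open>\<Sum> b\<^sub>j\<close>, which is \<open>O(1)\<close> on average.

  A general \<open>f\<close> is reduced to this case by querying coordinates with a large gain at the bottom,
  then coordinates with a very negative gain at the top. Each query raises \<open>f\<close> at the bottom
  (respectively top) by \<open>\<alpha>\<close> with probability \<open>1/2\<close>, so depth \<open>O(1/\<alpha> + log (1/\<epsilon>))\<close> suffices up to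
  error \<open>\<epsilon>\<close>. The choice \<open>\<alpha> = \<epsilon>\<^bsup>4/5\<^esup>\<close> balances both parts.

  The marginal being uniform, the best approximation of the labels by polynomials of degree \<open>D\<close> is
  given by the coefficients \<open>E (\<ell> \<chi>\<^sub>S)\<close>, which the learner estimates from
  \<open>12 (n+1)\<^bsup>D\<^esup> / \<epsilon>\<^sup>2\<close> samples. Evaluating the hypothesis needs no enumeration of the sets \<open>S\<close>: the sums
  \<open>\<Sum>\<^sub>S \<chi>\<^sub>S(x) \<chi>\<^sub>S(y)\<close> over \<open>|S| \<le> D\<close> obey a recursion in the number of coordinates.
\<close>

section \<open>Fourier analysis on the cube\<close>

definition cube_avg :: "'a set \<Rightarrow> ('a set \<Rightarrow> real) \<Rightarrow> real" where
  "cube_avg V f = (\<Sum>A\<in>Pow V. f A) / 2 ^ card V"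

definition rad :: "'a \<Rightarrow> 'a set \<Rightarrow> real" where
  "rad i A = (if i \<in> A then 1 else -1)"

text \<open>As \<open>- rad i A\<close> is -1 exactly for i in A, this is the Walsh character: -1 to
  the power of the size of the intersection of S and A.\<close>

definition chi :: "'a set \<Rightarrow> 'a set \<Rightarrow> real" where
  "chi S A = (\<Prod>i\<in>S. - rad i A)"

text \<open>Both endpoints are formed explicitly, so this discrete derivative lives on the whole
  cube and does not depend on coordinate i (\<open>ignores_gain\<close>).\<close>

definition gain :: "('a set \<Rightarrow> real) \<Rightarrow> 'a \<Rightarrow> 'a set \<Rightarrow> real" where
  "gain f i A = f (insert i A) - f (A - {i})"

definition ignores :: "'a \<Rightarrow> ('a set \<Rightarrow> 'b) \<Rightarrow> bool" where
  "ignores i f \<longleftrightarrow> (\<forall>A. f (insert i A) = f (A - {i}))"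

definition fcoeff :: "'a set \<Rightarrow> ('a set \<Rightarrow> real) \<Rightarrow> 'a set \<Rightarrow> real" where
  "fcoeff V f S = cube_avg V (\<lambda>A. f A * chi S A)"

section \<open>Averages over the cube, signs and discrete derivatives\<close>

lemma cube_avg_add: "cube_avg V (\<lambda>A. f A + g A) = cube_avg V f + cube_avg V g"
  by (simp add: cube_avg_def sum.distrib add_divide_distrib)

lemma cube_avg_diff: "cube_avg V (\<lambda>A. f A - g A) = cube_avg V f - cube_avg V g"
  by (simp add: cube_avg_def sum_subtractf diff_divide_distrib)

lemma cube_avg_cmult: "cube_avg V (\<lambda>A. c * f A) = c * cube_avg V f"
  by (simp add: cube_avg_def sum_distrib_left)

lemma cube_avg_uminus: "cube_avg V (\<lambda>A. - f A) = - cube_avg V f"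
  by (simp add: cube_avg_def sum_negf)

lemma cube_avg_sum: "cube_avg V (\<lambda>A. \<Sum>i\<in>I. f i A) = (\<Sum>i\<in>I. cube_avg V (f i))"
  unfolding cube_avg_def by (subst sum.swap) (simp add: sum_divide_distrib)

lemma cube_avg_mono: "(\<And>A. A \<subseteq> V \<Longrightarrow> f A \<le> g A) \<Longrightarrow> cube_avg V f \<le> cube_avg V g"
  unfolding cube_avg_def by (intro divide_right_mono sum_mono) auto

lemma cube_avg_cong: "(\<And>A. A \<subseteq> V \<Longrightarrow> f A = g A) \<Longrightarrow> cube_avg V f = cube_avg V g"
  unfolding cube_avg_def by (intro arg_cong2[where f = "(/)"] sum.cong) auto

lemma cube_avg_const: "finite V \<Longrightarrow> cube_avg V (\<lambda>_. c) = c"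
  by (simp add: cube_avg_def card_Pow)

lemma cube_avg_swap:
  "cube_avg U (\<lambda>A. cube_avg V (\<lambda>B. f A B)) = cube_avg V (\<lambda>B. cube_avg U (\<lambda>A. f A B))"
  unfolding cube_avg_def sum_divide_distrib[symmetric]
  by (subst sum.swap) simp

lemma sum_Pow_insert:
  assumes "finite U" "i \<notin> U"
  shows "(\<Sum>A\<in>Pow (insert i U). f A) = (\<Sum>A\<in>Pow U. f A) + (\<Sum>A\<in>Pow U. f (insert i A))"
proof -
  have "inj_on (insert i) (Pow U)"
    using assms(2) by (intro inj_onI) (metis PowD insert_ident subsetD)
  moreover have "Pow U \<inter> insert i ` Pow U = {}" using assms(2) by auto
  ultimately show ?thesis
    using assms by (simp add: Pow_insert sum.union_disjoint sum.reindex)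
qed

text \<open>Conditioning on one coordinate. The halves remain averages over all of V, so
  restrictions of f are handled without changing the ground set.\<close>

lemma cube_avg_split:
  assumes "finite V" "i \<in> V"
  shows "cube_avg V f = (cube_avg V (\<lambda>A. f (insert i A)) + cube_avg V (\<lambda>A. f (A - {i}))) / 2"
proof -
  define U where "U = V - {i}"
  have U: "V = insert i U" "i \<notin> U" "finite U"
    using assms by (auto simp: U_def)
  have "(\<Sum>A\<in>Pow U. f (A - {i})) = (\<Sum>A\<in>Pow U. f A)"
    by (intro sum.cong refl arg_cong[where f = f]) (use U in auto)
  moreover have "(\<Sum>A\<in>Pow U. f (insert i A - {i})) = (\<Sum>A\<in>Pow U. f A)"
    by (intro sum.cong refl arg_cong[where f = f]) (use U in auto)
  ultimately show ?thesis
    unfolding cube_avg_def U(1) using U(2,3)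
    by (simp add: sum_Pow_insert field_simps)
qed

text \<open>Discrete integration by parts: the sign turns the sum of the two halves in
  \<open>cube_avg_split\<close> into a difference.\<close>

lemma cube_avg_rad:
  assumes "finite V" "i \<in> V"
  shows "cube_avg V (\<lambda>A. rad i A * f A) = cube_avg V (gain f i) / 2"
proof -
  have "cube_avg V (gain f i) = cube_avg V (\<lambda>A. f (insert i A)) - cube_avg V (\<lambda>A. f (A - {i}))"
    unfolding gain_def by (rule cube_avg_diff)
  then show ?thesis
    unfolding cube_avg_split[OF assms, of "\<lambda>A. rad i A * f A"]
    by (simp add: rad_def cube_avg_uminus)
qed

lemma gain_eq_0: "ignores i f \<Longrightarrow> gain f i A = 0"
  by (simp add: ignores_def gain_def)

lemma cube_avg_rad_ignores:
  assumes "finite V" "i \<in> V" "ignores i f"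
  shows "cube_avg V (\<lambda>A. rad i A * f A) = 0"
  unfolding cube_avg_rad[OF assms(1,2)] using gain_eq_0[OF assms(3)] by (simp add: cube_avg_def)

lemma ignores_gain: "ignores i (gain f i)"
  by (simp add: ignores_def gain_def)

lemma ignores_mult: "ignores i f \<Longrightarrow> ignores i g \<Longrightarrow> ignores i (\<lambda>A. f A * g A)"
  by (simp add: ignores_def)

lemma ignores_comp: "ignores i f \<Longrightarrow> ignores i (\<lambda>A. h (f A))"
  by (simp add: ignores_def)

lemma ignores_rad: "i \<noteq> j \<Longrightarrow> ignores i (rad j)"
  by (simp add: ignores_def rad_def)

lemma ignores_sum: "(\<And>j. j \<in> J \<Longrightarrow> ignores i (f j)) \<Longrightarrow> ignores i (\<lambda>A. \<Sum>j\<in>J. f j A)"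
  unfolding ignores_def by (intro allI sum.cong) auto

lemma ignores_chi: "i \<notin> S \<Longrightarrow> ignores i (chi S)"
  unfolding ignores_def chi_def rad_def by (intro allI prod.cong) auto

lemma ignores_Diff: "ignores i w \<Longrightarrow> w (A - {i}) = w A"
  unfolding ignores_def by (cases "i \<in> A") (metis insert_absorb, simp)

lemma gain_mult_ignores: "ignores i w \<Longrightarrow> gain (\<lambda>A. w A * f A) i = (\<lambda>A. w A * gain f i A)"
proof
  fix A assume w: "ignores i w"
  have "w (insert i A) = w A"
    using w ignores_Diff[OF w, of A] by (simp add: ignores_def)
  then show "gain (\<lambda>A. w A * f A) i A = w A * gain f i A"
    by (simp add: gain_def ignores_Diff[OF w] right_diff_distrib)
qed

lemma gain_commute: "gain (gain f i) j A = gain (gain f j) i A"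
proof (cases "i = j")
  case False
  then have "insert j A - {i} = insert j (A - {i})" "insert i A - {j} = insert i (A - {j})"
    by auto
  moreover have "A - {j} - {i} = A - {i} - {j}" by auto
  ultimately show ?thesis
    unfolding gain_def by (simp add: insert_commute)
qed simp

section \<open>Characters: inversion, Parseval, orthonormality\<close>

lemma chi_square: "finite S \<Longrightarrow> chi S A * chi S A = 1"
  unfolding chi_def prod.distrib[symmetric] by (intro prod.neutral) (simp add: rad_def)

lemma chi_insert: "finite S \<Longrightarrow> i \<notin> S \<Longrightarrow> chi (insert i S) A = - rad i A * chi S A"
  by (simp add: chi_def)

lemma prod_plus_one:
  fixes s :: "'a \<Rightarrow> real"
  assumes "finite V"
  shows "(\<Sum>S\<in>Pow V. \<Prod>i\<in>S. s i) = (\<Prod>i\<in>V. 1 + s i)"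
  using prod_add[OF assms, of s "\<lambda>_. 1"] by (simp add: add.commute)

text \<open>The sum over S is the expansion of the product of all
  \<open>1 + rad i A * rad i B\<close>, and one coordinate on which A and B differ makes this
  product vanish.\<close>

lemma sum_chi_chi:
  assumes "finite V" "A \<subseteq> V" "B \<subseteq> V"
  shows "(\<Sum>S\<in>Pow V. chi S A * chi S B) = (if A = B then 2 ^ card V else 0)"
proof -
  have "(\<Sum>S\<in>Pow V. chi S A * chi S B) = (\<Prod>i\<in>V. 1 + rad i A * rad i B)"
    using prod_plus_one[OF assms(1), of "\<lambda>i. rad i A * rad i B"]
    by (simp add: chi_def prod.distrib[symmetric])
  also have "\<dots> = (if A = B then 2 ^ card V else 0)"
  proof (cases "A = B")
    case False
    then obtain i where "i \<in> V" "i \<in> A \<longleftrightarrow> i \<notin> B"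
      using assms by blast
    then have "\<exists>i\<in>V. 1 + rad i A * rad i B = 0"
      by (intro bexI[of _ i]) (auto simp: rad_def)
    with False show ?thesis using assms(1) by simp
  next
    case True
    have "(\<Prod>i\<in>V. 1 + rad i A * rad i A) = (\<Prod>i\<in>V. 2)"
      by (intro prod.cong) (auto simp: rad_def)
    with True show ?thesis by simp
  qed
  finally show ?thesis .
qed

lemma fcoeff_inversion:
  assumes "finite V" "A \<subseteq> V"
  shows "(\<Sum>S\<in>Pow V. fcoeff V f S * chi S A) = f A"
proof -
  have "(\<Sum>S\<in>Pow V. fcoeff V f S * chi S A)
      = (\<Sum>S\<in>Pow V. \<Sum>B\<in>Pow V. f B * (chi S B * chi S A)) / 2 ^ card V"
    by (simp add: fcoeff_def cube_avg_def sum_divide_distrib sum_distrib_right mult.assoc)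
  also have "\<dots> = (\<Sum>B\<in>Pow V. f B * (\<Sum>S\<in>Pow V. chi S B * chi S A)) / 2 ^ card V"
    by (subst sum.swap) (simp add: sum_distrib_left)
  also have "\<dots> = (\<Sum>B\<in>Pow V. f B * (if B = A then 2 ^ card V else 0)) / 2 ^ card V"
    using assms by (intro arg_cong2[where f = "(/)"] sum.cong refl) (simp add: sum_chi_chi)
  also have "\<dots> = f A"
    using assms by (simp add: sum.delta if_distrib[where f = "\<lambda>x. _ * x"] cong: if_cong)
  finally show ?thesis .
qed

text \<open>One factor of each squared coefficient is written out as an average; summing over S then
  rebuilds f by the inversion formula.\<close>

lemma parseval:
  assumes "finite V"
  shows "(\<Sum>S\<in>Pow V. (fcoeff V f S)\<^sup>2) = cube_avg V (\<lambda>A. (f A)\<^sup>2)"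
proof -
  have "(\<Sum>S\<in>Pow V. (fcoeff V f S)\<^sup>2)
      = (\<Sum>S\<in>Pow V. cube_avg V (\<lambda>A. f A * (fcoeff V f S * chi S A)))"
    by (simp add: power2_eq_square cube_avg_cmult[symmetric])
       (simp add: fcoeff_def cube_avg_cmult[symmetric] mult_ac)
  also have "\<dots> = cube_avg V (\<lambda>A. f A * (\<Sum>S\<in>Pow V. fcoeff V f S * chi S A))"
    by (simp add: cube_avg_sum[symmetric] sum_distrib_left)
  also have "\<dots> = cube_avg V (\<lambda>A. (f A)\<^sup>2)"
    by (intro cube_avg_cong) (simp add: fcoeff_inversion[OF assms] power2_eq_square)
  finally show ?thesis .
qed

text \<open>If i lies in exactly one of S and T, the product is, up to sign, \<open>rad i\<close>
  times a function that ignores i, and its average is 0.\<close>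

lemma chi_orthonormal:
  assumes "finite V" "S \<subseteq> V" "T \<subseteq> V"
  shows "cube_avg V (\<lambda>A. chi S A * chi T A) = (if S = T then 1 else 0)"
proof (cases "S = T")
  case True
  then show ?thesis
    using assms by (simp add: chi_square finite_subset cube_avg_const)
next
  case False
  have *: "cube_avg V (\<lambda>A. chi S A * chi T A) = 0"
    if "i \<in> S" "i \<notin> T" "S \<subseteq> V" "T \<subseteq> V" for i S T
  proof -
    have "chi S A = - rad i A * chi (S - {i}) A" for A
      using chi_insert[of "S - {i}" i A] that assms
      by (metis Diff_iff finite_Diff finite_subset insertCI insert_Diff)
    then have "cube_avg V (\<lambda>A. chi S A * chi T A)
        = - cube_avg V (\<lambda>A. rad i A * (chi (S - {i}) A * chi T A))"
      by (simp add: cube_avg_uminus mult_ac)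
    also have "\<dots> = 0"
      using that assms by (subst cube_avg_rad_ignores) (auto intro!: ignores_mult ignores_chi)
    finally show ?thesis .
  qed
  from False obtain i where "i \<in> S \<and> i \<notin> T \<or> i \<in> T \<and> i \<notin> S" by auto
  then show ?thesis
    using *[of i S T] *[of i T S] assms False by (auto simp: mult.commute)
qed

section \<open>Fourier coefficients of discrete derivatives\<close>

lemma fcoeff_gain:
  assumes "finite V" "i \<in> V" "S \<subseteq> V"
  shows "fcoeff V (gain f i) S = (if i \<in> S then 0 else - 2 * fcoeff V f (insert i S))"
proof (cases "i \<in> S")
  case True
  have "chi S A = - rad i A * chi (S - {i}) A" for A
    using chi_insert[of "S - {i}" i A] True assms
    by (metis Diff_iff finite_Diff finite_subset insertCI insert_Diff)
  then have "fcoeff V (gain f i) S = - cube_avg V (\<lambda>A. rad i A * (chi (S - {i}) A * gain f i A))"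
    by (simp add: fcoeff_def cube_avg_uminus[symmetric] mult_ac)
  also have "\<dots> = 0"
    using assms by (simp add: cube_avg_rad gain_mult_ignores ignores_chi gain_eq_0 ignores_gain cube_avg_const)
  finally show ?thesis using True by simp
next
  case False
  have "fcoeff V f (insert i S) = - cube_avg V (\<lambda>A. rad i A * (chi S A * f A))"
    using False assms finite_subset[OF assms(3,1)]
    by (simp add: fcoeff_def chi_insert cube_avg_uminus[symmetric] mult_ac)
  also have "\<dots> = - cube_avg V (\<lambda>A. chi S A * gain f i A) / 2"
    using False assms by (simp add: cube_avg_rad gain_mult_ignores ignores_chi)
  finally show ?thesis using False by (simp add: fcoeff_def mult.commute)
qed

text \<open>A set T arises as \<open>insert i S\<close> once for each of its elements i, with S one
  element smaller; the factor 4 is the square of the -2 in \<open>fcoeff_gain\<close>. The weight c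
  stays free because the identity is used twice below, with c = 1 for the derivative in j and c(k) =
  k for the one in i.\<close>

lemma sum_fcoeff_gain:
  fixes c :: "nat \<Rightarrow> real"
  assumes "finite V"
  shows "(\<Sum>i\<in>V. \<Sum>S\<in>Pow V. c (card S) * (fcoeff V (gain f i) S)\<^sup>2)
       = 4 * (\<Sum>T\<in>Pow V. card T * c (card T - 1) * (fcoeff V f T)\<^sup>2)"
proof -
  have "(\<Sum>S\<in>Pow V. c (card S) * (fcoeff V (gain f i) S)\<^sup>2)
      = (\<Sum>T\<in>Pow V. if i \<in> T then 4 * c (card T - 1) * (fcoeff V f T)\<^sup>2 else 0)"
    if "i \<in> V" for i
  proof -
    define U where "U = V - {i}"
    have U: "V = insert i U" "i \<notin> U" "finite U"
      using assms that by (auto simp: U_def)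
    have 1: "c (card S) * (fcoeff V (gain f i) S)\<^sup>2
        = 4 * c (card (insert i S) - 1) * (fcoeff V f (insert i S))\<^sup>2" if "S \<in> Pow U" for S
    proof -
      have "i \<notin> S" "S \<subseteq> V" "finite S" using that U finite_subset by auto
      then show ?thesis
        using fcoeff_gain[OF assms \<open>i \<in> V\<close>, of S f] by (simp add: power2_eq_square)
    qed
    have 2: "fcoeff V (gain f i) (insert i S) = 0" if "S \<in> Pow U" for S
      using that U fcoeff_gain[OF assms \<open>i \<in> V\<close>, of "insert i S" f] by auto
    have "(\<Sum>S\<in>Pow V. c (card S) * (fcoeff V (gain f i) S)\<^sup>2)
        = (\<Sum>S\<in>Pow U. c (card S) * (fcoeff V (gain f i) S)\<^sup>2)"
      unfolding sum_Pow_insert[OF U(3,2), folded U(1)] using 2 by simp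
    also have "\<dots> = (\<Sum>S\<in>Pow U. 4 * c (card (insert i S) - 1) * (fcoeff V f (insert i S))\<^sup>2)"
      using 1 by (intro sum.cong) auto
    also have "\<dots> = (\<Sum>T\<in>Pow V. if i \<in> T then 4 * c (card T - 1) * (fcoeff V f T)\<^sup>2 else 0)"
    proof -
      have "(\<Sum>S\<in>Pow U. if i \<in> S then 4 * c (card S - 1) * (fcoeff V f S)\<^sup>2 else 0) = 0"
        by (intro sum.neutral) (use U in auto)
      then show ?thesis
        unfolding sum_Pow_insert[OF U(3,2), folded U(1)] by simp
    qed
    finally show ?thesis .
  qed
  then have "(\<Sum>i\<in>V. \<Sum>S\<in>Pow V. c (card S) * (fcoeff V (gain f i) S)\<^sup>2)
      = (\<Sum>i\<in>V. \<Sum>T\<in>Pow V. if i \<in> T then 4 * c (card T - 1) * (fcoeff V f T)\<^sup>2 else 0)"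
    by simp
  also have "\<dots> = (\<Sum>T\<in>Pow V. \<Sum>i\<in>V. if i \<in> T then 4 * c (card T - 1) * (fcoeff V f T)\<^sup>2 else 0)"
    by (rule sum.swap)
  also have "\<dots> = (\<Sum>T\<in>Pow V. 4 * (card T * c (card T - 1) * (fcoeff V f T)\<^sup>2))"
    using assms by (intro sum.cong refl) (simp add: sum.If_cases Int_absorb1)
  finally show ?thesis by (simp add: sum_distrib_left)
qed

lemma sum_second_gain:
  assumes "finite V"
  shows "(\<Sum>i\<in>V. \<Sum>j\<in>V. cube_avg V (\<lambda>A. (gain (gain f i) j A)\<^sup>2))
       = 16 * (\<Sum>T\<in>Pow V. card T * (card T - 1) * (fcoeff V f T)\<^sup>2)"
proof -
  have "(\<Sum>j\<in>V. cube_avg V (\<lambda>A. (gain g j A)\<^sup>2)) = 4 * (\<Sum>S\<in>Pow V. card S * (fcoeff V g S)\<^sup>2)"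
    for g :: "'a set \<Rightarrow> real"
    using sum_fcoeff_gain[OF assms, of "\<lambda>_. 1" g] by (simp add: parseval[OF assms])
  then have "(\<Sum>i\<in>V. \<Sum>j\<in>V. cube_avg V (\<lambda>A. (gain (gain f i) j A)\<^sup>2))
      = 4 * (\<Sum>i\<in>V. \<Sum>S\<in>Pow V. card S * (fcoeff V (gain f i) S)\<^sup>2)"
    by (simp add: sum_distrib_left)
  then show ?thesis
    using sum_fcoeff_gain[OF assms, of real f] by simp
qed

section \<open>Second differences of Lipschitz submodular functions\<close>

lemma ignores_eqI: "ignores i f \<Longrightarrow> A - {i} = B - {i} \<Longrightarrow> f A = f B"
  using ignores_Diff[of i f A] ignores_Diff[of i f B] by simp

text \<open>Membership of i is a fair coin, independent of any function that ignores i.\<close>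

lemma cube_avg_if_member:
  assumes "finite V" "i \<in> V" "ignores i f"
  shows "cube_avg V (\<lambda>A. if i \<in> A then f A else 0) = cube_avg V f / 2"
    and "cube_avg V (\<lambda>A. if i \<in> A then 0 else f A) = cube_avg V f / 2"
proof -
  have "f (insert i A) = f A" "f (A - {i}) = f A" for A
    by (rule ignores_eqI[OF assms(3)], simp)+
  moreover have "cube_avg V (\<lambda>_. 0) = 0" by (simp add: cube_avg_def)
  ultimately show "cube_avg V (\<lambda>A. if i \<in> A then f A else 0) = cube_avg V f / 2"
    and "cube_avg V (\<lambda>A. if i \<in> A then 0 else f A) = cube_avg V f / 2"
    by (subst cube_avg_split[OF assms(1,2)], simp)+
qed

lemma cube_avg_compl:
  assumes "finite V"
  shows "cube_avg V (\<lambda>A. f (V - A)) = cube_avg V f"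
proof -
  have "(\<Sum>A\<in>Pow V. f (V - A)) = (\<Sum>A\<in>Pow V. f A)"
    by (rule sum.reindex_bij_witness[of _ "\<lambda>A. V - A" "\<lambda>A. V - A"]) auto
  then show ?thesis by (simp add: cube_avg_def)
qed

section \<open>Marginal gains of submodular functions\<close>

lemma submodularD:
  "submodular n f \<Longrightarrow> A \<subseteq> {..<n} \<Longrightarrow> B \<subseteq> {..<n} \<Longrightarrow> f (A \<union> B) + f (A \<inter> B) \<le> f A + f B"
  by (simp add: submodular_def)

text \<open>Diminishing returns: submodularity for \<open>insert i A\<close> and
  \<open>B - {i}\<close>, whose union is \<open>insert i B\<close> and whose intersection is
  \<open>A - {i}\<close>.\<close>

lemma gain_antimono:
  assumes "submodular n f" "A \<subseteq> B" "B \<subseteq> {..<n}" "i < n"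
  shows "gain f i B \<le> gain f i A"
proof -
  have "insert i A \<union> (B - {i}) = insert i B" "insert i A \<inter> (B - {i}) = A - {i}"
    using assms by auto
  moreover have "insert i A \<subseteq> {..<n}" "B - {i} \<subseteq> {..<n}" using assms by auto
  ultimately show ?thesis
    using submodularD[OF assms(1), of "insert i A" "B - {i}"] by (simp add: gain_def)
qed

text \<open>Complementation exchanges bottom and top and negates gains, so bounds on negative gains
  will follow from those on positive gains.\<close>

lemma submodular_compl: "submodular n f \<Longrightarrow> submodular n (\<lambda>A. f ({..<n} - A))"
  unfolding submodular_def by (simp add: Diff_Un Diff_Int add.commute)

lemma gain_compl:
  assumes "A \<subseteq> {..<n}" "i < n"
  shows "gain (\<lambda>A. f ({..<n} - A)) i ({..<n} - A) = - gain f i A"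
proof -
  have "{..<n} - insert i ({..<n} - A) = A - {i}" "{..<n} - ({..<n} - A - {i}) = insert i A"
    using assms by auto
  then show ?thesis by (simp add: gain_def)
qed

text \<open>Remove the elements of T one at a time. By diminishing returns each removal lowers f by
  at least the gain at A, and the drops telescope.\<close>

lemma sum_gain_le:
  assumes "submodular n f" "A \<subseteq> {..<n}" "T \<subseteq> A"
  shows "(\<Sum>i\<in>T. gain f i A) \<le> f A - f (A - T)"
proof -
  have "finite T" using finite_subset[OF assms(3)] finite_subset[OF assms(2)] by simp
  from this assms(3) show ?thesis
  proof (induction T rule: finite_induct)
    case (insert i T)
    have "i < n" using insert.prems assms(2) by auto
    then have "gain f i A \<le> gain f i (A - T)"
      using assms(2) by (intro gain_antimono[OF assms(1)]) auto
    also have "\<dots> = f (A - T) - f (A - insert i T)"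
    proof -
      have "insert i (A - T) = A - T" "A - T - {i} = A - insert i T"
        using insert.hyps(2) insert.prems by auto
      then show ?thesis by (simp add: gain_def)
    qed
    finally show ?case using insert.IH insert.prems insert.hyps by simp
  qed simp
qed

definition pgain :: "('a set \<Rightarrow> real) \<Rightarrow> 'a \<Rightarrow> 'a set \<Rightarrow> real" where
  "pgain f i A = max 0 (gain f i A)"

definition ngain :: "('a set \<Rightarrow> real) \<Rightarrow> 'a \<Rightarrow> 'a set \<Rightarrow> real" where
  "ngain f i A = max 0 (- gain f i A)"

lemma submodular_classD:
  assumes "f \<in> submodular_class n"
  shows "submodular n f" "A \<subseteq> {..<n} \<Longrightarrow> 0 \<le> f A" "A \<subseteq> {..<n} \<Longrightarrow> f A \<le> 1"
  using assms by (auto simp: submodular_class_def)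

lemma submodular_class_compl:
  "f \<in> submodular_class n \<Longrightarrow> (\<lambda>A. f ({..<n} - A)) \<in> submodular_class n"
  by (auto simp: submodular_class_def submodular_compl)

text \<open>The elements of A with positive gain can be removed together, and the resulting drop of
  f is at most 1.\<close>

lemma sum_pgain_le_1:
  assumes "f \<in> submodular_class n" "A \<subseteq> {..<n}"
  shows "(\<Sum>i\<in>A. pgain f i A) \<le> 1"
proof -
  define T where "T = {i \<in> A. gain f i A > 0}"
  have "finite A" using finite_subset[OF assms(2)] by simp
  then have "(\<Sum>i\<in>A. pgain f i A) = (\<Sum>i\<in>T. gain f i A)"
    unfolding T_def by (subst sum.inter_filter) (auto simp: pgain_def intro!: sum.cong)
  also have "\<dots> \<le> f A - f (A - T)"
    using assms by (intro sum_gain_le) (auto simp: T_def submodular_classD)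
  also have "\<dots> \<le> 1"
    using submodular_classD[OF assms(1)] assms(2) by (smt (verit) Diff_subset order_trans)
  finally show ?thesis .
qed

lemma ngain_compl:
  assumes "A \<subseteq> {..<n}" "i < n"
  shows "ngain f i A = pgain (\<lambda>A. f ({..<n} - A)) i ({..<n} - A)"
  unfolding ngain_def pgain_def gain_compl[OF assms] ..

lemma sum_ngain_le_1:
  assumes "f \<in> submodular_class n" "A \<subseteq> {..<n}"
  shows "(\<Sum>i\<in>{..<n} - A. ngain f i A) \<le> 1"
proof -
  have "(\<Sum>i\<in>{..<n} - A. ngain f i A)
      = (\<Sum>i\<in>{..<n} - A. pgain (\<lambda>A. f ({..<n} - A)) i ({..<n} - A))"
    using assms(2) by (intro sum.cong refl ngain_compl) auto
  then show ?thesis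
    using sum_pgain_le_1[OF submodular_class_compl[OF assms(1)], of "{..<n} - A"] by simp
qed

section \<open>Gains and their spread on random subcubes\<close>

lemma ignores_pgain: "ignores i (pgain f i)" and ignores_ngain: "ignores i (ngain f i)"
  using ignores_gain[of i f] unfolding ignores_def pgain_def ngain_def by auto

text \<open>The i-th gain at \<open>x - J\<close> depends neither on i being in x nor on i being in
  J. So i in J may be replaced by i not in J, and then i in x may be required at the cost of a
  factor 2. What remains is a sum over the elements of \<open>x - J\<close>, at most 1 by
  \<open>sum_pgain_le_1\<close>.\<close>

lemma cube_avg_pgain_restricted:
  assumes f: "f \<in> submodular_class n"
  shows "cube_avg {..<n} (\<lambda>J. cube_avg {..<n} (\<lambda>x. \<Sum>i\<in>J. pgain f i (x - J))) \<le> 2"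
proof -
  let ?V = "{..<n}" and ?E = "cube_avg {..<n}"
  have ignJ: "ignores i (\<lambda>J. pgain f i (x - J))" for i x
    unfolding ignores_def by (intro allI ignores_eqI[OF ignores_pgain]) auto
  have ignx: "ignores i (\<lambda>x. pgain f i (x - J))" for i J
    unfolding ignores_def by (intro allI ignores_eqI[OF ignores_pgain]) auto
  have 1: "?E (\<lambda>J. ?E (\<lambda>x. if i \<in> J then pgain f i (x - J) else 0))
      = 2 * ?E (\<lambda>J. ?E (\<lambda>x. if i \<in> x - J then pgain f i (x - J) else 0))" if "i < n" for i
  proof -
    have "?E (\<lambda>J. ?E (\<lambda>x. if i \<in> J then pgain f i (x - J) else 0))
        = ?E (\<lambda>x. ?E (\<lambda>J. if i \<in> J then pgain f i (x - J) else 0))"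
      by (rule cube_avg_swap)
    also have "\<dots> = ?E (\<lambda>x. ?E (\<lambda>J. if i \<in> J then 0 else pgain f i (x - J)))"
      using that by (simp add: cube_avg_if_member ignJ)
    also have "\<dots> = ?E (\<lambda>J. ?E (\<lambda>x. if i \<in> J then 0 else pgain f i (x - J)))"
      by (rule cube_avg_swap)
    also have "\<dots> = ?E (\<lambda>J. 2 * ?E (\<lambda>x. if i \<in> x - J then pgain f i (x - J) else 0))"
    proof (rule cube_avg_cong)
      fix J
      have "?E (\<lambda>x. if i \<in> x then pgain f i (x - J) else 0) = ?E (\<lambda>x. pgain f i (x - J)) / 2"
        using that by (simp add: cube_avg_if_member ignx)
      then show "?E (\<lambda>x. if i \<in> J then 0 else pgain f i (x - J))
          = 2 * ?E (\<lambda>x. if i \<in> x - J then pgain f i (x - J) else 0)"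
        by (cases "i \<in> J") (simp_all add: cube_avg_const)
    qed
    finally show ?thesis by (simp add: cube_avg_cmult)
  qed
  have "?E (\<lambda>J. ?E (\<lambda>x. \<Sum>i\<in>J. pgain f i (x - J)))
      = ?E (\<lambda>J. ?E (\<lambda>x. \<Sum>i\<in>?V. if i \<in> J then pgain f i (x - J) else 0))"
    by (intro cube_avg_cong) (simp add: sum.If_cases Int_absorb1 Int_absorb2)
  also have "\<dots> = (\<Sum>i\<in>?V. ?E (\<lambda>J. ?E (\<lambda>x. if i \<in> J then pgain f i (x - J) else 0)))"
    by (simp add: cube_avg_sum)
  also have "\<dots> = (\<Sum>i\<in>?V. 2 * ?E (\<lambda>J. ?E (\<lambda>x. if i \<in> x - J then pgain f i (x - J) else 0)))"
    by (intro sum.cong refl 1) simp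
  also have "\<dots> = 2 * ?E (\<lambda>J. ?E (\<lambda>x. \<Sum>i\<in>?V. if i \<in> x - J then pgain f i (x - J) else 0))"
    by (simp add: cube_avg_sum sum_distrib_left)
  also have "?E (\<lambda>J. ?E (\<lambda>x. \<Sum>i\<in>?V. if i \<in> x - J then pgain f i (x - J) else 0))
      \<le> ?E (\<lambda>J. ?E (\<lambda>x. 1))"
  proof (intro cube_avg_mono)
    fix J x assume "x \<subseteq> ?V"
    then have "x - J \<subseteq> ?V" by auto
    then have "(\<Sum>i\<in>?V. if i \<in> x - J then pgain f i (x - J) else 0) = (\<Sum>i\<in>x - J. pgain f i (x - J))"
      by (subst sum.inter_restrict[symmetric]) (auto intro: sum.cong)
    also have "\<dots> \<le> 1" using \<open>x - J \<subseteq> ?V\<close> by (rule sum_pgain_le_1[OF f])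
    finally show "(\<Sum>i\<in>?V. if i \<in> x - J then pgain f i (x - J) else 0) \<le> 1" .
  qed
  also have "?E (\<lambda>J. ?E (\<lambda>x. 1)) = 1" by (simp add: cube_avg_const)
  finally show ?thesis by simp
qed

lemma cube_avg_ngain_restricted:
  assumes f: "f \<in> submodular_class n"
  shows "cube_avg {..<n} (\<lambda>J. cube_avg {..<n} (\<lambda>x. \<Sum>i\<in>J. ngain f i (x \<union> J))) \<le> 2"
proof -
  let ?V = "{..<n}" and ?f = "\<lambda>A. f ({..<n} - A)"
  have "cube_avg ?V (\<lambda>x. \<Sum>i\<in>J. ngain f i (x \<union> J))
      = cube_avg ?V (\<lambda>x. \<Sum>i\<in>J. pgain ?f i (x - J))" if J: "J \<subseteq> ?V" for J
  proof -
    have "cube_avg ?V (\<lambda>x. \<Sum>i\<in>J. ngain f i (x \<union> J))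
        = cube_avg ?V (\<lambda>x. \<Sum>i\<in>J. pgain ?f i ((?V - x) - J))"
    proof (intro cube_avg_cong sum.cong refl)
      fix x i assume "x \<subseteq> ?V" "i \<in> J"
      moreover have "?V - (x \<union> J) = (?V - x) - J" by auto
      ultimately show "ngain f i (x \<union> J) = pgain ?f i ((?V - x) - J)"
        using J by (subst ngain_compl[of _ n]) auto
    qed
    also have "\<dots> = cube_avg ?V (\<lambda>x. \<Sum>i\<in>J. pgain ?f i (x - J))"
      using cube_avg_compl[of ?V "\<lambda>x. \<Sum>i\<in>J. pgain ?f i (x - J)"] by simp
    finally show ?thesis .
  qed
  then have "cube_avg ?V (\<lambda>J. cube_avg ?V (\<lambda>x. \<Sum>i\<in>J. ngain f i (x \<union> J)))
      = cube_avg ?V (\<lambda>J. cube_avg ?V (\<lambda>x. \<Sum>i\<in>J. pgain ?f i (x - J)))"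
    by (rule cube_avg_cong)
  then show ?thesis
    using cube_avg_pgain_restricted[OF submodular_class_compl[OF f]] by simp
qed

text \<open>\<open>x - J\<close> and \<open>x \<union> J\<close> are the bottom and top of the
  subcube through x with the coordinates in J free. For submodular f this is the full range of the
  i-th gain on it.\<close>

definition spread :: "('a set \<Rightarrow> real) \<Rightarrow> 'a set \<Rightarrow> 'a \<Rightarrow> 'a set \<Rightarrow> real" where
  "spread f J i x = gain f i (x - J) - gain f i (x \<union> J)"

lemma ignores_spread: "k \<in> J \<Longrightarrow> ignores k (spread f J i)"
proof -
  assume "k \<in> J"
  then have "insert k A - J = A - {k} - J" "insert k A \<union> J = (A - {k}) \<union> J" for A by auto
  then show ?thesis by (simp add: ignores_def spread_def)
qed

lemma spread_le: "spread f J i x \<le> pgain f i (x - J) + ngain f i (x \<union> J)"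
  by (simp add: spread_def pgain_def ngain_def)

lemma cube_avg_spread:
  assumes f: "f \<in> submodular_class n"
  shows "cube_avg {..<n} (\<lambda>J. cube_avg {..<n} (\<lambda>x. \<Sum>i\<in>J. spread f J i x)) \<le> 4"
proof -
  have "cube_avg {..<n} (\<lambda>J. cube_avg {..<n} (\<lambda>x. \<Sum>i\<in>J. spread f J i x))
      \<le> cube_avg {..<n} (\<lambda>J. cube_avg {..<n} (\<lambda>x. \<Sum>i\<in>J. pgain f i (x - J) + ngain f i (x \<union> J)))"
    by (intro cube_avg_mono sum_mono spread_le)
  also have "\<dots> \<le> 4"
    using cube_avg_pgain_restricted[OF f] cube_avg_ngain_restricted[OF f]
    by (simp add: sum.distrib cube_avg_add)
  finally show ?thesis .
qed

text \<open>The second difference compares the i-th gain at two points of the subcube, so it cannot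
  exceed the range of that gain. Symmetry in i and j gives the other bound.\<close>

lemma gain_gain_le_spread:
  assumes "submodular n f" "J \<subseteq> {..<n}" "x \<subseteq> {..<n}" "i \<in> J" "j \<in> J"
  shows "- gain (gain f i) j x \<le> spread f J i x" "- gain (gain f i) j x \<le> spread f J j x"
    "gain (gain f i) j x \<le> 0"
proof -
  have *: "- gain (gain f i) j x \<le> spread f J i x" if "i \<in> J" "j \<in> J" for i j
  proof -
    have "gain f i (x - {j}) \<le> gain f i (x - J)" "gain f i (x \<union> J) \<le> gain f i (insert j x)"
      using that assms by (auto intro!: gain_antimono[OF assms(1)])
    then show ?thesis by (simp add: spread_def gain_def[of "gain f i"])
  qed
  show "- gain (gain f i) j x \<le> spread f J i x" using * assms by blast
  show "- gain (gain f i) j x \<le> spread f J j x" using *[of j i] assms by (simp add: gain_commute)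
  have "gain f i (insert j x) \<le> gain f i (x - {j})"
    using assms by (auto intro!: gain_antimono[OF assms(1)])
  then show "gain (gain f i) j x \<le> 0" by (simp add: gain_def[of "gain f i"])
qed

text \<open>The weights \<open>w\<close> are square roots of spreads and ignore every coordinate in
  J, so they pass through derivatives in these directions. The Lipschitz assumption enters through
  \<open>w i x \<le> W\<close>. The mean spread stays on the right, as it is under control only
  after averaging over J.\<close>

lemma sum_second_gain_restricted:
  assumes f: "f \<in> submodular_class n" and J: "J \<subseteq> {..<n}"
    and lip: "\<And>i A. i < n \<Longrightarrow> A \<subseteq> {..<n} \<Longrightarrow> \<bar>gain f i A\<bar> \<le> \<alpha>"
    and W: "W = sqrt (2 * \<alpha>)" and "0 \<le> \<alpha>"
  shows "(\<Sum>i\<in>J. \<Sum>j\<in>J. cube_avg {..<n} (\<lambda>x. (gain (gain f i) j x)\<^sup>2))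
      \<le> 4 * W * (1 + 2 * W + cube_avg {..<n} (\<lambda>x. \<Sum>i\<in>J. spread f J i x))"
proof -
  let ?E = "cube_avg {..<n}"
  define w where "w i x = sqrt (spread f J i x)" for i x
  \<comment> \<open>The term of i itself is left out so that \<open>Zi i\<close> ignores i; the
    price is a difference of at most W from Z.\<close>
  define Zi where "Zi i x = (\<Sum>j\<in>J - {i}. w j x * rad j x)" for i x
  define Z where "Z x = (\<Sum>j\<in>J. w j x * rad j x)" for x
  have sub: "submodular n f" using f by (rule submodular_classD)
  have finJ: "finite J" using finite_subset[OF J] by simp
  have W0: "W \<ge> 0" using W \<open>0 \<le> \<alpha>\<close> by simp
  have ignw: "ignores k (w i)" if "k \<in> J" for k i
    using ignores_spread[OF that, of f i] by (simp add: w_def[abs_def] ignores_def)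
  have spread0: "spread f J i x \<ge> 0" if "i \<in> J" "x \<subseteq> {..<n}" for i x
    using gain_gain_le_spread(1,3)[OF sub J that(2,1,1)] by linarith
  have w0: "w i x \<ge> 0" if "i \<in> J" "x \<subseteq> {..<n}" for i x
    using spread0[OF that] by (simp add: w_def)
  have wW: "w i x \<le> W" if "i \<in> J" "x \<subseteq> {..<n}" for i x
  proof -
    have "i < n" "x - J \<subseteq> {..<n}" "x \<union> J \<subseteq> {..<n}" using that J by auto
    then have "spread f J i x \<le> 2 * \<alpha>"
      using lip[of i "x - J"] lip[of i "x \<union> J"] by (simp add: spread_def)
    then show ?thesis by (simp add: w_def W)
  qed
  \<comment> \<open>Minus the second difference is at most both spreads, hence at most their
    geometric mean \<open>w i x * w j x\<close>; multiply by it once more.\<close>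
  have sq: "(gain (gain f i) j x)\<^sup>2 \<le> - (w i x * w j x * gain (gain f i) j x)"
    if "i \<in> J" "j \<in> J" "x \<subseteq> {..<n}" for i j x
  proof -
    define h where "h = - gain (gain f i) j x"
    have "h \<ge> 0" "h \<le> spread f J i x" "h \<le> spread f J j x"
      using gain_gain_le_spread[OF sub J that(3,1,2)] by (auto simp: h_def)
    then have "sqrt h * sqrt h \<le> w i x * w j x"
      unfolding w_def by (intro mult_mono) auto
    then have "h * h \<le> w i x * w j x * h"
      using \<open>h \<ge> 0\<close> by (intro mult_right_mono) auto
    then show ?thesis by (simp add: h_def power2_eq_square)
  qed
  \<comment> \<open>The weights move inside the derivative in j, and \<open>cube_avg_rad\<close>,
    read from right to left, trades this derivative for the sign of j.\<close>
  have pair: "?E (\<lambda>x. (gain (gain f i) j x)\<^sup>2) \<le> - 2 * ?E (\<lambda>x. w i x * gain f i x * (w j x * rad j x))"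
    if "i \<in> J" "j \<in> J" for i j
  proof -
    have "?E (\<lambda>x. (gain (gain f i) j x)\<^sup>2) \<le> ?E (\<lambda>x. - (w i x * w j x * gain (gain f i) j x))"
      using sq that by (intro cube_avg_mono)
    also have "\<dots> = - ?E (gain (\<lambda>x. (w i x * w j x) * gain f i x) j)"
      using that by (simp add: cube_avg_uminus gain_mult_ignores ignw ignores_mult)
    also have "\<dots> = - 2 * ?E (\<lambda>x. rad j x * ((w i x * w j x) * gain f i x))"
      using that J by (subst cube_avg_rad) auto
    also have "(\<lambda>x. rad j x * ((w i x * w j x) * gain f i x)) = (\<lambda>x. w i x * gain f i x * (w j x * rad j x))"
      by (simp add: fun_eq_iff)
    finally show ?thesis .
  qed
  have row: "(\<Sum>j\<in>J. ?E (\<lambda>x. (gain (gain f i) j x)\<^sup>2))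
      \<le> 4 * W * ?E (\<lambda>x. ((if i \<in> x then pgain f i x else 0) + (if i \<in> x then 0 else ngain f i x)) * (\<bar>Z x\<bar> + W))"
    if i: "i \<in> J" for i
  proof -
    have i': "i \<in> {..<n}" using i J by auto
    have "?E (\<lambda>x. (gain (gain f i) i x)\<^sup>2) = 0"
      by (simp add: gain_eq_0 ignores_gain cube_avg_const)
    then have "(\<Sum>j\<in>J. ?E (\<lambda>x. (gain (gain f i) j x)\<^sup>2)) = (\<Sum>j\<in>J - {i}. ?E (\<lambda>x. (gain (gain f i) j x)\<^sup>2))"
      using i finJ by (simp add: sum.remove)
    also have "\<dots> \<le> (\<Sum>j\<in>J - {i}. - 2 * ?E (\<lambda>x. w i x * gain f i x * (w j x * rad j x)))"
      using i by (intro sum_mono pair) auto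
    also have "\<dots> = 2 * ?E (\<lambda>x. - (w i x * gain f i x * Zi i x))"
      by (simp add: Zi_def cube_avg_uminus sum_distrib_left cube_avg_sum sum_negf)
    also have "?E (\<lambda>x. - (w i x * gain f i x * Zi i x))
        \<le> ?E (\<lambda>x. w i x * pgain f i x * \<bar>Zi i x\<bar> + w i x * ngain f i x * \<bar>Zi i x\<bar>)"
    proof (intro cube_avg_mono)
      fix x assume "x \<subseteq> {..<n}"
      have "- (w i x * gain f i x * Zi i x) \<le> \<bar>w i x * gain f i x * Zi i x\<bar>" by simp
      also have "\<dots> = w i x * pgain f i x * \<bar>Zi i x\<bar> + w i x * ngain f i x * \<bar>Zi i x\<bar>"
        using w0[OF i \<open>x \<subseteq> {..<n}\<close>] by (auto simp: abs_mult pgain_def ngain_def max_def)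
      finally show "- (w i x * gain f i x * Zi i x)
        \<le> w i x * pgain f i x * \<bar>Zi i x\<bar> + w i x * ngain f i x * \<bar>Zi i x\<bar>" .
    qed
    \<comment> \<open>Both terms ignore i, so positive gains may be charged to i in x and negative
      ones to i outside x, at the cost of a factor 2. These are the parts that
      \<open>sum_pgain_le_1\<close> and \<open>sum_ngain_le_1\<close> control.\<close>
    also have "\<dots> = 2 * ?E (\<lambda>x. (if i \<in> x then w i x * pgain f i x * \<bar>Zi i x\<bar> else 0)
        + (if i \<in> x then 0 else w i x * ngain f i x * \<bar>Zi i x\<bar>))"
    proof -
      have "ignores i (Zi i)"
        unfolding Zi_def using i
        by (intro ignores_sum ignores_mult ignw ignores_rad) auto
      then have "ignores i (\<lambda>x. \<bar>Zi i x\<bar>)" by (rule ignores_comp)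
      then have *: "ignores i (\<lambda>x. w i x * pgain f i x * \<bar>Zi i x\<bar>)"
          "ignores i (\<lambda>x. w i x * ngain f i x * \<bar>Zi i x\<bar>)"
        using ignores_mult[OF ignores_mult[OF ignw[OF i] ignores_pgain]]
          ignores_mult[OF ignores_mult[OF ignw[OF i] ignores_ngain]] by blast+
      show ?thesis
        using cube_avg_if_member(1)[OF finite_lessThan i' *(1)]
          cube_avg_if_member(2)[OF finite_lessThan i' *(2)] by (simp add: cube_avg_add)
    qed
    also have "?E (\<lambda>x. (if i \<in> x then w i x * pgain f i x * \<bar>Zi i x\<bar> else 0)
        + (if i \<in> x then 0 else w i x * ngain f i x * \<bar>Zi i x\<bar>))
      \<le> ?E (\<lambda>x. W * (((if i \<in> x then pgain f i x else 0) + (if i \<in> x then 0 else ngain f i x)) * (\<bar>Z x\<bar> + W)))"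
    proof (intro cube_avg_mono)
      fix x assume x: "x \<subseteq> {..<n}"
      have "Z x = w i x * rad i x + Zi i x"
        using i finJ by (simp add: Z_def Zi_def sum.remove)
      moreover have "\<bar>w i x * rad i x\<bar> \<le> W"
        using wW[OF i x] w0[OF i x] by (simp add: rad_def)
      ultimately have Zi: "\<bar>Zi i x\<bar> \<le> \<bar>Z x\<bar> + W" by linarith
      have *: "w i x * g * \<bar>Zi i x\<bar> \<le> W * (g * (\<bar>Z x\<bar> + W))" if "0 \<le> g" for g
      proof -
        have "w i x * (g * \<bar>Zi i x\<bar>) \<le> W * (g * (\<bar>Z x\<bar> + W))"
          using wW[OF i x] w0[OF i x] that Zi W0 by (intro mult_mono mult_nonneg_nonneg) auto
        then show ?thesis by (simp add: mult.assoc)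
      qed
      have "0 \<le> pgain f i x" "0 \<le> ngain f i x" by (simp_all add: pgain_def ngain_def)
      then show "(if i \<in> x then w i x * pgain f i x * \<bar>Zi i x\<bar> else 0)
          + (if i \<in> x then 0 else w i x * ngain f i x * \<bar>Zi i x\<bar>)
        \<le> W * (((if i \<in> x then pgain f i x else 0) + (if i \<in> x then 0 else ngain f i x)) * (\<bar>Z x\<bar> + W))"
        using * by auto
    qed
    finally show ?thesis by (simp add: cube_avg_cmult)
  qed
  \<comment> \<open>For distinct j and k, everything but the sign of j ignores j, so the cross terms
    vanish.\<close>
  have EZ: "?E (\<lambda>x. (Z x)\<^sup>2) = ?E (\<lambda>x. \<Sum>i\<in>J. spread f J i x)"
  proof -
    have "?E (\<lambda>x. (w j x * rad j x) * (w k x * rad k x)) = (if j = k then ?E (spread f J j) else 0)"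
      if "j \<in> J" "k \<in> J" for j k
    proof (cases "j = k")
      case True
      have "?E (\<lambda>x. (w j x * rad j x) * (w j x * rad j x)) = ?E (spread f J j)"
        using spread0 that by (intro cube_avg_cong) (auto simp: w_def rad_def)
      then show ?thesis using True by simp
    next
      case False
      have "(\<lambda>x. (w j x * rad j x) * (w k x * rad k x)) = (\<lambda>x. rad j x * (w j x * (w k x * rad k x)))"
        by (simp add: fun_eq_iff)
      moreover have "ignores j (\<lambda>x. w j x * (w k x * rad k x))"
        using that False by (intro ignores_mult ignw ignores_rad) auto
      ultimately show ?thesis
        using that J False
        by (simp add: cube_avg_rad_ignores[OF finite_lessThan] subset_iff)
    qed
    then have "(\<Sum>j\<in>J. \<Sum>k\<in>J. ?E (\<lambda>x. (w j x * rad j x) * (w k x * rad k x)))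
        = (\<Sum>j\<in>J. ?E (spread f J j))"
      using finJ by (simp add: sum.delta' cong: sum.cong)
    then show ?thesis
      by (simp add: Z_def power2_eq_square sum_product cube_avg_sum)
  qed
  have "(\<Sum>i\<in>J. \<Sum>j\<in>J. ?E (\<lambda>x. (gain (gain f i) j x)\<^sup>2))
    \<le> (\<Sum>i\<in>J. 4 * W * ?E (\<lambda>x. ((if i \<in> x then pgain f i x else 0) + (if i \<in> x then 0 else ngain f i x)) * (\<bar>Z x\<bar> + W)))"
    by (intro sum_mono row)
  also have "\<dots> = 4 * W * ?E (\<lambda>x. (\<Sum>i\<in>J. (if i \<in> x then pgain f i x else 0) + (if i \<in> x then 0 else ngain f i x)) * (\<bar>Z x\<bar> + W))"
    by (simp add: cube_avg_sum sum_distrib_left sum_distrib_right)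
  also have "\<dots> \<le> 4 * W * ?E (\<lambda>x. 1 + 2 * W + (Z x)\<^sup>2)"
  proof (intro mult_left_mono cube_avg_mono)
    fix x assume x: "x \<subseteq> {..<n}"
    have "(\<Sum>i\<in>J. (if i \<in> x then pgain f i x else 0) + (if i \<in> x then 0 else ngain f i x))
        \<le> (\<Sum>i<n. (if i \<in> x then pgain f i x else 0) + (if i \<in> x then 0 else ngain f i x))"
      using J by (intro sum_mono2) (auto simp: pgain_def ngain_def)
    also have "\<dots> = (\<Sum>i\<in>x. pgain f i x) + (\<Sum>i\<in>{..<n} - x. ngain f i x)"
      using x by (simp add: sum.distrib sum.If_cases Int_absorb1 Diff_eq Collect_neg_eq)
    also have "\<dots> \<le> 2" using sum_pgain_le_1[OF f x] sum_ngain_le_1[OF f x] by simp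
    finally have "(\<Sum>i\<in>J. (if i \<in> x then pgain f i x else 0) + (if i \<in> x then 0 else ngain f i x)) * (\<bar>Z x\<bar> + W)
        \<le> 2 * (\<bar>Z x\<bar> + W)"
      using W0 by (intro mult_right_mono) auto
    \<comment> \<open>From (|Z| - 1)^2 \<ge> 0.\<close>
    also have "\<dots> \<le> 1 + 2 * W + (Z x)\<^sup>2"
      using zero_le_power2[of "\<bar>Z x\<bar> - 1"] by (simp add: power2_diff)
    finally show "(\<Sum>i\<in>J. (if i \<in> x then pgain f i x else 0) + (if i \<in> x then 0 else ngain f i x)) * (\<bar>Z x\<bar> + W)
        \<le> 1 + 2 * W + (Z x)\<^sup>2" .
  qed (use W0 in auto)
  also have "?E (\<lambda>x. 1 + 2 * W + (Z x)\<^sup>2) = 1 + 2 * W + ?E (\<lambda>x. \<Sum>i\<in>J. spread f J i x)"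
    using EZ by (simp add: cube_avg_add cube_avg_const)
  finally show ?thesis .
qed

text \<open>Average over a random J: a pair of distinct coordinates lies in J with probability 1/4,
  and the diagonal terms are 0.\<close>

lemma sum_second_gain_le:
  assumes f: "f \<in> submodular_class n"
    and lip: "\<And>i A. i < n \<Longrightarrow> A \<subseteq> {..<n} \<Longrightarrow> \<bar>gain f i A\<bar> \<le> \<alpha>"
    and "0 \<le> \<alpha>" "\<alpha> \<le> 1"
  shows "(\<Sum>i<n. \<Sum>j<n. cube_avg {..<n} (\<lambda>x. (gain (gain f i) j x)\<^sup>2)) \<le> 128 * sqrt (2 * \<alpha>)"
proof -
  let ?E = "cube_avg {..<n}"
  define W where "W = sqrt (2 * \<alpha>)"
  define q where "q i j = ?E (\<lambda>x. (gain (gain f i) j x)\<^sup>2)" for i j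
  have "W \<le> sqrt ((3 / 2)\<^sup>2)"
    unfolding W_def using assms(4) by (intro real_sqrt_le_mono) (simp add: power2_eq_square)
  then have W: "0 \<le> W" "W \<le> 3 / 2"
    using assms(3) by (simp_all add: W_def)
  have "?E (\<lambda>J. if i \<in> J then if j \<in> J then q i j else 0 else 0) = q i j / 4"
    if "i < n" "j < n" for i j
  proof (cases "i = j")
    case True
    then have "q i j = 0"
      by (simp add: q_def gain_eq_0 ignores_gain cube_avg_const)
    with True have "(\<lambda>J. if i \<in> J then if j \<in> J then q i j else 0 else 0) = (\<lambda>_. 0)" by auto
    with \<open>q i j = 0\<close> show ?thesis by (simp add: cube_avg_const)
  next
    case False
    then have "ignores i (\<lambda>J. if j \<in> J then q i j else 0)" by (simp add: ignores_def)
    moreover have "ignores j (\<lambda>J. q i j)" by (simp add: ignores_def)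
    ultimately show ?thesis
      using that by (simp add: cube_avg_if_member cube_avg_const)
  qed
  then have "(\<Sum>i<n. \<Sum>j<n. ?E (\<lambda>J. if i \<in> J then if j \<in> J then q i j else 0 else 0))
      = (\<Sum>i<n. \<Sum>j<n. q i j / 4)"
    by (intro sum.cong refl) auto
  then have "(\<Sum>i<n. \<Sum>j<n. q i j) / 4 = (\<Sum>i<n. \<Sum>j<n. ?E (\<lambda>J. if i \<in> J then if j \<in> J then q i j else 0 else 0))"
    by (simp only: sum_divide_distrib)
  also have "\<dots> = ?E (\<lambda>J. \<Sum>i<n. \<Sum>j<n. if i \<in> J then if j \<in> J then q i j else 0 else 0)"
    by (simp add: cube_avg_sum)
  also have "\<dots> = ?E (\<lambda>J. \<Sum>i\<in>J. \<Sum>j\<in>J. q i j)"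
  proof (intro cube_avg_cong)
    fix J assume J: "J \<subseteq> {..<n}"
    have "(\<Sum>j<n. if i \<in> J then if j \<in> J then q i j else 0 else 0) = (if i \<in> J then \<Sum>j\<in>J. q i j else 0)" for i
      using J by (simp add: sum.If_cases Int_absorb1)
    then show "(\<Sum>i<n. \<Sum>j<n. if i \<in> J then if j \<in> J then q i j else 0 else 0) = (\<Sum>i\<in>J. \<Sum>j\<in>J. q i j)"
      using J by (simp add: sum.If_cases Int_absorb1)
  qed
  also have "\<dots> \<le> ?E (\<lambda>J. 4 * W * (1 + 2 * W + ?E (\<lambda>x. \<Sum>i\<in>J. spread f J i x)))"
    unfolding q_def
    by (intro cube_avg_mono sum_second_gain_restricted[OF f _ lip W_def assms(3)])
  also have "\<dots> = 4 * W * (1 + 2 * W + ?E (\<lambda>J. ?E (\<lambda>x. \<Sum>i\<in>J. spread f J i x)))"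
    by (simp add: cube_avg_cmult cube_avg_add cube_avg_const)
  \<comment> \<open>\<open>2 * W\<close> is at most 3 and the mean spread at most 4, which gives 32
    W; the division by 4 on the left turns it into 128 W.\<close>
  also have "\<dots> \<le> 4 * W * (1 + 3 + 4)"
    using W cube_avg_spread[OF f] by (intro mult_left_mono add_mono) auto
  finally show ?thesis by (simp add: q_def W_def)
qed

section \<open>Fourier concentration of submodular functions\<close>

definition ftail :: "'a set \<Rightarrow> nat \<Rightarrow> ('a set \<Rightarrow> real) \<Rightarrow> real" where
  "ftail V D f = (\<Sum>S | S \<subseteq> V \<and> D < card S. (fcoeff V f S)\<^sup>2)"

lemma ftail_antimono: "finite V \<Longrightarrow> D \<le> D' \<Longrightarrow> ftail V D' f \<le> ftail V D f"
  unfolding ftail_def by (intro sum_mono2) auto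

lemma ftail_le_cube_avg: "finite V \<Longrightarrow> ftail V D f \<le> cube_avg V (\<lambda>A. (f A)\<^sup>2)"
  unfolding ftail_def parseval[symmetric] by (intro sum_mono2) auto

lemma ftail_le_1:
  assumes "f \<in> submodular_class n"
  shows "ftail {..<n} D f \<le> 1"
proof -
  have "ftail {..<n} D f \<le> cube_avg {..<n} (\<lambda>A. (f A)\<^sup>2)" by (simp add: ftail_le_cube_avg)
  also have "\<dots> \<le> cube_avg {..<n} (\<lambda>A. 1)"
    using submodular_classD[OF assms] by (intro cube_avg_mono power_le_one) auto
  finally show ?thesis by (simp add: cube_avg_const)
qed

text \<open>On sets of more than d elements \<open>card S * (card S - 1)\<close> is at least d^2.
  The constant 8 is 128 divided by the 16 of \<open>sum_second_gain\<close>.\<close>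

lemma ftail_le_lipschitz:
  assumes f: "f \<in> submodular_class n"
    and lip: "\<And>i A. i < n \<Longrightarrow> A \<subseteq> {..<n} \<Longrightarrow> \<bar>gain f i A\<bar> \<le> \<alpha>"
    and \<alpha>: "0 \<le> \<alpha>" "\<alpha> \<le> 1" and d: "d \<ge> 1"
  shows "ftail {..<n} d f \<le> 8 * sqrt (2 * \<alpha>) / d\<^sup>2"
proof -
  have "real d ^ 2 * ftail {..<n} d f
      \<le> (\<Sum>S | S \<subseteq> {..<n} \<and> d < card S. card S * (card S - 1) * (fcoeff {..<n} f S)\<^sup>2)"
    unfolding ftail_def sum_distrib_left
  proof (intro sum_mono mult_right_mono)
    fix S assume "S \<in> {S. S \<subseteq> {..<n} \<and> d < card S}"
    then have "d * d \<le> card S * (card S - 1)" by (intro mult_mono) auto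
    then show "(real d)\<^sup>2 \<le> real (card S * (card S - 1))"
      unfolding power2_eq_square by (metis of_nat_le_iff of_nat_mult)
  qed auto
  also have "\<dots> \<le> (\<Sum>S\<in>Pow {..<n}. card S * (card S - 1) * (fcoeff {..<n} f S)\<^sup>2)"
    by (intro sum_mono2) auto
  also have "\<dots> \<le> 8 * sqrt (2 * \<alpha>)"
    using sum_second_gain_le[OF f lip \<alpha>] sum_second_gain[of "{..<n}" f] by simp
  finally show ?thesis using d by (simp add: field_simps)
qed

text \<open>Querying one coordinate costs one level. The coefficients of f at S and
  \<open>insert i S\<close> are half the sum and half the difference of those of the two
  restrictions at S, and their squares add up to half the sum of the squares.\<close>

lemma ftail_split:
  assumes "finite V" "i \<in> V"
  shows "ftail V (Suc D) f \<le> (ftail V D (\<lambda>A. f (A - {i})) + ftail V D (\<lambda>A. f (insert i A))) / 2"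
proof -
  define U where "U = V - {i}"
  have U: "V = insert i U" "i \<notin> U" "finite U"
    using assms by (auto simp: U_def)
  define a b where "a = fcoeff V (\<lambda>A. f (A - {i}))" and "b = fcoeff V (\<lambda>A. f (insert i A))"
  have finS: "finite S" if "S \<subseteq> U" for S using that U(3) finite_subset by blast
  have chi: "chi S (insert i A) = chi S A" "chi S (A - {i}) = chi S A"
    "chi (insert i S) (insert i A) = - chi S A" "chi (insert i S) (A - {i}) = chi S A"
    if "S \<subseteq> U" for S A
  proof -
    have "i \<notin> S" using that U by auto
    from ignores_chi[OF this] show *: "chi S (insert i A) = chi S A" "chi S (A - {i}) = chi S A"
      by (auto intro: ignores_eqI)
    show "chi (insert i S) (insert i A) = - chi S A" "chi (insert i S) (A - {i}) = chi S A"
      using chi_insert[OF finS[OF that] \<open>i \<notin> S\<close>] * by (simp_all add: rad_def)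
  qed
  have 1: "fcoeff V f S = (a S + b S) / 2" if "S \<subseteq> U" for S
    unfolding a_def b_def fcoeff_def
    by (subst cube_avg_split[OF assms]) (simp add: chi[OF that] add.commute)
  have 2: "fcoeff V f (insert i S) = (a S - b S) / 2" if "S \<subseteq> U" for S
    unfolding a_def b_def fcoeff_def
    by (subst cube_avg_split[OF assms]) (simp add: chi[OF that] cube_avg_uminus)
  have "{S. S \<subseteq> V \<and> Suc D < card S}
      = {S. S \<subseteq> U \<and> Suc D < card S} \<union> insert i ` {S. S \<subseteq> U \<and> D < card S}" (is "_ = ?A \<union> ?B")
  proof (intro equalityI subsetI)
    fix S assume S: "S \<in> {S. S \<subseteq> V \<and> Suc D < card S}"
    show "S \<in> ?A \<union> ?B"
    proof (cases "i \<in> S")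
      case True
      have "finite S" using S U finite_subset by (metis (no_types, lifting) finite_insert mem_Collect_eq)
      then have "S - {i} \<subseteq> U \<and> D < card (S - {i})" "S = insert i (S - {i})"
        using S True U by (auto simp: card_Diff_singleton)
      then show ?thesis by blast
    qed (use S U in auto)
  next
    fix S assume "S \<in> ?A \<union> ?B"
    then show "S \<in> {S. S \<subseteq> V \<and> Suc D < card S}"
    proof
      assume "S \<in> ?B"
      then obtain S' where "S = insert i S'" "S' \<subseteq> U" "D < card S'" by auto
      moreover from this have "i \<notin> S'" "finite S'" using U finS by auto
      ultimately show ?thesis using U by auto
    qed (use U in auto)
  qed
  then have "ftail V (Suc D) f = (\<Sum>S\<in>?A. (fcoeff V f S)\<^sup>2) + (\<Sum>S\<in>?B. (fcoeff V f S)\<^sup>2)"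
    unfolding ftail_def using U by (subst sum.union_disjoint[symmetric]) auto
  also have "(\<Sum>S\<in>?B. (fcoeff V f S)\<^sup>2) = (\<Sum>S | S \<subseteq> U \<and> D < card S. ((a S - b S) / 2)\<^sup>2)"
  proof -
    have "inj_on (insert i) {S. S \<subseteq> U \<and> D < card S}"
      using U(2) by (intro inj_onI) (metis (no_types, lifting) insert_ident mem_Collect_eq subsetD)
    then have "(\<Sum>S\<in>?B. (fcoeff V f S)\<^sup>2)
        = (\<Sum>S | S \<subseteq> U \<and> D < card S. (fcoeff V f (insert i S))\<^sup>2)"
      by (simp add: sum.reindex)
    also have "\<dots> = (\<Sum>S | S \<subseteq> U \<and> D < card S. ((a S - b S) / 2)\<^sup>2)"
      by (intro sum.cong refl) (simp only: mem_Collect_eq 2)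
    finally show ?thesis .
  qed
  also have "(\<Sum>S\<in>?A. (fcoeff V f S)\<^sup>2) = (\<Sum>S\<in>?A. ((a S + b S) / 2)\<^sup>2)"
    by (intro sum.cong refl) (simp only: mem_Collect_eq 1)
  \<comment> \<open>Lowering the threshold for sets without i adds nonnegative terms and lets each
    such S pair up with \<open>insert i S\<close>.\<close>
  also have "\<dots> \<le> (\<Sum>S | S \<subseteq> U \<and> D < card S. ((a S + b S) / 2)\<^sup>2)"
    using U by (intro sum_mono2) auto
  also have "(\<Sum>S | S \<subseteq> U \<and> D < card S. ((a S + b S) / 2)\<^sup>2) + (\<Sum>S | S \<subseteq> U \<and> D < card S. ((a S - b S) / 2)\<^sup>2)
      = (\<Sum>S | S \<subseteq> U \<and> D < card S. ((a S)\<^sup>2 + (b S)\<^sup>2) / 2)"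
    unfolding sum.distrib[symmetric]
    by (intro sum.cong) (auto simp: power2_eq_square field_simps)
  also have "\<dots> \<le> (\<Sum>S | S \<subseteq> V \<and> D < card S. ((a S)\<^sup>2 + (b S)\<^sup>2) / 2)"
    using U by (intro sum_mono2) auto
  also have "\<dots> = (ftail V D (\<lambda>A. f (A - {i})) + ftail V D (\<lambda>A. f (insert i A))) / 2"
    by (simp add: ftail_def a_def b_def sum.distrib add_divide_distrib sum_divide_distrib)
  finally show ?thesis by simp
qed

section \<open>Querying the coordinates with large gains\<close>

lemma submodular_class_restrict:
  assumes f: "f \<in> submodular_class n" and "i < n"
  shows "(\<lambda>A. f (A - {i})) \<in> submodular_class n" "(\<lambda>A. f (insert i A)) \<in> submodular_class n"
proof -
  have restrict: "(\<lambda>A. f (r A)) \<in> submodular_class n"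
    if r: "\<And>A B. r (A \<union> B) = r A \<union> r B" "\<And>A B. r (A \<inter> B) = r A \<inter> r B"
      "\<And>A. A \<subseteq> {..<n} \<Longrightarrow> r A \<subseteq> {..<n}" for r
    unfolding submodular_class_def submodular_def mem_Collect_eq r(1,2)
    using submodularD[OF submodular_classD(1)[OF f]] submodular_classD(2,3)[OF f] r(3) by simp
  show "(\<lambda>A. f (A - {i})) \<in> submodular_class n" "(\<lambda>A. f (insert i A)) \<in> submodular_class n"
    by (rule restrict; use \<open>i < n\<close> in blast)+
qed

lemma average_affine: "(b + p * x + (b + p * y)) / 2 = b + p * ((x + y) / 2)" for b :: real
  by (simp add: field_simps)

text \<open>The potential of a query tree, with u the value of f at the bottom or top. The branch
  where it rises by \<alpha> at least halves the potential and the other does not increase it, so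
  the average drops to at most 3/4.\<close>

lemma powr_step:
  fixes \<alpha> u v w :: real
  assumes "\<alpha> > 0" "u + \<alpha> \<le> v" "u \<le> w"
  shows "(2 powr ((1 - w) / \<alpha>) + 2 powr ((1 - v) / \<alpha>)) / 2 \<le> 3 / 4 * 2 powr ((1 - u) / \<alpha>)"
    and "(2 powr ((1 - v) / \<alpha>) + 2 powr ((1 - w) / \<alpha>)) / 2 \<le> 3 / 4 * 2 powr ((1 - u) / \<alpha>)"
proof -
  have "2 powr ((1 - w) / \<alpha>) \<le> 2 powr ((1 - u) / \<alpha>)"
    using assms by (intro powr_mono divide_right_mono) auto
  moreover have "2 powr ((1 - v) / \<alpha>) \<le> 2 powr ((1 - u) / \<alpha> - 1)"
  proof (intro powr_mono)
    have "(1 - v) / \<alpha> \<le> (1 - u - \<alpha>) / \<alpha>"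
      using assms by (intro divide_right_mono) auto
    then show "(1 - v) / \<alpha> \<le> (1 - u) / \<alpha> - 1"
      using assms by (simp add: diff_divide_distrib)
  qed simp
  moreover have "2 powr ((1 - u) / \<alpha> - 1) = 2 powr ((1 - u) / \<alpha>) / 2"
    by (simp add: powr_diff)
  ultimately show "(2 powr ((1 - w) / \<alpha>) + 2 powr ((1 - v) / \<alpha>)) / 2 \<le> 3 / 4 * 2 powr ((1 - u) / \<alpha>)"
    and "(2 powr ((1 - v) / \<alpha>) + 2 powr ((1 - w) / \<alpha>)) / 2 \<le> 3 / 4 * 2 powr ((1 - u) / \<alpha>)"
    by argo+
qed

text \<open>Induction on the number k of queries. If every gain at the top is at least -\<alpha>,
  all gains are at most \<alpha> in absolute value by diminishing returns, and no query is made.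
  Otherwise deleting some i raises the value at the top by more than \<alpha>. The last term pays
  for branches unfinished after k queries, whose tail is at most 1.\<close>

lemma ftail_le_upper_lipschitz:
  assumes \<alpha>: "0 < \<alpha>" "\<alpha> \<le> 1" and d: "d \<ge> 1"
    and f: "f \<in> submodular_class n" and up: "\<And>i. i < n \<Longrightarrow> gain f i {} \<le> \<alpha>"
  shows "ftail {..<n} (k + d) f
      \<le> 8 * sqrt (2 * \<alpha>) / d\<^sup>2 + (3 / 4) ^ k * 2 powr ((1 - f {..<n}) / \<alpha>)"
  using f up
proof (induction k arbitrary: f)
  case (0 f)
  let ?V = "{..<n}"
  have "f ?V \<le> 1" using submodular_classD(3)[OF 0(1)] by simp
  then have "1 \<le> 2 powr ((1 - f ?V) / \<alpha>)" using \<alpha> by (intro ge_one_powr_ge_zero) auto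
  moreover have "0 \<le> 8 * sqrt (2 * \<alpha>) / (real d)\<^sup>2" using \<alpha> by simp
  ultimately show ?case using ftail_le_1[OF 0(1), of d] by simp
next
  case (Suc k f)
  let ?V = "{..<n}" and ?\<beta> = "8 * sqrt (2 * \<alpha>) / d\<^sup>2"
  show ?case
  proof (cases "\<forall>i<n. - \<alpha> \<le> gain f i ?V")
    case True
    have "\<bar>gain f i A\<bar> \<le> \<alpha>" if "i < n" "A \<subseteq> ?V" for i A
    proof -
      note sub = submodular_classD(1)[OF Suc.prems(1)]
      have "gain f i ?V \<le> gain f i A" "gain f i A \<le> gain f i {}"
        using that by (auto intro!: gain_antimono[OF sub])
      then show ?thesis using True Suc.prems(2)[OF that(1)] that(1) by force
    qed
    then have "ftail ?V d f \<le> ?\<beta>" using \<alpha> d Suc.prems(1) by (intro ftail_le_lipschitz) auto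
    moreover have "ftail ?V (Suc k + d) f \<le> ftail ?V d f" by (intro ftail_antimono) auto
    moreover have "0 \<le> (3 / 4) ^ Suc k * 2 powr ((1 - f ?V) / \<alpha>)" by simp
    ultimately show ?thesis by linarith
  next
    case False
    then obtain i where i: "i < n" "gain f i ?V < - \<alpha>" by force
    define f0 f1 where "f0 = (\<lambda>A. f (A - {i}))" and "f1 = (\<lambda>A. f (insert i A))"
    have cl: "f0 \<in> submodular_class n" "f1 \<in> submodular_class n"
      unfolding f0_def f1_def using submodular_class_restrict[OF Suc.prems(1) i(1)] by auto
    have V: "insert i ?V = ?V" using i by auto
    \<comment> \<open>Both restrictions keep the bound on gains at the bottom: deleting i leaves the
      bottom in place, inserting i moves it up, where gains are smaller.\<close>
    have up0: "gain f0 j {} \<le> \<alpha>" if "j < n" for j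
      using Suc.prems(2)[OF that] \<alpha> by (auto simp: gain_def f0_def insert_Diff_if)
    have up1: "gain f1 j {} \<le> \<alpha>" if "j < n" for j
    proof (cases "j = i")
      case False
      have "gain f1 j {} = gain f j {i}" using False by (simp add: gain_def f1_def insert_commute)
      also have "\<dots> \<le> gain f j {}"
        using i that by (intro gain_antimono[OF submodular_classD(1)[OF Suc.prems(1)]]) auto
      finally show ?thesis using Suc.prems(2)[OF that] by simp
    qed (use \<alpha> in \<open>simp add: gain_def f1_def\<close>)
    have "ftail ?V (Suc k + d) f \<le> (ftail ?V (k + d) f0 + ftail ?V (k + d) f1) / 2"
      using ftail_split[of ?V i "k + d" f] i by (simp add: f0_def f1_def)
    also have "\<dots> \<le> ?\<beta> + (3 / 4) ^ k * ((2 powr ((1 - f0 ?V) / \<alpha>) + 2 powr ((1 - f1 ?V) / \<alpha>)) / 2)"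
      using Suc.IH[OF cl(1) up0] Suc.IH[OF cl(2) up1]
      by (subst average_affine[symmetric]) (intro divide_right_mono add_mono; simp)
    also have "\<dots> \<le> ?\<beta> + (3 / 4) ^ k * (3 / 4 * 2 powr ((1 - f ?V) / \<alpha>))"
      using i(2) V \<alpha>
      by (intro add_left_mono mult_left_mono powr_step(2)) (auto simp: f0_def f1_def gain_def)
    finally show ?thesis by (simp add: mult_ac)
  qed
qed

text \<open>The first phase: while some gain at the bottom exceeds \<alpha>, that coordinate is
  queried, and inserting it raises the value at the bottom. Once none is left,
  \<open>ftail_le_upper_lipschitz\<close> takes over with l further queries.\<close>

lemma ftail_le_submodular:
  assumes \<alpha>: "0 < \<alpha>" "\<alpha> \<le> 1" and d: "d \<ge> 1"
    and f: "f \<in> submodular_class n"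
  shows "ftail {..<n} (k + (l + d)) f
      \<le> 8 * sqrt (2 * \<alpha>) / d\<^sup>2 + (3 / 4) ^ l * 2 powr (1 / \<alpha>) + (3 / 4) ^ k * 2 powr ((1 - f {}) / \<alpha>)"
  using f
proof (induction k arbitrary: f)
  case (0 f)
  have "f {} \<le> 1" using submodular_classD(3)[OF 0(1)] by simp
  then have "1 \<le> 2 powr ((1 - f {}) / \<alpha>)" using \<alpha> by (intro ge_one_powr_ge_zero) auto
  moreover have "0 \<le> 8 * sqrt (2 * \<alpha>) / (real d)\<^sup>2 + (3 / 4) ^ l * 2 powr (1 / \<alpha>)" using \<alpha> by simp
  ultimately show ?case using ftail_le_1[OF 0(1), of "l + d"] by simp
next
  case (Suc k f)
  let ?V = "{..<n}" and ?\<beta> = "8 * sqrt (2 * \<alpha>) / d\<^sup>2 + (3 / 4) ^ l * 2 powr (1 / \<alpha>)"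
  show ?case
  proof (cases "\<forall>i<n. gain f i {} \<le> \<alpha>")
    case True
    have "ftail ?V (l + d) f \<le> 8 * sqrt (2 * \<alpha>) / d\<^sup>2 + (3 / 4) ^ l * 2 powr ((1 - f ?V) / \<alpha>)"
      using \<alpha> d Suc.prems True by (intro ftail_le_upper_lipschitz) auto
    also have "\<dots> \<le> ?\<beta>"
      using \<alpha> submodular_classD(2)[OF Suc.prems, of ?V]
      by (intro add_left_mono mult_left_mono powr_mono divide_right_mono) auto
    finally have "ftail ?V (l + d) f \<le> ?\<beta>" .
    moreover have "ftail ?V (Suc k + (l + d)) f \<le> ftail ?V (l + d) f" by (intro ftail_antimono) auto
    moreover have "0 \<le> (3 / 4) ^ Suc k * 2 powr ((1 - f {}) / \<alpha>)" by simp
    ultimately show ?thesis by linarith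
  next
    case False
    then obtain i where i: "i < n" "gain f i {} > \<alpha>" by force
    define f0 f1 where "f0 = (\<lambda>A. f (A - {i}))" and "f1 = (\<lambda>A. f (insert i A))"
    have cl: "f0 \<in> submodular_class n" "f1 \<in> submodular_class n"
      unfolding f0_def f1_def using submodular_class_restrict[OF Suc.prems(1) i(1)] by auto
    have "ftail ?V (Suc k + (l + d)) f \<le> (ftail ?V (k + (l + d)) f0 + ftail ?V (k + (l + d)) f1) / 2"
      using ftail_split[of ?V i "k + (l + d)" f] i by (simp add: f0_def f1_def)
    also have "\<dots> \<le> ?\<beta> + (3 / 4) ^ k * ((2 powr ((1 - f0 {}) / \<alpha>) + 2 powr ((1 - f1 {}) / \<alpha>)) / 2)"
      using Suc.IH[OF cl(1)] Suc.IH[OF cl(2)]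
      by (subst average_affine[symmetric]) (intro divide_right_mono add_mono; simp)
    also have "\<dots> \<le> ?\<beta> + (3 / 4) ^ k * (3 / 4 * 2 powr ((1 - f {}) / \<alpha>))"
      using i(2) \<alpha>
      by (intro add_left_mono mult_left_mono powr_step(1)) (auto simp: f0_def f1_def gain_def)
    finally show ?thesis by (simp add: mult_ac)
  qed
qed

text \<open>The parameters are \<alpha> = 1/m, 20 m queries in each phase and d = 10 m. With r =
  m^(-5/2), which is at most \<epsilon>^2, the Lipschitz term is at most 3/25 r and each of the two
  query terms at most 1/16 r, together less than r/4.\<close>

theorem submodular_fourier_concentration:
  assumes f: "f \<in> submodular_class n" and \<epsilon>: "\<epsilon> > 0" and m: "m \<ge> 1" "real m ^ 5 * \<epsilon> ^ 4 \<ge> 1"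
  shows "ftail {..<n} (50 * m) f \<le> \<epsilon>\<^sup>2 / 4"
proof -
  let ?r = "sqrt (1 / real m ^ 5)"
  have m0: "real m \<ge> 1" using m by simp
  have "?r \<le> sqrt ((\<epsilon>\<^sup>2)\<^sup>2)"
    using m m0 by (intro real_sqrt_le_mono) (simp add: field_simps)
  then have r: "?r \<le> \<epsilon>\<^sup>2" unfolding real_sqrt_abs by simp
  have "8 * sqrt (2 * (1 / m)) / (10 * real m)\<^sup>2 = 8 / 100 * sqrt 2 * ?r"
  proof -
    have "sqrt (1 / real m ^ 5) = sqrt (1 / real m * (1 / real m ^ 2)\<^sup>2)"
      by (simp add: power2_eq_square power_numeral_reduce mult_ac)
    also have "\<dots> = sqrt (1 / m) / real m ^ 2"
      unfolding real_sqrt_mult by simp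
    finally show ?thesis
      unfolding real_sqrt_mult by (simp add: power_mult_distrib)
  qed
  also have "\<dots> \<le> 8 / 100 * (3 / 2) * ?r"
  proof (intro mult_right_mono mult_left_mono)
    show "sqrt 2 \<le> (3 / 2 :: real)" by (rule real_le_lsqrt) (simp_all add: power2_eq_square)
  qed simp_all
  finally have 1: "8 * sqrt (2 * (1 / m)) / (10 * real m)\<^sup>2 \<le> 3 / 25 * ?r" by simp
  have 2: "(3 / 4) ^ (20 * m) * 2 powr (1 / (1 / m)) \<le> 1 / 16 * ?r"
  proof -
    have "m \<le> 2 ^ m" by (simp add: less_imp_le)
    then have "real m ^ 3 \<le> (2 ^ m) ^ 3"
      by (intro power_mono) (metis of_nat_le_iff of_nat_numeral of_nat_power, simp)
    also have "((2::real) ^ m) ^ 3 = (2 ^ 3) ^ m" by (metis mult.commute power_mult)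
    finally have m3: "real m ^ 3 \<le> 8 ^ m" by simp
    have "16 ^ 1 \<le> (16::real) ^ m" using m by (intro power_increasing) auto
    then have "16 * real m ^ 3 \<le> 16 ^ m * 8 ^ m" using m3 by (intro mult_mono) auto
    also have "\<dots> = (128::real) ^ m" by (simp add: power_mult_distrib[symmetric])
    finally have 3: "16 * real m ^ 3 \<le> 128 ^ m" .
    \<comment> \<open>As (3/4)^20 * 2 is below 1/128, twenty queries per unit of m bring the initial
      potential 2^m below 128^(-m).\<close>
    have "(3 / 4) ^ (20 * m) * 2 powr (1 / (1 / m)) = ((3 / 4) ^ 20 * 2) ^ m"
      by (simp add: power_mult powr_realpow power_mult_distrib)
    also have "\<dots> \<le> (1 / 128) ^ m" by (intro power_mono) (simp_all add: power_numeral_reduce)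
    also have "\<dots> = 1 / 128 ^ m" by (simp add: power_one_over)
    also have "\<dots> \<le> 1 / (16 * real m ^ 3)" using 3 m0 by (intro divide_left_mono) auto
    also have "\<dots> = 1 / 16 * sqrt ((1 / real m ^ 3)\<^sup>2)" by simp
    also have "\<dots> \<le> 1 / 16 * ?r"
    proof (intro mult_left_mono real_sqrt_le_mono)
      have "real m ^ 5 \<le> real m ^ 6" using m0 by (intro power_increasing) auto
      then show "(1 / real m ^ 3)\<^sup>2 \<le> 1 / real m ^ 5"
        using m0 by (simp add: power_divide frac_le flip: power_mult)
    qed simp
    finally show ?thesis .
  qed
  have "ftail {..<n} (20 * m + (20 * m + 10 * m)) f
      \<le> 8 * sqrt (2 * (1 / m)) / (10 * m)\<^sup>2 + (3 / 4) ^ (20 * m) * 2 powr (1 / (1 / m))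
        + (3 / 4) ^ (20 * m) * 2 powr ((1 - f {}) / (1 / m))"
    using m f by (intro ftail_le_submodular) auto
  also have "\<dots> \<le> 8 * sqrt (2 * (1 / m)) / (10 * real m)\<^sup>2 + (3 / 4) ^ (20 * m) * 2 powr (1 / (1 / m))
        + (3 / 4) ^ (20 * m) * 2 powr (1 / (1 / m))"
    using submodular_classD(2)[OF f, of "{}"] m
    by (intro add_mono mult_left_mono powr_mono divide_right_mono) auto
  also have "\<dots> \<le> 1 / 4 * ?r"
  proof -
    have "x + y + y \<le> 1 / 4 * r" if "x \<le> 3 / 25 * r" "y \<le> 1 / 16 * r" "0 \<le> r" for x y r :: real
      using that by linarith
    from this[OF 1 2] show ?thesis by simp
  qed
  also have "\<dots> \<le> \<epsilon>\<^sup>2 / 4" using r by simp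
  finally show ?thesis by simp
qed

section \<open>The learner\<close>

definition runs :: "com \<Rightarrow> state \<Rightarrow> nat \<Rightarrow> (state \<Rightarrow> bool) \<Rightarrow> bool" where
  "runs c s T Q \<longleftrightarrow> (\<exists>t s'. exec c s t s' \<and> t \<le> T \<and> Q s')"

lemma runs_NStore: "1 \<le> T \<Longrightarrow> Q (nstore a (nval s i) (nval s e) s) \<Longrightarrow> runs (NStore a i e) s T Q"
  unfolding runs_def using exec.NStore by blast

lemma runs_RStore: "1 \<le> T \<Longrightarrow> Q (rstore a (nval s i) (rval s e) s) \<Longrightarrow> runs (RStore a i e) s T Q"
  unfolding runs_def using exec.RStore by blast

lemma runs_Draw: "1 \<le> T \<Longrightarrow> Q (draw s) \<Longrightarrow> runs Draw s T Q"
  unfolding runs_def using exec.Draw by blast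

lemma runs_Seq:
  "runs c1 s T1 R \<Longrightarrow> (\<And>s'. R s' \<Longrightarrow> runs c2 s' T2 Q) \<Longrightarrow> T1 + T2 \<le> T \<Longrightarrow> runs (Seq c1 c2) s T Q"
  unfolding runs_def by (meson add_mono exec.Seq le_trans)

lemma runs_Cond:
  "runs (if bval s b then c1 else c2) s T' Q \<Longrightarrow> Suc T' \<le> T \<Longrightarrow> runs (Cond b c1 c2) s T Q"
proof -
  assume "runs (if bval s b then c1 else c2) s T' Q" "Suc T' \<le> T"
  then obtain t s' where "exec (if bval s b then c1 else c2) s t s'" "1 + t \<le> T" "Q s'"
    unfolding runs_def by auto
  then show ?thesis
    unfolding runs_def using exec.CondTrue[of s b c1 t s' c2] exec.CondFalse[of s b c2 t s' c1]
    by (cases "bval s b") auto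
qed

lemma runs_NStore_Seq:
  "runs c (nstore a (nval s i) (nval s e) s) T' Q \<Longrightarrow> Suc T' \<le> T \<Longrightarrow> runs (Seq (NStore a i e) c) s T Q"
  by (rule runs_Seq[OF runs_NStore[where T = 1 and Q = "\<lambda>s'. s' = nstore a (nval s i) (nval s e) s"]]) auto

lemma runs_RStore_Seq:
  "runs c (rstore a (nval s i) (rval s e) s) T' Q \<Longrightarrow> Suc T' \<le> T \<Longrightarrow> runs (Seq (RStore a i e) c) s T Q"
  by (rule runs_Seq[OF runs_RStore[where T = 1 and Q = "\<lambda>s'. s' = rstore a (nval s i) (rval s e) s"]]) auto

lemma runs_Draw_Seq: "runs c (draw s) T' Q \<Longrightarrow> Suc T' \<le> T \<Longrightarrow> runs (Seq Draw c) s T Q"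
  by (rule runs_Seq[OF runs_Draw[where T = 1 and Q = "\<lambda>s'. s' = draw s"]]) auto

lemma runs_mono: "runs c s T Q \<Longrightarrow> T \<le> T' \<Longrightarrow> (\<And>s'. Q s' \<Longrightarrow> Q' s') \<Longrightarrow> runs c s T' Q'"
  unfolding runs_def by (meson le_trans)

text \<open>N is the exact number of iterations. Each one costs at most B plus one for the test, and
  the final failing test costs one more.\<close>

lemma runs_While:
  assumes "I 0 s"
    and step: "\<And>k s. k < N \<Longrightarrow> I k s \<Longrightarrow> bval s b \<and> runs c s B (I (Suc k))"
    and stop: "\<And>s. I N s \<Longrightarrow> \<not> bval s b"
    and "N * Suc B + 1 \<le> T"
  shows "runs (While b c) s T (I N)"
proof -
  have "runs (While b c) s ((N - k) * Suc B + 1) (I N)" if "k \<le> N" "I k s" for k s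
    using that
  proof (induction "N - k" arbitrary: k s)
    case 0
    then have "I N s" by simp
    then show ?case
      unfolding runs_def using exec.WhileFalse[OF stop] 0 by force
  next
    case (Suc l)
    then have "k < N" by simp
    then obtain t1 s1 where 1: "bval s b" "exec c s t1 s1" "t1 \<le> B" "I (Suc k) s1"
      using step Suc.prems unfolding runs_def by blast
    have l: "l = N - Suc k" using Suc.hyps(2) by simp
    obtain t2 s2 where 2: "exec (While b c) s1 t2 s2" "t2 \<le> (N - Suc k) * Suc B + 1" "I N s2"
      using Suc.hyps(1)[OF l Suc_leI[OF \<open>k < N\<close>] 1(4)] unfolding runs_def by blast
    have "(N - k) * Suc B = Suc B + (N - Suc k) * Suc B"
      using \<open>k < N\<close> by (metis Suc_diff_Suc mult_Suc)
    then have "1 + t1 + t2 \<le> (N - k) * Suc B + 1" using 1(3) 2(2) by linarith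
    then show ?case
      unfolding runs_def using exec.WhileTrue[OF 1(1,2) 2(1)] 2(3) by blast
  qed
  from this[of 0 s] show ?thesis using assms(1,4) by (auto intro: runs_mono)
qed

lemma store_simps [simp]:
  "nmem (nstore a i v s) = (nmem s)(a := (nmem s a)(i := v))"
  "rmem (nstore a i v s) = rmem s"
  "current (nstore a i v s) = current s"
  "pending (nstore a i v s) = pending s"
  "rmem (rstore a i r s) = (rmem s)(a := (rmem s a)(i := r))"
  "nmem (rstore a i r s) = nmem s"
  "current (rstore a i r s) = current s"
  "pending (rstore a i r s) = pending s"
  "nmem (draw s) = nmem s"
  "rmem (draw s) = rmem s"
  "current (draw s) = pending s 0"
  "pending (draw s) = (\<lambda>i. pending s (Suc i))"
  by (simp_all add: nstore_def rstore_def draw_def)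

section \<open>The training and evaluation programs\<close>

abbreviation "nvar a \<equiv> NMem a (NLit 0)"
abbreviation "rvar a \<equiv> RMem a (NLit 0)"
abbreviation "nset a e \<equiv> NStore a (NLit 0) e"
abbreviation "rset a e \<equiv> RStore a (NLit 0) e"
abbreviation "incr a \<equiv> nset a (NAdd (nvar a) (NLit 1))"

text \<open>
  Layout of the memory; an array used as a scalar is used at index 0.
  Naturals: 0 dimension, 1 degree, 2 coordinate, 3 sample count, 4 position in array 5,
  5 sample bits (the samples one after the other), 6 level, 7 index of the sample.
  Reals: 0 accuracy and output, 1 the value \<open>resolution \<epsilon>\<close>, 2 required sample count, 3 sample count, 4 labels,
  5 dimension plus one, 6 truncated kernel sums, 7 sign, 8 accumulator.
\<close>

definition degree_loop :: com where
  "degree_loop =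
     While (RLess (RMul (RMul (RMul (RMul (RMul (rvar 1) (rvar 1)) (rvar 1)) (rvar 1)) (rvar 1))
         (RMul (RMul (RMul (rvar 0) (rvar 0)) (rvar 0)) (rvar 0))) (RLit 1))
       (Seq (rset 1 (RAdd (rvar 1) (RLit 1))) (nset 1 (NAdd (nvar 1) (NLit 50))))"

text \<open>No expression converts a natural into a real, so the real n + 1 is obtained by counting
  in both types in parallel.\<close>

definition dimension_loop :: com where
  "dimension_loop =
     Seq (rset 5 (RLit 1)) (Seq (nset 2 (NLit 0))
       (While (NLess (nvar 2) (nvar 0)) (Seq (rset 5 (RAdd (rvar 5) (RLit 1))) (incr 2))))"

definition sample_size_loop :: com where
  "sample_size_loop =
     Seq (rset 2 (RDiv (RLit 12) (RMul (rvar 0) (rvar 0)))) (Seq (nset 2 (NLit 0))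
       (While (NLess (nvar 2) (nvar 1)) (Seq (rset 2 (RMul (rvar 2) (rvar 5))) (incr 2))))"

definition record_bits :: com where
  "record_bits =
     While (NLess (nvar 2) (nvar 0))
       (Seq (Cond (Bit (nvar 2)) (NStore 5 (nvar 4) (NLit 1)) (NStore 5 (nvar 4) (NLit 0)))
         (Seq (incr 4) (incr 2)))"

text \<open>The sample count is kept twice, as a natural for indexing and as a real for comparison
  with the real target. This rounds the target up without any conversion.\<close>

definition sample_loop :: com where
  "sample_loop =
     While (RLess (rvar 3) (rvar 2))
       (Seq Draw (Seq (RStore 4 (nvar 3) Label) (Seq (nset 2 (NLit 0)) (Seq record_bits
         (Seq (incr 3) (rset 3 (RAdd (rvar 3) (RLit 1))))))))"

definition train :: com where
  "train = Seq degree_loop (Seq dimension_loop (Seq sample_size_loop sample_loop))"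

definition reset_levels :: com where
  "reset_levels =
     Seq (nset 6 (NLit 0)) (While (NLess (nvar 6) (NAdd (nvar 1) (NLit 1)))
       (Seq (RStore 6 (nvar 6) (RLit 1)) (incr 6)))"

text \<open>Level \<open>k\<close> needs the old value of level \<open>k - 1\<close>, so the array is overwritten downwards.\<close>

definition update_levels :: com where
  "update_levels =
     Seq (nset 6 (nvar 1)) (While (NLess (NLit 0) (nvar 6))
       (Seq (RStore 6 (nvar 6) (RAdd (RMem 6 (nvar 6))
           (RMul (rvar 7) (RMem 6 (NSub (nvar 6) (NLit 1))))))
         (nset 6 (NSub (nvar 6) (NLit 1)))))"

definition set_sign :: com where
  "set_sign =
     Cond (Bit (nvar 2))
       (Cond (NLess (NLit 0) (NMem 5 (nvar 4))) (rset 7 (RLit 1)) (rset 7 (RLit (-1))))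
       (Cond (NLess (NLit 0) (NMem 5 (nvar 4))) (rset 7 (RLit (-1))) (rset 7 (RLit 1)))"

definition kernel_loop :: com where
  "kernel_loop =
     Seq (nset 2 (NLit 0)) (While (NLess (nvar 2) (nvar 0))
       (Seq set_sign (Seq update_levels (Seq (incr 4) (incr 2)))))"

definition evaluate :: com where
  "evaluate =
     Seq (nset 7 (NLit 0)) (Seq (nset 4 (NLit 0)) (Seq (rset 8 (RLit 0))
       (Seq (While (NLess (nvar 7) (nvar 3))
           (Seq reset_levels (Seq kernel_loop
             (Seq (rset 8 (RAdd (rvar 8) (RMul (RMem 4 (nvar 7)) (RMem 6 (nvar 1))))) (incr 7)))))
         (rset 0 (RDiv (rvar 8) (rvar 3))))))"

text \<open>The frame condition of the loops that draw no example.\<close>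

definition same_except :: "nat set \<Rightarrow> nat set \<Rightarrow> state \<Rightarrow> state \<Rightarrow> bool" where
  "same_except N R s s' \<longleftrightarrow> (\<forall>a. a \<notin> N \<longrightarrow> nmem s' a = nmem s a) \<and>
     (\<forall>a. a \<notin> R \<longrightarrow> rmem s' a = rmem s a) \<and> current s' = current s \<and> pending s' = pending s"

lemma same_except_refl [simp]: "same_except N R s s"
  by (simp add: same_except_def)

lemma same_except_store:
  "same_except N R s s' \<Longrightarrow> a \<in> N \<Longrightarrow> same_except N R s (nstore a i v s')"
  "same_except N R s s' \<Longrightarrow> a \<in> R \<Longrightarrow> same_except N R s (rstore a i r s')"
  by (auto simp: same_except_def)

lemma same_exceptD:
  "same_except N R s s' \<Longrightarrow> a \<notin> N \<Longrightarrow> nmem s' a = nmem s a"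
  "same_except N R s s' \<Longrightarrow> a \<notin> R \<Longrightarrow> rmem s' a = rmem s a"
  "same_except N R s s' \<Longrightarrow> current s' = current s"
  "same_except N R s s' \<Longrightarrow> pending s' = pending s"
  by (auto simp: same_except_def)

lemma same_except_trans:
  "same_except N R s s' \<Longrightarrow> same_except N' R' s' s'' \<Longrightarrow> N \<subseteq> N'' \<Longrightarrow> N' \<subseteq> N'' \<Longrightarrow>
    R \<subseteq> R'' \<Longrightarrow> R' \<subseteq> R'' \<Longrightarrow> same_except N'' R'' s s''"
  unfolding same_except_def by (metis subset_iff)

text \<open>This is \<open>\<epsilon>\<^bsup>-4/5\<^esup>\<close> rounded up, in a form that the machine can compute without taking roots.\<close>

definition resolution :: "real \<Rightarrow> nat" where
  "resolution \<epsilon> = (LEAST m. real m ^ 5 * \<epsilon> ^ 4 \<ge> 1)"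

lemma resolution_works:
  assumes "\<epsilon> > 0"
  shows "real (resolution \<epsilon>) ^ 5 * \<epsilon> ^ 4 \<ge> 1" "k < resolution \<epsilon> \<Longrightarrow> real k ^ 5 * \<epsilon> ^ 4 < 1" "resolution \<epsilon> \<ge> 1"
proof -
  obtain m where m: "1 / \<epsilon> ^ 4 < real m" using reals_Archimedean2 by blast
  moreover have "0 < 1 / \<epsilon> ^ 4" using assms by simp
  ultimately have "0 < real m" by linarith
  then have "1 \<le> real m" by simp
  then have "real m ^ 1 \<le> real m ^ 5" by (intro power_increasing) auto
  then have "1 / \<epsilon> ^ 4 \<le> real m ^ 5" using m unfolding power_one_right by linarith
  then have "\<exists>m. real m ^ 5 * \<epsilon> ^ 4 \<ge> 1" using assms by (auto simp: field_simps)
  then show 1: "real (resolution \<epsilon>) ^ 5 * \<epsilon> ^ 4 \<ge> 1" unfolding resolution_def by (rule LeastI_ex)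
  show "k < resolution \<epsilon> \<Longrightarrow> real k ^ 5 * \<epsilon> ^ 4 < 1"
    unfolding resolution_def by (drule not_less_Least) simp
  show "resolution \<epsilon> \<ge> 1" using 1 by (cases "resolution \<epsilon>") auto
qed

section \<open>Correctness of the training program\<close>

lemma runs_degree_loop:
  assumes "\<epsilon> > 0" "rmem s 0 0 = \<epsilon>" "rmem s 1 0 = 0" "nmem s 1 0 = 0"
  shows "runs degree_loop s (3 * resolution \<epsilon> + 1)
    (\<lambda>s'. same_except {1} {1} s s' \<and> nmem s' 1 0 = 50 * resolution \<epsilon>)"
proof -
  let ?I = "\<lambda>k s'. same_except {1} {1} s s' \<and> nmem s' 1 0 = 50 * k \<and> rmem s' 1 0 = real k"
  have pow: "x * x * x * x * x * (\<epsilon> * \<epsilon> * \<epsilon> * \<epsilon>) = x ^ 5 * \<epsilon> ^ 4" for x :: real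
    by (simp add: power_numeral_reduce)
  have "runs degree_loop s (3 * resolution \<epsilon> + 1) (?I (resolution \<epsilon>))"
    unfolding degree_loop_def
  proof (rule runs_While[where I = ?I and N = "resolution \<epsilon>" and B = 2])
    fix k s' assume k: "k < resolution \<epsilon>" and I: "?I k s'"
    have "rmem s' 0 0 = \<epsilon>" using I assms by (simp add: same_except_def)
    then have "bval s' (RLess (RMul (RMul (RMul (RMul (RMul (rvar 1) (rvar 1)) (rvar 1)) (rvar 1)) (rvar 1))
         (RMul (RMul (RMul (rvar 0) (rvar 0)) (rvar 0)) (rvar 0))) (RLit 1))"
      using I resolution_works(2)[OF assms(1) k] by (simp add: pow)
    moreover have "runs (Seq (rset 1 (RAdd (rvar 1) (RLit 1))) (nset 1 (NAdd (nvar 1) (NLit 50)))) s' 2 (?I (Suc k))"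
      by (rule runs_RStore_Seq[OF runs_NStore[where T = 1]]) (use I in \<open>auto intro!: same_except_store\<close>)
    ultimately show "bval s' (RLess (RMul (RMul (RMul (RMul (RMul (rvar 1) (rvar 1)) (rvar 1)) (rvar 1)) (rvar 1))
         (RMul (RMul (RMul (rvar 0) (rvar 0)) (rvar 0)) (rvar 0))) (RLit 1)) \<and>
      runs (Seq (rset 1 (RAdd (rvar 1) (RLit 1))) (nset 1 (NAdd (nvar 1) (NLit 50)))) s' 2 (?I (Suc k))" ..
  next
    fix s' assume I: "?I (resolution \<epsilon>) s'"
    then have "rmem s' 0 0 = \<epsilon>" using assms by (simp add: same_except_def)
    then show "\<not> bval s' (RLess (RMul (RMul (RMul (RMul (RMul (rvar 1) (rvar 1)) (rvar 1)) (rvar 1)) (rvar 1))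
         (RMul (RMul (RMul (rvar 0) (rvar 0)) (rvar 0)) (rvar 0))) (RLit 1))"
      using I resolution_works(1)[OF assms(1)] by (simp add: pow)
  qed (use assms in auto)
  then show ?thesis by (rule runs_mono) auto
qed

lemma runs_dimension_loop:
  assumes "nmem s 0 0 = n"
  shows "runs dimension_loop s (3 * n + 3)
    (\<lambda>s'. same_except {2} {5} s s' \<and> rmem s' 5 0 = real n + 1)"
proof -
  let ?I = "\<lambda>k s'. same_except {2} {5} s s' \<and> nmem s' 2 0 = k \<and> rmem s' 5 0 = real k + 1"
  have "runs dimension_loop s (3 * n + 3) (?I n)"
    unfolding dimension_loop_def
  proof (rule runs_RStore_Seq[OF runs_NStore_Seq[OF runs_While[where I = ?I and N = n and B = 2]]])
    fix k s' assume k: "k < n" and I: "?I k s'"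
    have "nmem s' 0 0 = n" using I assms by (simp add: same_except_def)
    then have "bval s' (NLess (nvar 2) (nvar 0))" using I k by simp
    moreover have "runs (Seq (rset 5 (RAdd (rvar 5) (RLit 1))) (incr 2)) s' 2 (?I (Suc k))"
      by (rule runs_RStore_Seq[OF runs_NStore[where T = 1]]) (use I in \<open>auto intro!: same_except_store\<close>)
    ultimately show "bval s' (NLess (nvar 2) (nvar 0)) \<and>
      runs (Seq (rset 5 (RAdd (rvar 5) (RLit 1))) (incr 2)) s' 2 (?I (Suc k))" ..
  next
    fix s' assume I: "?I n s'"
    then have "nmem s' 0 0 = n" using assms by (simp add: same_except_def)
    then show "\<not> bval s' (NLess (nvar 2) (nvar 0))" using I by simp
  qed (use assms in \<open>auto intro!: same_except_store\<close>)
  then show ?thesis by (rule runs_mono) auto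
qed

lemma runs_sample_size_loop:
  assumes "nmem s 1 0 = D" "rmem s 0 0 = \<epsilon>" "rmem s 5 0 = q"
  shows "runs sample_size_loop s (3 * D + 3)
    (\<lambda>s'. same_except {2} {2} s s' \<and> rmem s' 2 0 = 12 / \<epsilon>\<^sup>2 * q ^ D)"
proof -
  let ?I = "\<lambda>k s'. same_except {2} {2} s s' \<and> nmem s' 2 0 = k \<and> rmem s' 2 0 = 12 / \<epsilon>\<^sup>2 * q ^ k"
  have "runs sample_size_loop s (3 * D + 3) (?I D)"
    unfolding sample_size_loop_def
  proof (rule runs_RStore_Seq[OF runs_NStore_Seq[OF runs_While[where I = ?I and N = D and B = 2]]])
    fix k s' assume k: "k < D" and I: "?I k s'"
    have *: "nmem s' 1 0 = D" "rmem s' 5 0 = q" using I assms by (simp_all add: same_except_def)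
    then have "bval s' (NLess (nvar 2) (nvar 1))" using I k by simp
    moreover have "runs (Seq (rset 2 (RMul (rvar 2) (rvar 5))) (incr 2)) s' 2 (?I (Suc k))"
      by (rule runs_RStore_Seq[OF runs_NStore[where T = 1]])
         (use I * in \<open>auto intro!: same_except_store\<close>)
    ultimately show "bval s' (NLess (nvar 2) (nvar 1)) \<and>
      runs (Seq (rset 2 (RMul (rvar 2) (rvar 5))) (incr 2)) s' 2 (?I (Suc k))" ..
  next
    fix s' assume I: "?I D s'"
    then have "nmem s' 1 0 = D" using assms by (simp add: same_except_def)
    then show "\<not> bval s' (NLess (nvar 2) (nvar 1))" using I by simp
  qed (use assms in \<open>auto intro!: same_except_store simp: power2_eq_square\<close>)
  then show ?thesis by (rule runs_mono) auto
qed

lemma runs_record_bits: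
  assumes "nmem s 0 0 = n" "nmem s 2 0 = 0" "nmem s 4 0 = p"
  shows "runs record_bits s (5 * n + 1)
    (\<lambda>s'. same_except {2, 4, 5} {} s s' \<and> nmem s' 4 0 = p + n \<and>
       (\<forall>j<p. nmem s' 5 j = nmem s 5 j) \<and> (\<forall>j<n. nmem s' 5 (p + j) = of_bool (j \<in> fst (current s))))"
proof -
  let ?I = "\<lambda>k s'. same_except {2, 4, 5} {} s s' \<and> nmem s' 2 0 = k \<and> nmem s' 4 0 = p + k \<and>
       (\<forall>j<p. nmem s' 5 j = nmem s 5 j) \<and> (\<forall>j<k. nmem s' 5 (p + j) = of_bool (j \<in> fst (current s)))"
  let ?body = "Seq (Cond (Bit (nvar 2)) (NStore 5 (nvar 4) (NLit 1)) (NStore 5 (nvar 4) (NLit 0)))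
         (Seq (incr 4) (incr 2))"
  have "runs record_bits s (5 * n + 1) (?I n)"
    unfolding record_bits_def
  proof (rule runs_While[where I = ?I and N = n and B = 4])
    fix k s' assume k: "k < n" and I: "?I k s'"
    have *: "nmem s' 0 0 = n" "current s' = current s"
      using same_exceptD(1)[OF conjunct1[OF I], of 0] same_exceptD(3)[OF conjunct1[OF I]] assms(1) by simp_all
    then have "bval s' (NLess (nvar 2) (nvar 0))" using I k by simp
    moreover have "runs ?body s' 4 (?I (Suc k))"
    proof (rule runs_Seq)
      let ?s = "nstore 5 (p + k) (of_bool (k \<in> fst (current s))) s'"
      show "runs (Cond (Bit (nvar 2)) (NStore 5 (nvar 4) (NLit 1)) (NStore 5 (nvar 4) (NLit 0))) s' 2 (\<lambda>s''. s'' = ?s)"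
      proof (rule runs_Cond[where T' = 1])
        show "runs (if bval s' (Bit (nvar 2)) then NStore 5 (nvar 4) (NLit 1) else NStore 5 (nvar 4) (NLit 0)) s' 1
            (\<lambda>s''. s'' = ?s)"
          using I * by (cases "k \<in> fst (current s)") (simp_all add: runs_NStore)
      qed simp
      show "runs (Seq (incr 4) (incr 2)) s'' 2 (?I (Suc k))" if "s'' = ?s" for s''
        by (rule runs_NStore_Seq[OF runs_NStore[where T = 1]])
           (use I that in \<open>auto intro!: same_except_store simp: less_Suc_eq\<close>)
    qed simp
    ultimately show "bval s' (NLess (nvar 2) (nvar 0)) \<and> runs ?body s' 4 (?I (Suc k))" ..
  next
    fix s' assume I: "?I n s'"
    then have "nmem s' 0 0 = n"
      using same_exceptD(1)[OF conjunct1[OF I], of 0] assms(1) by simp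
    then show "\<not> bval s' (NLess (nvar 2) (nvar 0))" using I by simp
  qed (use assms in auto)
  then show ?thesis by (rule runs_mono) auto
qed

text \<open>This is what evaluation reads. It does not mention \<open>current\<close> or
  \<open>pending\<close>, so it survives the passage to \<open>query_state\<close>.\<close>

definition trained :: "nat \<Rightarrow> nat \<Rightarrow> nat \<Rightarrow> (nat \<Rightarrow> labelled) \<Rightarrow> state \<Rightarrow> bool" where
  "trained n D m \<omega> s \<longleftrightarrow> nmem s 0 0 = n \<and> nmem s 1 0 = D \<and> nmem s 3 0 = m \<and> rmem s 3 0 = real m \<and>
     (\<forall>t<m. rmem s 4 t = snd (\<omega> t)) \<and>
     (\<forall>t<m. \<forall>j<n. nmem s 5 (t * n + j) = of_bool (j \<in> fst (\<omega> t)))"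

lemma runs_sample_loop:
  assumes "nmem s 0 0 = n" "nmem s 1 0 = D" "nmem s 3 0 = 0" "nmem s 4 0 = 0" "rmem s 3 0 = 0"
    "rmem s 2 0 = M" "pending s = \<omega>"
  shows "runs sample_loop s (nat \<lceil>M\<rceil> * (5 * n + 7) + 1) (trained n D (nat \<lceil>M\<rceil>) \<omega>)"
proof -
  let ?I = "\<lambda>k s'. trained n D k \<omega> s' \<and> nmem s' 4 0 = k * n \<and> rmem s' 2 0 = M \<and> pending s' = (\<lambda>i. \<omega> (i + k))"
  let ?body = "Seq Draw (Seq (RStore 4 (nvar 3) Label) (Seq (nset 2 (NLit 0)) (Seq record_bits
         (Seq (incr 3) (rset 3 (RAdd (rvar 3) (RLit 1)))))))"
  have "runs sample_loop s (nat \<lceil>M\<rceil> * (5 * n + 7) + 1) (?I (nat \<lceil>M\<rceil>))"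
    unfolding sample_loop_def
  proof (rule runs_While[where I = ?I and N = "nat \<lceil>M\<rceil>" and B = "5 * n + 6"])
    fix k s' assume k: "k < nat \<lceil>M\<rceil>" and I: "?I k s'"
    \<comment> \<open>A natural k is below the ceiling of M exactly when its real value is below M,
      so the real test allows exactly \<open>nat \<lceil>M\<rceil>\<close> rounds.\<close>
    have "real k < M" using k by linarith
    then have "bval s' (RLess (rvar 3) (rvar 2))" using I by (simp add: trained_def)
    moreover have "runs ?body s' (5 * n + 6) (?I (Suc k))"
    proof (rule runs_Draw_Seq[OF runs_RStore_Seq[OF runs_NStore_Seq[OF runs_Seq]]])
      let ?s = "nstore 2 0 0 (rstore 4 k (snd (\<omega> k)) (draw s'))"
      have 1: "nmem ?s 0 0 = n" "nmem ?s 2 0 = 0" "nmem ?s 4 0 = k * n"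
        using I by (simp_all add: trained_def)
      show "runs record_bits (nstore 2 (nval (rstore 4 (nval (draw s') (nvar 3)) (rval (draw s') Label) (draw s')) (NLit 0))
          (nval (rstore 4 (nval (draw s') (nvar 3)) (rval (draw s') Label) (draw s')) (NLit 0))
          (rstore 4 (nval (draw s') (nvar 3)) (rval (draw s') Label) (draw s'))) (5 * n + 1)
         (\<lambda>s''. same_except {2, 4, 5} {} ?s s'' \<and> nmem s'' 4 0 = k * n + n \<and>
       (\<forall>j<k * n. nmem s'' 5 j = nmem ?s 5 j) \<and> (\<forall>j<n. nmem s'' 5 (k * n + j) = of_bool (j \<in> fst (current ?s))))"
        using runs_record_bits[OF 1] I by (simp add: trained_def)
    next
      let ?s = "nstore 2 0 0 (rstore 4 k (snd (\<omega> k)) (draw s'))"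
      fix s'' assume "same_except {2, 4, 5} {} ?s s'' \<and> nmem s'' 4 0 = k * n + n \<and>
       (\<forall>j<k * n. nmem s'' 5 j = nmem ?s 5 j) \<and> (\<forall>j<n. nmem s'' 5 (k * n + j) = of_bool (j \<in> fst (current ?s)))"
      then have s'': "same_except {2, 4, 5} {} ?s s''" "nmem s'' 4 0 = k * n + n"
        "\<And>j. j < k * n \<Longrightarrow> nmem s'' 5 j = nmem s' 5 j" "\<And>j. j < n \<Longrightarrow> nmem s'' 5 (k * n + j) = of_bool (j \<in> fst (\<omega> k))"
        using I by auto
      have m: "nmem s'' 0 0 = n" "nmem s'' 1 0 = D" "nmem s'' 3 0 = k" "rmem s'' 3 0 = real k" "rmem s'' 2 0 = M"
        "rmem s'' 4 = (rmem s' 4)(k := snd (\<omega> k))" "pending s'' = (\<lambda>i. \<omega> (i + Suc k))"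
        using I by (simp_all add: same_exceptD[OF s''(1)] trained_def)
      \<comment> \<open>The bits of earlier samples lie below the position k * n at which this round
        starts writing, so they are unchanged.\<close>
      have bits: "nmem s'' 5 (t * n + j) = of_bool (j \<in> fst (\<omega> t))" if "t < Suc k" "j < n" for t j
      proof (cases "t = k")
        case False
        then have "t * n + j < Suc t * n" "Suc t * n \<le> k * n"
          using that by (simp, intro mult_right_mono) auto
        then have "t * n + j < k * n" by linarith
        then show ?thesis using s''(3) I that False by (simp add: trained_def)
      qed (use s''(4) that in simp)
      show "runs (Seq (incr 3) (rset 3 (RAdd (rvar 3) (RLit 1)))) s'' 2 (?I (Suc k))"
      proof (rule runs_NStore_Seq[OF runs_RStore[where T = 1]])
        show "?I (Suc k) (rstore 3 (nval (nstore 3 (nval s'' (NLit 0)) (nval s'' (NAdd (nvar 3) (NLit 1))) s'') (NLit 0))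
          (rval (nstore 3 (nval s'' (NLit 0)) (nval s'' (NAdd (nvar 3) (NLit 1))) s'') (RAdd (rvar 3) (RLit 1)))
          (nstore 3 (nval s'' (NLit 0)) (nval s'' (NAdd (nvar 3) (NLit 1))) s''))"
          using I m s''(2) bits by (simp add: trained_def less_Suc_eq)
      qed auto
    qed auto
    ultimately show "bval s' (RLess (rvar 3) (rvar 2)) \<and> runs ?body s' (5 * n + 6) (?I (Suc k))" ..
  next
    fix s' assume I: "?I (nat \<lceil>M\<rceil>) s'"
    moreover have "M \<le> real (nat \<lceil>M\<rceil>)" by linarith
    ultimately show "\<not> bval s' (RLess (rvar 3) (rvar 2))" by (simp add: trained_def)
  qed (use assms in \<open>auto simp: trained_def\<close>)
  then show ?thesis by (rule runs_mono) auto
qed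

text \<open>The factor 12 brings the expected coefficient error down to \<epsilon>^2 / 12, a third
  of the tolerated \<epsilon>^2 / 4, which is what Markov's inequality asks for in
  \<open>coeff_error_prob\<close>.\<close>

definition sample_size :: "nat \<Rightarrow> real \<Rightarrow> nat" where
  "sample_size n \<epsilon> = nat \<lceil>12 / \<epsilon>\<^sup>2 * (real n + 1) ^ (50 * resolution \<epsilon>)\<rceil>"

lemma runs_train:
  assumes "\<epsilon> > 0"
  shows "runs train (train_state n \<epsilon> \<omega>) (153 * resolution \<epsilon> + 3 * n + 8 + sample_size n \<epsilon> * (5 * n + 7))
    (trained n (50 * resolution \<epsilon>) (sample_size n \<epsilon>) \<omega>)"
proof -
  let ?s = "train_state n \<epsilon> \<omega>"
  have init: "nmem ?s 0 0 = n" "nmem ?s 1 0 = 0" "nmem ?s 3 0 = 0" "nmem ?s 4 0 = 0" "rmem ?s 0 0 = \<epsilon>"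
    "rmem ?s 1 0 = 0" "rmem ?s 3 0 = 0" "pending ?s = \<omega>"
    by (simp_all add: train_state_def)
  show ?thesis
    unfolding train_def
  proof (rule runs_Seq[OF runs_degree_loop[OF assms init(5,6,2)]])
    fix s1 assume s1: "same_except {1} {1} ?s s1 \<and> nmem s1 1 0 = 50 * resolution \<epsilon>"
    then have m1: "nmem s1 0 0 = n" "nmem s1 1 0 = 50 * resolution \<epsilon>" "nmem s1 3 0 = 0" "nmem s1 4 0 = 0"
      "rmem s1 0 0 = \<epsilon>" "rmem s1 3 0 = 0" "pending s1 = \<omega>"
      using init by (simp_all add: same_except_def)
    show "runs (Seq dimension_loop (Seq sample_size_loop sample_loop)) s1
       (3 * n + 3 + ((150 * resolution \<epsilon> + 3) + (sample_size n \<epsilon> * (5 * n + 7) + 1))) (trained n (50 * resolution \<epsilon>) (sample_size n \<epsilon>) \<omega>)"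
    proof (rule runs_Seq[OF runs_dimension_loop[OF m1(1)]])
      fix s2 assume s2: "same_except {2} {5} s1 s2 \<and> rmem s2 5 0 = real n + 1"
      then have m2: "nmem s2 0 0 = n" "nmem s2 1 0 = 50 * resolution \<epsilon>" "nmem s2 3 0 = 0" "nmem s2 4 0 = 0"
        "rmem s2 0 0 = \<epsilon>" "rmem s2 3 0 = 0" "pending s2 = \<omega>" "rmem s2 5 0 = real n + 1"
        using m1 by (simp_all add: same_except_def)
      show "runs (Seq sample_size_loop sample_loop) s2
       ((150 * resolution \<epsilon> + 3) + (sample_size n \<epsilon> * (5 * n + 7) + 1)) (trained n (50 * resolution \<epsilon>) (sample_size n \<epsilon>) \<omega>)"
      proof (rule runs_Seq[OF runs_sample_size_loop[OF m2(2,5,8)]])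
        fix s3 assume s3: "same_except {2} {2} s2 s3 \<and> rmem s3 2 0 = 12 / \<epsilon>\<^sup>2 * (real n + 1) ^ (50 * resolution \<epsilon>)"
        then have m3: "nmem s3 0 0 = n" "nmem s3 1 0 = 50 * resolution \<epsilon>" "nmem s3 3 0 = 0" "nmem s3 4 0 = 0"
          "rmem s3 3 0 = 0" "rmem s3 2 0 = 12 / \<epsilon>\<^sup>2 * (real n + 1) ^ (50 * resolution \<epsilon>)" "pending s3 = \<omega>"
          using m2 by (simp_all add: same_except_def)
        show "runs sample_loop s3 (sample_size n \<epsilon> * (5 * n + 7) + 1) (trained n (50 * resolution \<epsilon>) (sample_size n \<epsilon>) \<omega>)"
          using runs_sample_loop[OF m3] by (simp add: sample_size_def)
      qed simp
    qed simp
  qed simp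
qed

section \<open>The truncated kernel and the correctness of evaluation\<close>

definition ksum :: "(nat \<Rightarrow> real) \<Rightarrow> nat \<Rightarrow> nat \<Rightarrow> real" where
  "ksum \<sigma> i k = (\<Sum>S | S \<subseteq> {..<i} \<and> card S \<le> k. \<Prod>j\<in>S. \<sigma> j)"

lemma ksum_0: "ksum \<sigma> 0 k = 1"
proof -
  have "{S. S \<subseteq> {..<0::nat} \<and> card S \<le> k} = {{}}" by auto
  then show ?thesis by (simp add: ksum_def)
qed

text \<open>\<open>ksum \<sigma> i k\<close> is the sum of the elementary symmetric polynomials of
  degrees 0 to k in the first i variables. The recursion separates the sets with and without i; at
  level 0 there is only the empty set.\<close>

lemma ksum_Suc: "ksum \<sigma> (Suc i) k = ksum \<sigma> i k + (if k = 0 then 0 else \<sigma> i * ksum \<sigma> i (k - 1))"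
proof -
  let ?A = "{S. S \<subseteq> {..<i} \<and> card S \<le> k}" and ?B = "{S. S \<subseteq> {..<i} \<and> Suc (card S) \<le> k}"
  have fin: "finite S" "i \<notin> S" if "S \<subseteq> {..<i}" for S
    using that finite_subset[OF that] by auto
  have "{S. S \<subseteq> {..<Suc i} \<and> card S \<le> k} = ?A \<union> insert i ` ?B"
  proof (intro equalityI subsetI)
    fix S assume S: "S \<in> {S. S \<subseteq> {..<Suc i} \<and> card S \<le> k}"
    show "S \<in> ?A \<union> insert i ` ?B"
    proof (cases "i \<in> S")
      case True
      have "finite S" using S finite_subset[of S "{..<Suc i}"] by auto
      then have "Suc (card (S - {i})) = card S" using True by (rule card_Suc_Diff1)
      moreover have "S - {i} \<subseteq> {..<i}" using S by (auto simp: less_Suc_eq)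
      ultimately have "S - {i} \<in> ?B" "S = insert i (S - {i})" using S True by auto
      then show ?thesis by blast
    next
      case False
      then have "S \<subseteq> {..<i}" using S by (auto simp: less_Suc_eq)
      then show ?thesis using S by simp
    qed
  next
    fix S assume "S \<in> ?A \<union> insert i ` ?B"
    then show "S \<in> {S. S \<subseteq> {..<Suc i} \<and> card S \<le> k}"
    proof
      assume "S \<in> insert i ` ?B"
      then obtain S' where "S = insert i S'" "S' \<subseteq> {..<i}" "Suc (card S') \<le> k" by auto
      then show ?thesis using fin[of S'] by auto
    qed auto
  qed
  moreover have "?A \<inter> insert i ` ?B = {}" by auto
  ultimately have "ksum \<sigma> (Suc i) k = ksum \<sigma> i k + (\<Sum>S\<in>insert i ` ?B. prod \<sigma> S)"
    unfolding ksum_def by (subst sum.union_disjoint[symmetric]) auto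
  also have "(\<Sum>S\<in>insert i ` ?B. prod \<sigma> S) = (\<Sum>S\<in>?B. prod \<sigma> (insert i S))"
  proof -
    have "inj_on (insert i) ?B"
      by (intro inj_onI) (metis (no_types, lifting) fin(2) insert_ident mem_Collect_eq)
    then show ?thesis by (simp add: sum.reindex)
  qed
  also have "\<dots> = (\<Sum>S\<in>?B. \<sigma> i * prod \<sigma> S)"
    by (intro sum.cong refl) (use fin in auto)
  also have "\<dots> = (if k = 0 then 0 else \<sigma> i * ksum \<sigma> i (k - 1))"
  proof (cases k)
    case (Suc l)
    then show ?thesis by (simp add: ksum_def sum_distrib_left)
  qed simp
  finally show ?thesis .
qed

lemma runs_reset_levels:
  assumes "nmem s 1 0 = D"
  shows "runs reset_levels s (3 * D + 5)
    (\<lambda>s'. same_except {6} {6} s s' \<and> (\<forall>k\<le>D. rmem s' 6 k = 1))"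
proof -
  let ?I = "\<lambda>k s'. same_except {6} {6} s s' \<and> nmem s' 6 0 = k \<and> (\<forall>j<k. rmem s' 6 j = 1)"
  let ?body = "Seq (RStore 6 (nvar 6) (RLit 1)) (incr 6)"
  have "runs reset_levels s (3 * D + 5) (?I (Suc D))"
    unfolding reset_levels_def
  proof (rule runs_NStore_Seq[OF runs_While[where I = ?I and N = "Suc D" and B = 2]])
    fix k s' assume k: "k < Suc D" and I: "?I k s'"
    have "nmem s' 1 0 = D" using same_exceptD(1)[OF conjunct1[OF I], of 1] assms by simp
    then have "bval s' (NLess (nvar 6) (NAdd (nvar 1) (NLit 1)))" using I k by simp
    moreover have "runs ?body s' 2 (?I (Suc k))"
      by (rule runs_RStore_Seq[OF runs_NStore[where T = 1]])
         (use I in \<open>auto intro!: same_except_store simp: less_Suc_eq\<close>)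
    ultimately show "bval s' (NLess (nvar 6) (NAdd (nvar 1) (NLit 1))) \<and> runs ?body s' 2 (?I (Suc k))" ..
  next
    fix s' assume I: "?I (Suc D) s'"
    have "nmem s' 1 0 = D" using same_exceptD(1)[OF conjunct1[OF I], of 1] assms by simp
    then show "\<not> bval s' (NLess (nvar 6) (NAdd (nvar 1) (NLit 1)))" using I by simp
  qed (use assms in \<open>auto intro!: same_except_store\<close>)
  then show ?thesis by (rule runs_mono) auto
qed

lemma runs_update_levels:
  assumes "nmem s 1 0 = D" "rmem s 7 0 = x"
  shows "runs update_levels s (3 * D + 2)
    (\<lambda>s'. same_except {6} {6} s s' \<and> rmem s' 6 0 = rmem s 6 0 \<and>
       (\<forall>k<D. rmem s' 6 (Suc k) = rmem s 6 (Suc k) + x * rmem s 6 k))"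
proof -
  \<comment> \<open>After c rounds the top c levels are new and those below still old, so the cell
    below the one being written has its old value.\<close>
  let ?I = "\<lambda>c s'. same_except {6} {6} s s' \<and> nmem s' 6 0 = D - c \<and>
    (\<forall>k\<le>D - c. rmem s' 6 k = rmem s 6 k) \<and>
    (\<forall>k<D. D - c \<le> k \<longrightarrow> rmem s' 6 (Suc k) = rmem s 6 (Suc k) + x * rmem s 6 k)"
  let ?body = "Seq (RStore 6 (nvar 6) (RAdd (RMem 6 (nvar 6))
           (RMul (rvar 7) (RMem 6 (NSub (nvar 6) (NLit 1)))))) (nset 6 (NSub (nvar 6) (NLit 1)))"
  have "runs update_levels s (3 * D + 2) (?I D)"
    unfolding update_levels_def
  proof (rule runs_NStore_Seq[OF runs_While[where I = ?I and N = D and B = 2]])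
    fix c s' assume c: "c < D" and I: "?I c s'"
    define l where "l = D - Suc c"
    have l: "D - c = Suc l" "l < D" using c by (auto simp: l_def)
    have 7: "rmem s' 7 0 = x" using same_exceptD(2)[OF conjunct1[OF I], of 7] assms by simp
    have 6: "nmem s' 6 0 = Suc l" "rmem s' 6 (Suc l) = rmem s 6 (Suc l)" "rmem s' 6 l = rmem s 6 l"
      using I l by auto
    have "bval s' (NLess (NLit 0) (nvar 6))" using 6 by simp
    moreover have "runs ?body s' 2 (?I (Suc c))"
    proof (rule runs_RStore_Seq[OF runs_NStore[where T = 1]])
      let ?s = "nstore 6 0 l (rstore 6 (Suc l) (rmem s 6 (Suc l) + x * rmem s 6 l) s')"
      have I': "?I (Suc c) ?s"
        using I l unfolding l_def[symmetric]
        by (auto intro!: same_except_store simp: Suc_le_eq)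
      have eq: "nstore 6 (nval (rstore 6 (nval s' (nvar 6)) (rval s' (RAdd (RMem 6 (nvar 6))
           (RMul (rvar 7) (RMem 6 (NSub (nvar 6) (NLit 1)))))) s') (NLit 0))
          (nval (rstore 6 (nval s' (nvar 6)) (rval s' (RAdd (RMem 6 (nvar 6))
           (RMul (rvar 7) (RMem 6 (NSub (nvar 6) (NLit 1)))))) s') (NSub (nvar 6) (NLit 1)))
          (rstore 6 (nval s' (nvar 6)) (rval s' (RAdd (RMem 6 (nvar 6))
           (RMul (rvar 7) (RMem 6 (NSub (nvar 6) (NLit 1)))))) s') = ?s" (is "?t = _")
        by (simp add: 6 7)
      show "?I (Suc c) ?t" by (rule ssubst[where P = "?I (Suc c)", OF eq I'])
    qed auto
    ultimately show "bval s' (NLess (NLit 0) (nvar 6)) \<and> runs ?body s' 2 (?I (Suc c))" ..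
  qed (use assms in \<open>auto intro!: same_except_store\<close>)
  then show ?thesis by (rule runs_mono) auto
qed

lemma runs_set_sign:
  assumes "nmem s 2 0 = i" "nmem s 4 0 = p" "nmem s 5 p = of_bool (i \<in> y)" "fst (current s) = x"
  shows "runs set_sign s 3 (\<lambda>s'. s' = rstore 7 0 (rad i x * rad i y) s)"
  unfolding set_sign_def
proof (rule runs_Cond[where T' = 2])
  show "runs (if bval s (Bit (nvar 2))
     then Cond (NLess (NLit 0) (NMem 5 (nvar 4))) (rset 7 (RLit 1)) (rset 7 (RLit (-1)))
     else Cond (NLess (NLit 0) (NMem 5 (nvar 4))) (rset 7 (RLit (-1))) (rset 7 (RLit 1))) s 2
     (\<lambda>s'. s' = rstore 7 0 (rad i x * rad i y) s)"
    using assms by (auto intro!: runs_Cond[where T' = 1] runs_RStore simp: rad_def)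
qed simp

text \<open>After i coordinates array 6 holds \<open>ksum\<close> for all levels up to D at once;
  the initial ones are the values for i = 0.\<close>

lemma runs_kernel_loop:
  assumes "nmem s 0 0 = n" "nmem s 1 0 = D" "nmem s 4 0 = p" "\<And>k. k \<le> D \<Longrightarrow> rmem s 6 k = 1"
    "\<And>j. j < n \<Longrightarrow> nmem s 5 (p + j) = of_bool (j \<in> y)" "fst (current s) = x"
  shows "runs kernel_loop s (n * (3 * D + 8) + 2)
    (\<lambda>s'. same_except {2, 4, 6} {6, 7} s s' \<and> nmem s' 4 0 = p + n \<and>
       rmem s' 6 D = ksum (\<lambda>j. rad j x * rad j y) n D)"
proof -
  let ?\<sigma> = "\<lambda>j. rad j x * rad j y"
  let ?I = "\<lambda>i s'. same_except {2, 4, 6} {6, 7} s s' \<and> nmem s' 2 0 = i \<and> nmem s' 4 0 = p + i \<and>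
    (\<forall>k\<le>D. rmem s' 6 k = ksum ?\<sigma> i k)"
  let ?body = "Seq set_sign (Seq update_levels (Seq (incr 4) (incr 2)))"
  have "runs kernel_loop s (n * (3 * D + 8) + 2) (?I n)"
    unfolding kernel_loop_def
  proof (rule runs_NStore_Seq[OF runs_While[where I = ?I and N = n and B = "3 * D + 7"]])
    fix i s' assume i: "i < n" and I: "?I i s'"
    note same = same_exceptD[OF conjunct1[OF I]]
    have m: "nmem s' 0 0 = n" "nmem s' 1 0 = D" "nmem s' 2 0 = i" "nmem s' 4 0 = p + i"
      "nmem s' 5 (p + i) = of_bool (i \<in> y)" "fst (current s') = x"
      using I assms i same(1)[of 0] same(1)[of 1] same(1)[of 5] same(3) by simp_all
    have "bval s' (NLess (nvar 2) (nvar 0))" using m i by simp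
    moreover have "runs ?body s' (3 * D + 7) (?I (Suc i))"
    proof (rule runs_Seq[OF runs_set_sign[OF m(3-6)]])
      fix s1 assume s1: "s1 = rstore 7 0 (?\<sigma> i) s'"
      have m1: "nmem s1 1 0 = D" "rmem s1 7 0 = ?\<sigma> i" using m s1 by simp_all
      show "runs (Seq update_levels (Seq (incr 4) (incr 2))) s1 ((3 * D + 2) + 2) (?I (Suc i))"
      proof (rule runs_Seq[OF runs_update_levels[OF m1]])
        fix s2 assume s2: "same_except {6} {6} s1 s2 \<and> rmem s2 6 0 = rmem s1 6 0 \<and>
          (\<forall>k<D. rmem s2 6 (Suc k) = rmem s1 6 (Suc k) + ?\<sigma> i * rmem s1 6 k)"
        note same2 = same_exceptD[OF conjunct1[OF s2]]
        have m2: "nmem s2 2 0 = i" "nmem s2 4 0 = p + i"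
          using same2(1)[of 2] same2(1)[of 4] m s1 by simp_all
        have lev: "rmem s2 6 k = ksum ?\<sigma> (Suc i) k" if "k \<le> D" for k
          using s2 I that s1 by (cases k) (simp_all add: ksum_Suc)
        have "same_except {2, 4, 6} {6, 7} s' s1" using s1 by (simp add: same_except_store)
        then have "same_except {2, 4, 6} {6, 7} s s1"
          by (rule same_except_trans[OF conjunct1[OF I]]) auto
        then have se: "same_except {2, 4, 6} {6, 7} s s2"
          using conjunct1[OF s2] by (rule same_except_trans) auto
        show "runs (Seq (incr 4) (incr 2)) s2 2 (?I (Suc i))"
        proof (rule runs_NStore_Seq[OF runs_NStore[where T = 1]])
          have "?I (Suc i) (nstore 2 0 (Suc i) (nstore 4 0 (Suc (p + i)) s2))"
            using lev by (auto intro!: same_except_store se)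
          then show "?I (Suc i) (nstore 2 (nval (nstore 4 (nval s2 (NLit 0)) (nval s2 (NAdd (nvar 4) (NLit 1))) s2) (NLit 0))
              (nval (nstore 4 (nval s2 (NLit 0)) (nval s2 (NAdd (nvar 4) (NLit 1))) s2) (NAdd (nvar 2) (NLit 1)))
              (nstore 4 (nval s2 (NLit 0)) (nval s2 (NAdd (nvar 4) (NLit 1))) s2))"
            by (simp add: m2)
        qed auto
      qed simp
    qed simp
    ultimately show "bval s' (NLess (nvar 2) (nvar 0)) \<and> runs ?body s' (3 * D + 7) (?I (Suc i))" ..
  next
    fix s' assume I: "?I n s'"
    have "nmem s' 0 0 = n" using same_exceptD(1)[OF conjunct1[OF I], of 0] assms by simp
    then show "\<not> bval s' (NLess (nvar 2) (nvar 0))" using I by simp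
  qed (use assms in \<open>auto intro!: same_except_store simp: ksum_0\<close>)
  then show ?thesis by (rule runs_mono) auto
qed

text \<open>The empirical Fourier expansion of degree D (see \<open>hypothesis_eq\<close>), in the
  kernel form that the program computes sample by sample.\<close>

definition hypothesis :: "nat \<Rightarrow> nat \<Rightarrow> nat \<Rightarrow> (nat \<Rightarrow> labelled) \<Rightarrow> nat set \<Rightarrow> real" where
  "hypothesis n D m \<omega> x =
     (\<Sum>t<m. snd (\<omega> t) * ksum (\<lambda>j. rad j x * rad j (fst (\<omega> t))) n D) / real m"

lemma runs_evaluate:
  assumes tr: "trained n D m \<omega> s" and x: "fst (current s) = x"
  shows "runs evaluate s (m * (n * (3 * D + 8) + 3 * D + 10) + 5) (\<lambda>s'. rmem s' 0 0 = hypothesis n D m \<omega> x)"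
proof -
  let ?K = "\<lambda>t. ksum (\<lambda>j. rad j x * rad j (fst (\<omega> t))) n D"
  let ?I = "\<lambda>k s'. same_except {2, 4, 6, 7} {6, 7, 8} s s' \<and> nmem s' 7 0 = k \<and> nmem s' 4 0 = k * n \<and>
    rmem s' 8 0 = (\<Sum>t<k. snd (\<omega> t) * ?K t)"
  let ?body = "Seq reset_levels (Seq kernel_loop
             (Seq (rset 8 (RAdd (rvar 8) (RMul (RMem 4 (nvar 7)) (RMem 6 (nvar 1))))) (incr 7)))"
  let ?s = "rstore 8 0 0 (nstore 4 0 0 (nstore 7 0 0 s))"
  have loop: "runs (While (NLess (nvar 7) (nvar 3)) ?body) ?s (m * (n * (3 * D + 8) + 3 * D + 10) + 1) (?I m)"
  proof (rule runs_While[where I = ?I and N = m and B = "n * (3 * D + 8) + 3 * D + 9"])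
    fix k s' assume k: "k < m" and I: "?I k s'"
    note same = same_exceptD[OF conjunct1[OF I]]
    have m: "nmem s' 0 0 = n" "nmem s' 1 0 = D" "nmem s' 3 0 = m"
      "rmem s' 4 k = snd (\<omega> k)" "\<And>j. j < n \<Longrightarrow> nmem s' 5 (k * n + j) = of_bool (j \<in> fst (\<omega> k))"
      "fst (current s') = x" "nmem s' 4 0 = k * n" "nmem s' 7 0 = k"
      using I tr x k same(1)[of 0] same(1)[of 1] same(1)[of 3] same(1)[of 5] same(2)[of 4] same(3)
      by (simp_all add: trained_def)
    have "bval s' (NLess (nvar 7) (nvar 3))" using m k by simp
    moreover have "runs ?body s' (n * (3 * D + 8) + 3 * D + 9) (?I (Suc k))"
    proof (rule runs_Seq[OF runs_reset_levels[OF m(2)]])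
      fix s1 assume s1: "same_except {6} {6} s' s1 \<and> (\<forall>k\<le>D. rmem s1 6 k = 1)"
      note same1 = same_exceptD[OF conjunct1[OF s1]]
      have m1: "nmem s1 0 0 = n" "nmem s1 1 0 = D" "nmem s1 4 0 = k * n" "\<And>k. k \<le> D \<Longrightarrow> rmem s1 6 k = 1"
        "\<And>j. j < n \<Longrightarrow> nmem s1 5 (k * n + j) = of_bool (j \<in> fst (\<omega> k))" "fst (current s1) = x"
        using s1 m same1(1)[of 0] same1(1)[of 1] same1(1)[of 4] same1(1)[of 5] same1(3) by simp_all
      show "runs (Seq kernel_loop
             (Seq (rset 8 (RAdd (rvar 8) (RMul (RMem 4 (nvar 7)) (RMem 6 (nvar 1))))) (incr 7)))
          s1 ((n * (3 * D + 8) + 2) + 2) (?I (Suc k))"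
      proof (rule runs_Seq[OF runs_kernel_loop[OF m1]])
        fix s2 assume s2: "same_except {2, 4, 6} {6, 7} s1 s2 \<and> nmem s2 4 0 = k * n + n \<and> rmem s2 6 D = ?K k"
        have "same_except {2, 4, 6} {6, 7} s' s2"
          using conjunct1[OF s1] conjunct1[OF s2] by (rule same_except_trans) auto
        note same2 = same_exceptD[OF this]
        have se: "same_except {2, 4, 6, 7} {6, 7, 8} s s2"
          using conjunct1[OF I] \<open>same_except {2, 4, 6} {6, 7} s' s2\<close> by (rule same_except_trans) auto
        have m2: "nmem s2 1 0 = D" "nmem s2 7 0 = k" "rmem s2 4 k = snd (\<omega> k)" "nmem s2 4 0 = n + k * n"
          "rmem s2 8 0 = (\<Sum>t<k. snd (\<omega> t) * ?K t)" "rmem s2 6 D = ?K k"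
          using s2 m I same2(1)[of 1] same2(1)[of 7] same2(2)[of 4] same2(2)[of 8] by simp_all
        show "runs (Seq (rset 8 (RAdd (rvar 8) (RMul (RMem 4 (nvar 7)) (RMem 6 (nvar 1))))) (incr 7)) s2 2 (?I (Suc k))"
        proof (rule runs_RStore_Seq[OF runs_NStore[where T = 1]])
          let ?t = "rstore 8 0 ((\<Sum>t<k. snd (\<omega> t) * ?K t) + snd (\<omega> k) * ?K k) s2"
          have "?I (Suc k) (nstore 7 0 (Suc k) ?t)"
            using m2 by (auto intro!: same_except_store se)
          then show "?I (Suc k) (nstore 7
             (nval (rstore 8 (nval s2 (NLit 0)) (rval s2 (RAdd (rvar 8) (RMul (RMem 4 (nvar 7)) (RMem 6 (nvar 1))))) s2) (NLit 0))
             (nval (rstore 8 (nval s2 (NLit 0)) (rval s2 (RAdd (rvar 8) (RMul (RMem 4 (nvar 7)) (RMem 6 (nvar 1))))) s2) (NAdd (nvar 7) (NLit 1)))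
             (rstore 8 (nval s2 (NLit 0)) (rval s2 (RAdd (rvar 8) (RMul (RMem 4 (nvar 7)) (RMem 6 (nvar 1))))) s2))"
            using m2(1-3,5,6) by simp
        qed auto
      qed auto
    qed simp
    ultimately show "bval s' (NLess (nvar 7) (nvar 3)) \<and> runs ?body s' (n * (3 * D + 8) + 3 * D + 9) (?I (Suc k))" ..
  next
    fix s' assume I: "?I m s'"
    have "nmem s' 3 0 = m" using same_exceptD(1)[OF conjunct1[OF I], of 3] tr by (simp add: trained_def)
    then show "\<not> bval s' (NLess (nvar 7) (nvar 3))" using I by simp
  qed (auto intro!: same_except_store)
  have "runs (Seq (While (NLess (nvar 7) (nvar 3)) ?body) (rset 0 (RDiv (rvar 8) (rvar 3)))) ?s
      ((m * (n * (3 * D + 8) + 3 * D + 10) + 1) + 1) (\<lambda>s'. rmem s' 0 0 = hypothesis n D m \<omega> x)"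
  proof (rule runs_Seq[OF loop])
    fix s' assume I: "?I m s'"
    have "rmem s' 3 0 = real m" using same_exceptD(2)[OF conjunct1[OF I], of 3] tr by (simp add: trained_def)
    then show "runs (rset 0 (RDiv (rvar 8) (rvar 3))) s' 1 (\<lambda>s'. rmem s' 0 0 = hypothesis n D m \<omega> x)"
      using I by (intro runs_RStore) (simp_all add: hypothesis_def)
  qed simp
  then show ?thesis
    unfolding evaluate_def
    by (intro runs_NStore_Seq runs_RStore_Seq) (auto intro: runs_mono)
qed

text \<open>Execution is deterministic, so the output is fixed on the cube. This turns the success
  event into a statement about \<open>hypothesis\<close>, whose measurability can be
  checked.\<close>

lemma outputs_iff:
  assumes "\<epsilon> > 0"
  shows "outputs (train, evaluate) n \<epsilon> \<omega> h \<longleftrightarrow>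
    (\<forall>x\<in>Pow {..<n}. h x = hypothesis n (50 * resolution \<epsilon>) (sample_size n \<epsilon>) \<omega> x)"
proof -
  let ?h = "hypothesis n (50 * resolution \<epsilon>) (sample_size n \<epsilon>) \<omega>"
  obtain t s where ts: "exec train (train_state n \<epsilon> \<omega>) t s" "trained n (50 * resolution \<epsilon>) (sample_size n \<epsilon>) \<omega> s"
    using runs_train[OF assms] unfolding runs_def by blast
  have q: "\<exists>t' s'. exec evaluate (query_state s x) t' s' \<and> rmem s' 0 0 = ?h x" for x
  proof -
    have "trained n (50 * resolution \<epsilon>) (sample_size n \<epsilon>) \<omega> (query_state s x)" "fst (current (query_state s x)) = x"
      using ts(2) by (simp_all add: trained_def query_state_def)
    from runs_evaluate[OF this] show ?thesis unfolding runs_def by blast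
  qed
  show ?thesis
  proof
    assume "outputs (train, evaluate) n \<epsilon> \<omega> h"
    then obtain t1 s1 where "exec train (train_state n \<epsilon> \<omega>) t1 s1"
      "\<forall>x\<in>Pow {..<n}. \<exists>t' s'. exec evaluate (query_state s1 x) t' s' \<and> rmem s' 0 0 = h x"
      unfolding outputs_def by auto
    moreover from this have "s1 = s" using exec_deterministic ts(1) by blast
    ultimately show "\<forall>x\<in>Pow {..<n}. h x = ?h x" using q exec_deterministic by metis
  next
    assume "\<forall>x\<in>Pow {..<n}. h x = ?h x"
    then show "outputs (train, evaluate) n \<epsilon> \<omega> h"
      unfolding outputs_def using ts(1) q by (intro exI[of _ t] exI[of _ s]) simp
  qed
qed

lemma halts_within_learner:
  assumes "\<epsilon> > 0"
    and "real (153 * resolution \<epsilon> + 3 * n + 8 + sample_size n \<epsilon> * (5 * n + 7)) \<le> T"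
    and "real (sample_size n \<epsilon> * (n * (150 * resolution \<epsilon> + 8) + 150 * resolution \<epsilon> + 10) + 5) \<le> T"
  shows "halts_within (train, evaluate) n \<epsilon> \<omega> T"
proof -
  obtain t s where ts: "exec train (train_state n \<epsilon> \<omega>) t s" "trained n (50 * resolution \<epsilon>) (sample_size n \<epsilon>) \<omega> s"
    "t \<le> 153 * resolution \<epsilon> + 3 * n + 8 + sample_size n \<epsilon> * (5 * n + 7)"
    using runs_train[OF assms(1)] unfolding runs_def by blast
  have "\<exists>t' s'. exec evaluate (query_state s x) t' s' \<and> real t' \<le> T" for x
  proof -
    have "trained n (50 * resolution \<epsilon>) (sample_size n \<epsilon>) \<omega> (query_state s x)" "fst (current (query_state s x)) = x"
      using ts(2) by (simp_all add: trained_def query_state_def)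
    from runs_evaluate[OF this] obtain t' s' where "exec evaluate (query_state s x) t' s'"
      "t' \<le> sample_size n \<epsilon> * (n * (150 * resolution \<epsilon> + 8) + 150 * resolution \<epsilon> + 10) + 5"
      unfolding runs_def by auto
    then show ?thesis using assms(3) by (meson of_nat_mono order_trans)
  qed
  moreover have "real t \<le> T" using ts(3) assms(2) by (meson of_nat_mono order_trans)
  ultimately show ?thesis
    unfolding halts_within_def using ts(1) by (intro exI[of _ t] exI[of _ s]) simp
qed

section \<open>Running time\<close>

text \<open>The predecessor of the resolution fails the defining inequality, so it is below
  \<epsilon>^(-4/5). If \<epsilon> < 1/2, rounding up costs a factor 2, and the logarithm, being at
  least 1/2, another factor 2. For larger \<epsilon> the resolution is below 3 and the maximum with
  1 suffices.\<close>

lemma resolution_le_exponent: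
  assumes "\<epsilon> > 0"
  shows "real (resolution \<epsilon>) \<le> 4 * learning_exponent \<epsilon>"
proof -
  define r where "r = real (resolution \<epsilon> - 1)"
  have r: "real (resolution \<epsilon>) = r + 1" "r \<ge> 0" using resolution_works(3)[OF assms] by (simp_all add: r_def)
  have "r ^ 5 * \<epsilon> ^ 4 < 1"
    unfolding r_def by (rule resolution_works(2)[OF assms]) (use resolution_works(3)[OF assms] in simp)
  then have r5: "r ^ 5 < 1 / \<epsilon> ^ 4" using assms by (simp add: field_simps)
  show ?thesis
  proof (cases "\<epsilon> \<ge> 1 / 2")
    case True
    have "(1 / 2) ^ 4 \<le> \<epsilon> ^ 4" using True by (intro power_mono) auto
    then have "1 / \<epsilon> ^ 4 \<le> 2 ^ 5" using assms by (simp add: field_simps)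
    with r5 have "r ^ 5 < 2 ^ 5" by linarith
    then have "r < 2" by (rule power_less_imp_less_base) simp
    then show ?thesis using r by (simp add: learning_exponent_def)
  next
    case False
    let ?y = "\<epsilon> powr (4 / 5)"
    have y: "0 < ?y" "?y \<le> 1" using assms False by (auto simp: powr_le1)
    have "(1 / ?y) ^ 5 = 1 / \<epsilon> ^ 4"
    proof -
      have "?y ^ 5 = \<epsilon> powr (4 / 5 * real 5)" using assms by (subst powr_powr[symmetric]) (simp add: powr_realpow)
      also have "\<dots> = \<epsilon> ^ 4" using assms by (simp add: powr_realpow)
      finally show ?thesis by (simp add: power_divide)
    qed
    with r5 have "r ^ 5 < (1 / ?y) ^ 5" by simp
    then have "r < 1 / ?y" by (rule power_less_imp_less_base) (use y in simp)
    moreover have "1 \<le> 1 / ?y" using y by simp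
    ultimately have *: "real (resolution \<epsilon>) \<le> 2 / ?y" using r by simp
    have "2 \<le> 1 / \<epsilon>" using False assms by (simp add: field_simps)
    then have "ln 2 \<le> ln (1 / \<epsilon>)" using assms by (subst ln_le_cancel_iff) auto
    then have "1 / 2 \<le> ln (1 / \<epsilon>)" using ln2_ge_two_thirds by linarith
    then have "4 * (1 / 2 / ?y) \<le> 4 * (ln (1 / \<epsilon>) / ?y)"
      using y by (intro mult_left_mono divide_right_mono) auto
    also have "\<dots> \<le> 4 * learning_exponent \<epsilon>" by (simp add: learning_exponent_def)
    finally show ?thesis using * by simp
  qed
qed

lemma two_power_le: "2 \<le> X \<Longrightarrow> \<not> 2 ^ k < c \<Longrightarrow> c \<le> X ^ k" for X :: real
  by (rule order_trans[OF _ power_mono[of 2 X k]]) auto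

context
  fixes n :: nat and \<epsilon> X :: real and r :: nat
  assumes n: "n \<ge> 2" and \<epsilon>: "\<epsilon> > 0"
  defines "r \<equiv> resolution \<epsilon>" and "X \<equiv> real n ^ r"
begin

text \<open>Every quantity in the running time is compared with powers of X = n^r, where r is the
  resolution. The definition of r bounds 1 / \<epsilon>^2 by r^(5/2), which is rounded up to
  r^3.\<close>

lemma size_bounds: "r \<ge> 1" "2 \<le> X" "real n \<le> X" "real r \<le> X" "1 / \<epsilon>\<^sup>2 \<le> X ^ 3"
proof -
  have n2: "real n \<ge> 2" using n by simp
  show r: "r \<ge> 1" unfolding r_def by (rule resolution_works(3)[OF \<epsilon>])
  have "real n ^ 1 \<le> X" unfolding X_def using n2 r by (intro power_increasing) auto
  then show nX: "real n \<le> X" by simp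
  then show "2 \<le> X" using n2 by simp
  have "real r \<le> 2 ^ r" by (metis less_imp_le of_nat_less_two_power)
  also have "\<dots> \<le> X" unfolding X_def using n2 by (intro power_mono) auto
  finally show rX: "real r \<le> X" .
  have "(1 / \<epsilon>\<^sup>2)\<^sup>2 \<le> real r ^ 5"
    using resolution_works(1)[OF \<epsilon>] \<epsilon> by (simp add: r_def field_simps flip: power_mult)
  also have "\<dots> \<le> real r ^ 6" using r by (intro power_increasing) auto
  also have "\<dots> = (real r ^ 3)\<^sup>2" by (simp flip: power_mult)
  finally have "1 / \<epsilon>\<^sup>2 \<le> real r ^ 3" by (rule power2_le_imp_le) simp
  also have "\<dots> \<le> X ^ 3" using rX by (intro power_mono) auto
  finally show "1 / \<epsilon>\<^sup>2 \<le> X ^ 3" .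
qed

text \<open>Since n + 1 is at most n^2, the power contributes X^100. The constant 12 costs X^4, the
  factor 1 / \<epsilon>^2 costs X^3, and rounding up one more X.\<close>

lemma sample_size_le: "real (sample_size n \<epsilon>) \<le> X ^ 108"
proof -
  note [simp] = size_bounds
  have X0: "0 \<le> X" using size_bounds(2) by linarith
  have "real n + 1 \<le> 2 * real n" using n by simp
  also have "\<dots> \<le> real n * real n" using n by (intro mult_right_mono) (use X0 in auto)
  finally have "(real n + 1) ^ (50 * r) \<le> (real n * real n) ^ (50 * r)"
    by (intro power_mono) auto
  also have "\<dots> = X ^ 100"
    by (simp add: X_def power_mult_distrib mult.commute flip: power_mult power_add)
  finally have 1: "(real n + 1) ^ (50 * r) \<le> X ^ 100" .
  have "12 / \<epsilon>\<^sup>2 * (real n + 1) ^ (50 * r) = 12 * (1 / \<epsilon>\<^sup>2) * (real n + 1) ^ (50 * r)" by simp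
  also have "\<dots> \<le> X ^ 4 * X ^ 3 * X ^ 100"
    using 1 X0 by (intro mult_mono[OF mult_mono[OF two_power_le]]) auto
  also have "\<dots> = X ^ 107" by (simp flip: power_add)
  finally have "12 / \<epsilon>\<^sup>2 * (real n + 1) ^ (50 * r) \<le> X ^ 107" .
  moreover have "real (sample_size n \<epsilon>) \<le> 12 / \<epsilon>\<^sup>2 * (real n + 1) ^ (50 * r) + 1"
  proof -
    have "real (nat \<lceil>x\<rceil>) \<le> x + 1" if "0 \<le> x" for x :: real using that by linarith
    then show ?thesis by (simp add: sample_size_def r_def)
  qed
  moreover have "1 \<le> X ^ 107" by (rule one_le_power) (use size_bounds(2) in linarith)
  ultimately have "real (sample_size n \<epsilon>) \<le> 2 * X ^ 107" by linarith
  also have "\<dots> \<le> X * X ^ 107" by (intro mult_right_mono) (use X0 in auto)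
  finally show ?thesis by (simp flip: power_Suc)
qed

text \<open>Constants are absorbed by powers of X, which is at least 2. Evaluation has the larger
  bound: X^108 samples with X^11 steps each, and one more X for lower-order terms.\<close>

lemma halts_within_power: "halts_within (train, evaluate) n \<epsilon> \<omega> (X ^ 120)"
proof (rule halts_within_learner[OF \<epsilon>])
  note [simp] = size_bounds
  let ?N = "real (sample_size n \<epsilon>)"
  have X1: "1 \<le> X" using size_bounds(2) by linarith
  have mono: "X ^ i \<le> X ^ j" if "i \<le> j" for i j
    using that X1 by (intro power_increasing)
  have "153 * real r \<le> X ^ 8 * X" by (intro mult_mono[OF two_power_le]) (use X1 in auto)
  moreover have "3 * real n \<le> X ^ 2 * X" by (intro mult_mono[OF two_power_le]) (use X1 in auto)
  moreover have "8 \<le> X ^ 3" by (intro two_power_le) auto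
  moreover have "?N * (5 * real n + 7) \<le> X ^ 108 * X ^ 5"
  proof (intro mult_mono sample_size_le)
    have "5 * real n + 7 \<le> 12 * X" using size_bounds(2,3) by linarith
    also have "\<dots> \<le> X ^ 4 * X" by (intro mult_mono[OF two_power_le]) (use X1 in auto)
    finally show "5 * real n + 7 \<le> X ^ 5" by (simp flip: power_Suc2)
  qed auto
  ultimately have "153 * real r + 3 * real n + 8 + ?N * (5 * real n + 7) \<le> X ^ 9 + X ^ 3 + X ^ 3 + X ^ 113"
    by (simp flip: power_Suc2 power_add)
  also have "\<dots> \<le> 4 * X ^ 113" using mono[of 9 113] mono[of 3 113] by linarith
  also have "\<dots> \<le> X ^ 2 * X ^ 113" by (intro mult_right_mono[OF two_power_le]) (use X1 in auto)
  also have "\<dots> \<le> X ^ 120" by (simp add: mono flip: power_add)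
  finally show "real (153 * resolution \<epsilon> + 3 * n + 8 + sample_size n \<epsilon> * (5 * n + 7)) \<le> X ^ 120"
    by (simp add: r_def algebra_simps)
  have "?N * (real n * (150 * real r + 8) + (150 * real r + 10)) \<le> X ^ 108 * X ^ 11"
  proof (intro mult_mono sample_size_le)
    have a: "150 * real r + 8 \<le> 160 * X" "150 * real r + 10 \<le> 160 * X"
      using size_bounds(2,4) by linarith+
    have b: "160 * X \<le> X ^ 8 * X" by (intro mult_mono[OF two_power_le]) (use X1 in auto)
    have "real n * (150 * real r + 8) + (150 * real r + 10) \<le> X * X ^ 9 + X ^ 9"
      using a b X1 by (intro add_mono mult_mono) (auto simp flip: power_Suc2)
    also have "\<dots> \<le> 2 * X ^ 10" using mono[of 9 10] by (simp flip: power_Suc)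
    also have "\<dots> \<le> X * X ^ 10" by (intro mult_right_mono) (use X1 in auto)
    finally show "real n * (150 * real r + 8) + (150 * real r + 10) \<le> X ^ 11" by (simp flip: power_Suc)
  qed (use X1 in auto)
  also have "X ^ 108 * X ^ 11 = X ^ 119" by (simp flip: power_add)
  finally have "?N * (real n * (150 * real r + 8) + (150 * real r + 10)) + 5 \<le> 2 * X ^ 119"
    using mono[of 3 119] two_power_le[of X 3 5] by simp
  also have "\<dots> \<le> X * X ^ 119" by (intro mult_right_mono) (use X1 in auto)
  finally show "real (sample_size n \<epsilon> * (n * (150 * resolution \<epsilon> + 8) + 150 * resolution \<epsilon> + 10) + 5) \<le> X ^ 120"
    by (simp add: r_def algebra_simps flip: power_Suc)
qed

end

lemma runs_in_time_learner:
  "runs_in_time (train, evaluate) (\<lambda>n \<epsilon>. real n powr (480 * learning_exponent \<epsilon>))"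
  unfolding runs_in_time_def
proof (intro allI impI)
  fix n :: nat and \<epsilon> :: real and \<omega> :: "nat \<Rightarrow> labelled"
  assume n: "n \<ge> 2" and \<epsilon>: "\<epsilon> > 0"
  \<comment> \<open>480 is this 120 times the 4 of \<open>resolution_le_exponent\<close>.\<close>
  have "(real n ^ resolution \<epsilon>) ^ 120 = real n powr (real (resolution \<epsilon> * 120))"
    by (subst powr_realpow) (use n in \<open>simp_all add: power_mult\<close>)
  also have "\<dots> \<le> real n powr (480 * learning_exponent \<epsilon>)"
    using n resolution_le_exponent[OF \<epsilon>] by (intro powr_mono) auto
  finally show "halts_within (train, evaluate) n \<epsilon> \<omega> (real n powr (480 * learning_exponent \<epsilon>))"
    using halts_within_power[OF n \<epsilon>, of \<omega>] unfolding halts_within_def by (meson order_trans)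
qed

section \<open>Agnostic learning from empirical Fourier coefficients\<close>

lemma hypothesis_eq:
  assumes "x \<subseteq> {..<n}"
  shows "hypothesis n D m \<omega> x =
    (\<Sum>S | S \<subseteq> {..<n} \<and> card S \<le> D. (\<Sum>t<m. snd (\<omega> t) * chi S (fst (\<omega> t))) / m * chi S x)"
proof -
  have "(\<Prod>j\<in>S. rad j x * rad j y) = chi S x * chi S y" for S y
    by (simp add: chi_def flip: prod.distrib)
  then have ksum: "ksum (\<lambda>j. rad j x * rad j y) n D = (\<Sum>S | S \<subseteq> {..<n} \<and> card S \<le> D. chi S x * chi S y)" for y
    by (simp add: ksum_def)
  have "hypothesis n D m \<omega> x = (\<Sum>t<m. \<Sum>S | S \<subseteq> {..<n} \<and> card S \<le> D.
      snd (\<omega> t) * chi S (fst (\<omega> t)) / m * chi S x)"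
    unfolding hypothesis_def ksum sum_divide_distrib sum_distrib_left by (simp add: mult_ac)
  also have "\<dots> = (\<Sum>S | S \<subseteq> {..<n} \<and> card S \<le> D. \<Sum>t<m.
      snd (\<omega> t) * chi S (fst (\<omega> t)) / m * chi S x)"
    by (rule sum.swap)
  finally show ?thesis by (simp only: sum_divide_distrib sum_distrib_right)
qed

text \<open>A set of at most D elements is listed and padded to length D with the extra symbol n, so
  it comes from a word of length D over n + 1 symbols.\<close>

lemma card_low_degree_le: "card {S. S \<subseteq> {..<n} \<and> card S \<le> D} \<le> (n + 1) ^ D"
proof -
  let ?X = "{xs. set xs \<subseteq> {..n} \<and> length xs = D}"
  have "{S. S \<subseteq> {..<n} \<and> card S \<le> D} \<subseteq> (\<lambda>xs. set xs - {n}) ` ?X"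
  proof
    fix S assume "S \<in> {S. S \<subseteq> {..<n} \<and> card S \<le> D}"
    then have S: "S \<subseteq> {..<n}" "card S \<le> D" by auto
    then have "finite S" using finite_subset by blast
    then obtain xs where xs: "set xs = S" "length xs = card S"
      using finite_distinct_list distinct_card by metis
    have "set (xs @ replicate (D - card S) n) - {n} = S" "xs @ replicate (D - card S) n \<in> ?X"
      using xs S by (auto simp: subset_iff less_imp_le split: if_splits)
    then show "S \<in> (\<lambda>xs. set xs - {n}) ` ?X" by blast
  qed
  then have "card {S. S \<subseteq> {..<n} \<and> card S \<le> D} \<le> card ?X"
    by (intro surj_card_le finite_lists_length_eq) auto
  also have "\<dots> = (n + 1) ^ D" by (simp add: card_lists_length_eq)
  finally show ?thesis .
qed

lemma cube_avg_square_chi_sum: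
  assumes "finite V" "K \<subseteq> Pow V"
  shows "cube_avg V (\<lambda>x. (\<Sum>S\<in>K. a S * chi S x)\<^sup>2) = (\<Sum>S\<in>K. (a S)\<^sup>2)"
proof -
  have K: "finite K" using assms finite_subset by blast
  have "cube_avg V (\<lambda>x. (\<Sum>S\<in>K. a S * chi S x)\<^sup>2)
      = (\<Sum>S\<in>K. \<Sum>T\<in>K. cube_avg V (\<lambda>x. a S * a T * (chi S x * chi T x)))"
    by (simp add: power2_eq_square sum_product cube_avg_sum mult_ac)
  also have "\<dots> = (\<Sum>S\<in>K. \<Sum>T\<in>K. a S * a T * (if S = T then 1 else 0))"
  proof (intro sum.cong refl)
    fix S T assume "S \<in> K" "T \<in> K"
    then have "S \<subseteq> V" "T \<subseteq> V" using assms by auto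
    from chi_orthonormal[OF assms(1) this] show "cube_avg V (\<lambda>x. a S * a T * (chi S x * chi T x)) = a S * a T * (if S = T then 1 else 0)"
      unfolding cube_avg_cmult by simp
  qed
  also have "\<dots> = (\<Sum>S\<in>K. (a S)\<^sup>2)"
    using K by (simp add: power2_eq_square if_distrib cong: if_cong)
  finally show ?thesis .
qed

section \<open>Square error under a uniform marginal\<close>

locale uniform_examples =
  fixes n :: nat and P :: "labelled measure"
  assumes marginal: "uniform_marginal n P"
begin

sublocale prob_space P
  using marginal by (simp add: uniform_marginal_def)

lemma sets_P: "sets P = sets (labelled_space n)"
  using marginal by (simp add: uniform_marginal_def)

lemma in_space_P: "z \<in> space P \<Longrightarrow> fst z \<subseteq> {..<n} \<and> snd z \<in> {0..1}"
  unfolding sets_eq_imp_space_eq[OF sets_P] labelled_space_def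
  by (auto simp: space_pair_measure space_restrict_space)

lemma measurable_fst_P [measurable]: "fst \<in> P \<rightarrow>\<^sub>M count_space (Pow {..<n})"
  unfolding measurable_cong_sets[OF sets_P refl] labelled_space_def by simp

lemma measurable_snd_P [measurable]: "snd \<in> borel_measurable P"
proof -
  have "snd \<in> count_space (Pow {..<n}) \<Otimes>\<^sub>M restrict_space borel {0..1::real} \<rightarrow>\<^sub>M restrict_space borel {0..1}"
    by simp
  then show ?thesis
    unfolding measurable_cong_sets[OF sets_P refl] labelled_space_def
    using measurable_restrict_space2_iff by blast
qed

lemma measurable_cube [measurable]: "(\<lambda>z. g (fst z) :: real) \<in> borel_measurable P"
  by (rule measurable_compose[OF measurable_fst_P]) simp

lemma integrable_bounded:
  assumes "f \<in> borel_measurable P" "\<And>z. z \<in> space P \<Longrightarrow> \<bar>f z\<bar> \<le> (B :: real)"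
  shows "integrable P f"
  using assms by (intro integrable_const_bound[where B = B]) (auto intro!: AE_I2)

lemma abs_le_sum_abs: "A \<subseteq> {..<n} \<Longrightarrow> \<bar>g A\<bar> \<le> (\<Sum>A\<in>Pow {..<n}. \<bar>g A :: real\<bar>)"
  by (intro member_le_sum) auto

lemma integrable_cube: "integrable P (\<lambda>z. g (fst z) :: real)"
  by (rule integrable_bounded[where B = "\<Sum>A\<in>Pow {..<n}. \<bar>g A\<bar>"])
     (auto intro!: abs_le_sum_abs dest: in_space_P)

lemma integrable_label_times_cube: "integrable P (\<lambda>z. snd z * g (fst z))"
proof (rule integrable_bounded[where B = "\<Sum>A\<in>Pow {..<n}. \<bar>g A\<bar>"])
  fix z assume z: "z \<in> space P"
  have "\<bar>snd z * g (fst z)\<bar> \<le> 1 * \<bar>g (fst z)\<bar>"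
    unfolding abs_mult using in_space_P[OF z] by (intro mult_right_mono) auto
  also have "\<dots> \<le> (\<Sum>A\<in>Pow {..<n}. \<bar>g A\<bar>)" using abs_le_sum_abs[of "fst z" g] in_space_P[OF z] by simp
  finally show "\<bar>snd z * g (fst z)\<bar> \<le> (\<Sum>A\<in>Pow {..<n}. \<bar>g A\<bar>)" .
qed simp

lemma integrable_label_square: "integrable P (\<lambda>z. (snd z)\<^sup>2)"
  by (rule integrable_bounded[where B = 1])
     (auto dest!: in_space_P simp: abs_square_le_1)

lemma integral_cube: "(\<integral>z. g (fst z) \<partial>P) = cube_avg {..<n} g"
proof -
  have "(\<integral>z. g (fst z) \<partial>P) = (\<integral>x. g x \<partial>distr P (count_space (Pow {..<n})) fst)"
    by (rule integral_distr[symmetric]) auto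
  also have "\<dots> = (\<integral>x. g x \<partial>uniform_count_measure (Pow {..<n}))"
    using marginal by (simp add: uniform_marginal_def)
  also have "\<dots> = cube_avg {..<n} g"
    by (simp add: integral_uniform_count_measure cube_avg_def card_Pow)
  finally show ?thesis .
qed

definition sq_err :: "(nat set \<Rightarrow> real) \<Rightarrow> real" where
  "sq_err h = (\<integral>z. (snd z - h (fst z))\<^sup>2 \<partial>P)"

definition corr :: "nat set \<Rightarrow> real" where
  "corr S = (\<integral>z. snd z * chi S (fst z) \<partial>P)"

lemma sq_expand: "(snd z - h (fst z))\<^sup>2 = (snd z)\<^sup>2 - 2 * (snd z * h (fst z)) + (h (fst z))\<^sup>2"
  for h :: "nat set \<Rightarrow> real" and z :: labelled
  by (simp add: power2_diff)

lemma integrable_sq_err: "integrable P (\<lambda>z. (snd z - h (fst z))\<^sup>2)"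
  unfolding sq_expand
  by (intro Bochner_Integration.integrable_add Bochner_Integration.integrable_diff
      integrable_label_square integrable_mult_right integrable_label_times_cube
      integrable_cube[where g = "\<lambda>x. (h x)\<^sup>2"])

lemma sq_err_expand:
  "sq_err h = (\<integral>z. (snd z)\<^sup>2 \<partial>P) - 2 * (\<integral>z. snd z * h (fst z) \<partial>P) + cube_avg {..<n} (\<lambda>x. (h x)\<^sup>2)"
  unfolding sq_err_def sq_expand
  using integrable_label_square integrable_label_times_cube[of h] integrable_cube[of "\<lambda>x. (h x)\<^sup>2"]
    integral_cube[of "\<lambda>x. (h x)\<^sup>2"]
  by simp

lemma sq_err_cong: "(\<And>x. x \<subseteq> {..<n} \<Longrightarrow> h x = h' x) \<Longrightarrow> sq_err h = sq_err h'"
  unfolding sq_err_def by (intro Bochner_Integration.integral_cong refl) (use in_space_P in auto)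

lemma l2_error_eq: "l2_error P h = sqrt (sq_err h)"
  by (simp add: l2_error_def sq_err_def)

lemma sq_err_nonneg: "0 \<le> sq_err h"
  by (simp add: sq_err_def)

text \<open>Uniformity makes the characters orthonormal under P. Completing the square in each
  coefficient shows that \<open>corr\<close> is the best choice and that any other costs its squared
  distance from \<open>corr\<close>.\<close>

lemma sq_err_chi_sum:
  assumes K: "K \<subseteq> Pow {..<n}"
  shows "sq_err (\<lambda>x. \<Sum>S\<in>K. a S * chi S x)
    = (\<integral>z. (snd z)\<^sup>2 \<partial>P) - (\<Sum>S\<in>K. (corr S)\<^sup>2) + (\<Sum>S\<in>K. (a S - corr S)\<^sup>2)"
proof -
  have "(\<integral>z. snd z * (\<Sum>S\<in>K. a S * chi S (fst z)) \<partial>P) = (\<integral>z. (\<Sum>S\<in>K. a S * (snd z * chi S (fst z))) \<partial>P)"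
    by (simp add: sum_distrib_left mult_ac)
  also have "\<dots> = (\<Sum>S\<in>K. a S * corr S)"
    using integrable_label_times_cube by (simp add: corr_def)
  finally have "sq_err (\<lambda>x. \<Sum>S\<in>K. a S * chi S x)
      = (\<integral>z. (snd z)\<^sup>2 \<partial>P) - 2 * (\<Sum>S\<in>K. a S * corr S) + (\<Sum>S\<in>K. (a S)\<^sup>2)"
    unfolding sq_err_expand using cube_avg_square_chi_sum[OF finite_lessThan K] by simp
  then show ?thesis
    by (simp add: power2_diff sum.distrib sum_subtractf sum_distrib_left mult_ac)
qed

text \<open>Minkowski's inequality, by integrating a pointwise bound for (u + v)^2 with a weight s
  to be optimised.\<close>

lemma l2_triangle:
  assumes "cube_avg {..<n} (\<lambda>x. (f x - g x)\<^sup>2) \<le> \<delta>\<^sup>2" "\<delta> > 0"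
  shows "sqrt (sq_err g) \<le> sqrt (sq_err f) + \<delta>"
proof (rule field_le_epsilon)
  fix e :: real assume "e > 0"
  \<comment> \<open>The slack e keeps a positive, so that s = \<delta> / a makes sense even if f has
    no error. With this s the bound becomes exactly (a + \<delta>)^2.\<close>
  define a where "a = sqrt (sq_err f) + e"
  have a: "a > 0" "sq_err f \<le> a\<^sup>2"
    unfolding a_def using \<open>e > 0\<close> sq_err_nonneg[of f]
    by (auto simp: power2_sum intro: add_nonneg_pos)
  define s where "s = \<delta> / a"
  have s: "s > 0" using a assms by (simp add: s_def)
  have pt: "(u + v)\<^sup>2 \<le> (1 + s) * u\<^sup>2 + (1 + 1 / s) * v\<^sup>2" for u v :: real
  proof -
    have "0 \<le> (s * u - v)\<^sup>2 / s" using s by simp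
    also have "\<dots> = s * u\<^sup>2 + v\<^sup>2 / s - 2 * u * v"
      using s by (simp add: power2_eq_square field_simps)
    finally show ?thesis by (simp add: power2_sum algebra_simps)
  qed
  have "sq_err g \<le> (\<integral>z. (1 + s) * (snd z - f (fst z))\<^sup>2 + (1 + 1 / s) * (f (fst z) - g (fst z))\<^sup>2 \<partial>P)"
    unfolding sq_err_def
  proof (rule integral_mono)
    show "integrable P (\<lambda>z. (snd z - g (fst z))\<^sup>2)" by (rule integrable_sq_err)
    show "integrable P (\<lambda>z. (1 + s) * (snd z - f (fst z))\<^sup>2 + (1 + 1 / s) * (f (fst z) - g (fst z))\<^sup>2)"
      by (intro Bochner_Integration.integrable_add integrable_mult_right integrable_sq_err
          integrable_cube[where g = "\<lambda>x. (f x - g x)\<^sup>2"])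
    fix z :: labelled
    show "(snd z - g (fst z))\<^sup>2 \<le> (1 + s) * (snd z - f (fst z))\<^sup>2 + (1 + 1 / s) * (f (fst z) - g (fst z))\<^sup>2"
      using pt[of "snd z - f (fst z)" "f (fst z) - g (fst z)"] by simp
  qed
  also have "\<dots> = (1 + s) * sq_err f + (1 + 1 / s) * cube_avg {..<n} (\<lambda>x. (f x - g x)\<^sup>2)"
    using integrable_sq_err[of f] integrable_cube[of "\<lambda>x. (f x - g x)\<^sup>2"] integral_cube[of "\<lambda>x. (f x - g x)\<^sup>2"]
    by (simp add: sq_err_def)
  also have "\<dots> \<le> (1 + s) * a\<^sup>2 + (1 + 1 / s) * \<delta>\<^sup>2"
    using a assms s by (intro add_mono mult_left_mono) auto
  also have "\<dots> = (a + \<delta>)\<^sup>2"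
    using a assms(2) by (simp add: s_def power2_eq_square field_simps)
  finally have "sqrt (sq_err g) \<le> sqrt ((a + \<delta>)\<^sup>2)" by (rule real_sqrt_le_mono)
  then show "sqrt (sq_err g) \<le> sqrt (sq_err f) + \<delta> + e"
    using a assms(2) by (simp add: a_def)
qed

abbreviation (input) "low D \<equiv> {S. S \<subseteq> {..<n} \<and> card S \<le> D}"

text \<open>The projection of the labels does at least as well as the low-degree part of f, whose
  squared distance from f is the Fourier tail.\<close>

lemma sq_err_projection_le:
  assumes "ftail {..<n} D f \<le> \<delta>\<^sup>2" "\<delta> > 0"
  shows "sqrt (sq_err (\<lambda>x. \<Sum>S\<in>low D. corr S * chi S x)) \<le> sqrt (sq_err f) + \<delta>"
proof -
  let ?V = "{..<n}" and ?g = "\<lambda>x. \<Sum>S\<in>low D. fcoeff {..<n} f S * chi S x"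
  let ?K = "{S. S \<subseteq> ?V \<and> D < card S}"
  have "sq_err (\<lambda>x. \<Sum>S\<in>low D. corr S * chi S x) \<le> sq_err ?g"
    by (subst (1 2) sq_err_chi_sum) (auto intro: sum_nonneg)
  moreover have "cube_avg ?V (\<lambda>x. (f x - ?g x)\<^sup>2) = cube_avg ?V (\<lambda>x. (\<Sum>S\<in>?K. fcoeff ?V f S * chi S x)\<^sup>2)"
  proof (rule cube_avg_cong)
    fix x assume x: "x \<subseteq> ?V"
    have "Pow ?V = low D \<union> ?K" "low D \<inter> ?K = {}" by auto
    then have "f x = ?g x + (\<Sum>S\<in>?K. fcoeff ?V f S * chi S x)"
      using fcoeff_inversion[OF finite_lessThan x, of f] by (simp add: sum.union_disjoint)
    then show "(f x - ?g x)\<^sup>2 = (\<Sum>S\<in>?K. fcoeff ?V f S * chi S x)\<^sup>2" by simp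
  qed
  moreover have "\<dots> = ftail ?V D f"
    unfolding ftail_def by (rule cube_avg_square_chi_sum) auto
  ultimately show ?thesis
    using l2_triangle[of f ?g \<delta>] assms by (smt (verit) real_sqrt_le_mono)
qed

section \<open>Independent samples and estimated coefficients\<close>

abbreviation "samples \<equiv> Pi\<^sub>M UNIV (\<lambda>_::nat. P)"

lemma prob_space_samples: "prob_space samples"
  by (intro prob_space_PiM prob_space_axioms)

lemma distr_sample: "distr samples P (\<lambda>\<omega>. \<omega> t) = P"
  by (rule distr_PiM_component) (auto intro: prob_space_axioms)

lemma integral_sample:
  assumes "g \<in> borel_measurable P"
  shows "(\<integral>\<omega>. (g (\<omega> t) :: real) \<partial>samples) = (\<integral>z. g z \<partial>P)"
  using integral_distr[of "\<lambda>\<omega>. \<omega> t" samples P g] assms by (simp add: distr_sample)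

lemma integrable_sample:
  assumes "integrable P g"
  shows "integrable samples (\<lambda>\<omega>. g (\<omega> t) :: real)"
  using integrable_distr[of "\<lambda>\<omega>. \<omega> t" samples P g] assms by (simp add: distr_sample)

lemma integral_sample_times_sample:
  assumes g: "integrable P (g :: labelled \<Rightarrow> real)" and "t \<noteq> u"
  shows "integrable samples (\<lambda>\<omega>. g (\<omega> t) * g (\<omega> u))"
    "(\<integral>\<omega>. g (\<omega> t) * g (\<omega> u) \<partial>samples) = (\<integral>z. g z \<partial>P)\<^sup>2"
proof -
  interpret samples: prob_space samples by (rule prob_space_samples)
  have "samples.indep_vars (\<lambda>_. P) (\<lambda>t \<omega>. \<omega> t) UNIV"
    by (subst samples.indep_vars_iff_distr_eq_PiM) (simp_all add: distr_sample restrict_UNIV)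
  then have "samples.indep_vars (\<lambda>_. borel) (\<lambda>t \<omega>. g (\<omega> t)) UNIV"
    by (rule samples.indep_vars_compose2) (use g in auto)
  then have *: "samples.indep_vars (\<lambda>_. borel) (\<lambda>t \<omega>. g (\<omega> t)) {t, u}"
    by (rule samples.indep_vars_subset) auto
  have int: "integrable samples (\<lambda>\<omega>. g (\<omega> i))" for i by (rule integrable_sample[OF g])
  show "integrable samples (\<lambda>\<omega>. g (\<omega> t) * g (\<omega> u))"
    using samples.indep_vars_integrable[OF _ * int] \<open>t \<noteq> u\<close> by simp
  show "(\<integral>\<omega>. g (\<omega> t) * g (\<omega> u) \<partial>samples) = (\<integral>z. g z \<partial>P)\<^sup>2"
    using samples.indep_vars_lebesgue_integral[OF _ * int] \<open>t \<noteq> u\<close> g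
    by (simp add: integral_sample power2_eq_square)
qed

text \<open>The cross terms vanish because distinct samples are independent and g is
  centred.\<close>

lemma square_sum_samples:
  assumes g: "integrable P (g :: labelled \<Rightarrow> real)" "integrable P (\<lambda>z. (g z)\<^sup>2)" "(\<integral>z. g z \<partial>P) = 0"
  shows "integrable samples (\<lambda>\<omega>. (\<Sum>t<m. g (\<omega> t))\<^sup>2)"
    "(\<integral>\<omega>. (\<Sum>t<m. g (\<omega> t))\<^sup>2 \<partial>samples) = m * (\<integral>z. (g z)\<^sup>2 \<partial>P)"
proof -
  have int: "integrable samples (\<lambda>\<omega>. g (\<omega> t) * g (\<omega> u))" for t u
    using integral_sample_times_sample(1)[OF g(1), of t u] integrable_sample[OF g(2), of t]
    by (cases "t = u") (simp_all add: power2_eq_square)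
  have val: "(\<integral>\<omega>. g (\<omega> t) * g (\<omega> u) \<partial>samples) = (if t = u then \<integral>z. (g z)\<^sup>2 \<partial>P else 0)" for t u
    using integral_sample_times_sample(2)[OF g(1), of t u] integral_sample[of "\<lambda>z. (g z)\<^sup>2" t] g
    by (cases "t = u") (simp_all add: power2_eq_square)
  have sq: "(\<Sum>t<m. g (\<omega> t))\<^sup>2 = (\<Sum>t<m. \<Sum>u<m. g (\<omega> t) * g (\<omega> u))" for \<omega>
    by (simp add: power2_eq_square sum_product)
  show "integrable samples (\<lambda>\<omega>. (\<Sum>t<m. g (\<omega> t))\<^sup>2)"
    unfolding sq using int by simp
  show "(\<integral>\<omega>. (\<Sum>t<m. g (\<omega> t))\<^sup>2 \<partial>samples) = m * (\<integral>z. (g z)\<^sup>2 \<partial>P)"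
    unfolding sq using int by (simp add: val)
qed

definition estimate :: "nat \<Rightarrow> (nat \<Rightarrow> labelled) \<Rightarrow> nat set \<Rightarrow> real" where
  "estimate m \<omega> S = (\<Sum>t<m. snd (\<omega> t) * chi S (fst (\<omega> t))) / m"

text \<open>Label times character has variance at most 1, since characters square to 1 and labels
  lie in [0,1]; averaging m samples divides it by m.\<close>

lemma estimate_error:
  assumes "m \<ge> 1" "S \<subseteq> {..<n}"
  shows "integrable samples (\<lambda>\<omega>. (estimate m \<omega> S - corr S)\<^sup>2)"
    "(\<integral>\<omega>. (estimate m \<omega> S - corr S)\<^sup>2 \<partial>samples) \<le> 1 / m"
proof -
  define g where "g z = snd z * chi S (fst z) - corr S" for z :: labelled
  have "finite S" using assms finite_subset by blast
  have int: "integrable P (\<lambda>z. snd z * chi S (fst z))" by (rule integrable_label_times_cube)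
  have g: "integrable P g" "(\<integral>z. g z \<partial>P) = 0"
    unfolding g_def using int by (simp_all add: corr_def prob_space)
  have sq: "(g z)\<^sup>2 = (snd z)\<^sup>2 - 2 * corr S * (snd z * chi S (fst z)) + (corr S)\<^sup>2" for z
    using chi_square[OF \<open>finite S\<close>, of "fst z"]
    by (simp add: g_def power2_diff power_mult_distrib) (simp add: power2_eq_square)
  have g2: "integrable P (\<lambda>z. (g z)\<^sup>2)"
    unfolding sq using int integrable_label_square by simp
  have "(\<integral>z. (g z)\<^sup>2 \<partial>P) = (\<integral>z. (snd z)\<^sup>2 \<partial>P) - (corr S)\<^sup>2"
    unfolding sq using int integrable_label_square
    by (simp add: prob_space) (simp add: corr_def power2_eq_square)
  also have "\<dots> \<le> (\<integral>z. (snd z)\<^sup>2 \<partial>P)" by simp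
  also have "\<dots> \<le> (\<integral>z. 1 \<partial>P)"
    using integrable_label_square
    by (intro integral_mono) (auto dest!: in_space_P simp: power_le_one)
  finally have var: "(\<integral>z. (g z)\<^sup>2 \<partial>P) \<le> 1" by (simp add: prob_space)
  have est: "(estimate m \<omega> S - corr S)\<^sup>2 = (\<Sum>t<m. g (\<omega> t))\<^sup>2 / (real m)\<^sup>2" for \<omega>
    using assms(1) by (simp add: estimate_def g_def sum_subtractf field_simps flip: power_divide)
  show "integrable samples (\<lambda>\<omega>. (estimate m \<omega> S - corr S)\<^sup>2)"
    unfolding est using square_sum_samples(1)[OF g(1) g2 g(2)] by simp
  have "(\<integral>\<omega>. (estimate m \<omega> S - corr S)\<^sup>2 \<partial>samples) = m * (\<integral>z. (g z)\<^sup>2 \<partial>P) / (real m)\<^sup>2"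
    unfolding est using square_sum_samples(2)[OF g(1) g2 g(2)] by simp
  also have "\<dots> \<le> real m * 1 / (real m)\<^sup>2"
    using var by (intro divide_right_mono mult_left_mono) auto
  also have "\<dots> = 1 / m" by (simp add: power2_eq_square)
  finally show "(\<integral>\<omega>. (estimate m \<omega> S - corr S)\<^sup>2 \<partial>samples) \<le> 1 / m" .
qed

definition coeff_error :: "nat \<Rightarrow> nat \<Rightarrow> (nat \<Rightarrow> labelled) \<Rightarrow> real" where
  "coeff_error D m \<omega> = (\<Sum>S\<in>low D. (estimate m \<omega> S - corr S)\<^sup>2)"

lemma coeff_error_nonneg: "0 \<le> coeff_error D m \<omega>"
  by (simp add: coeff_error_def sum_nonneg)

text \<open>At most (n + 1)^D coefficients are estimated, each with mean squared error at most 1 /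
  m. Markov's inequality then bounds the failure probability by (\<epsilon>^2 / 12) / (\<epsilon>^2
  / 4).\<close>

lemma coeff_error_prob:
  assumes "m \<ge> 1" and m: "12 / \<epsilon>\<^sup>2 * (real n + 1) ^ D \<le> m" and "\<epsilon> > 0"
  shows "measure samples {\<omega> \<in> space samples. coeff_error D m \<omega> < \<epsilon>\<^sup>2 / 4} \<ge> 2 / 3"
proof -
  interpret samples: prob_space samples by (rule prob_space_samples)
  have int: "integrable samples (coeff_error D m)"
    unfolding coeff_error_def using estimate_error(1)[OF assms(1)] by auto
  have "real (card (low D)) \<le> real ((n + 1) ^ D)"
    using card_low_degree_le by (rule of_nat_mono)
  then have card: "12 / \<epsilon>\<^sup>2 * card (low D) \<le> m"
    using m by (smt (verit) mult_left_mono of_nat_1 of_nat_add of_nat_power zero_le_divide_iff zero_le_power2)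
  have "(\<integral>\<omega>. coeff_error D m \<omega> \<partial>samples) = (\<Sum>S\<in>low D. \<integral>\<omega>. (estimate m \<omega> S - corr S)\<^sup>2 \<partial>samples)"
    unfolding coeff_error_def using estimate_error(1)[OF assms(1)] by (intro Bochner_Integration.integral_sum) auto
  also have "\<dots> \<le> (\<Sum>S\<in>low D. 1 / m)"
    using estimate_error(2)[OF assms(1)] by (intro sum_mono) auto
  also have "\<dots> = card (low D) / m" by simp
  also have "\<dots> \<le> \<epsilon>\<^sup>2 / 12"
    using card assms(1,3) by (simp add: field_simps)
  finally have E: "(\<integral>\<omega>. coeff_error D m \<omega> \<partial>samples) \<le> \<epsilon>\<^sup>2 / 12" .
  have "measure samples {\<omega> \<in> space samples. \<epsilon>\<^sup>2 / 4 \<le> coeff_error D m \<omega>}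
      \<le> (\<integral>\<omega>. coeff_error D m \<omega> \<partial>samples) / (\<epsilon>\<^sup>2 / 4)"
    using int assms(3)
    by (intro integral_Markov_inequality_measure[where A = "{}"]) (use coeff_error_nonneg in auto)
  also have "\<dots> \<le> (\<epsilon>\<^sup>2 / 12) / (\<epsilon>\<^sup>2 / 4)" using E assms(3) by (intro divide_right_mono) auto
  also have "\<dots> = 1 / 3" using assms(3) by simp
  finally have bad: "measure samples {\<omega> \<in> space samples. \<epsilon>\<^sup>2 / 4 \<le> coeff_error D m \<omega>} \<le> 1 / 3" .
  have [measurable]: "coeff_error D m \<in> borel_measurable samples" using int by simp
  have "measure samples {\<omega> \<in> space samples. \<not> \<epsilon>\<^sup>2 / 4 \<le> coeff_error D m \<omega>}
      = 1 - measure samples {\<omega> \<in> space samples. \<epsilon>\<^sup>2 / 4 \<le> coeff_error D m \<omega>}"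
    by (rule samples.prob_neg) measurable
  then show ?thesis using bad by (simp add: not_le)
qed

text \<open>Pythagoras: by \<open>sq_err_chi_sum\<close> the excess over the best low-degree error
  is exactly the coefficient error.\<close>

lemma sq_err_hypothesis:
  "sq_err (hypothesis n D m \<omega>) = sq_err (\<lambda>x. \<Sum>S\<in>low D. corr S * chi S x) + coeff_error D m \<omega>"
proof -
  have "sq_err (hypothesis n D m \<omega>) = sq_err (\<lambda>x. \<Sum>S\<in>low D. estimate m \<omega> S * chi S x)"
    by (rule sq_err_cong) (simp add: hypothesis_eq estimate_def)
  moreover have K: "low D \<subseteq> Pow {..<n}" by auto
  ultimately show ?thesis
    unfolding coeff_error_def sq_err_chi_sum[OF K] by simp
qed

text \<open>The accuracy is split in halves: \<epsilon>/2 for estimating the coefficients and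
  \<epsilon>/2 for replacing the class by polynomials of degree \<open>?D\<close>.\<close>

lemma learner_prob:
  assumes "\<epsilon> > 0"
  shows "measure samples {\<omega> \<in> space samples. \<exists>h. outputs (train, evaluate) n \<epsilon> \<omega> h \<and>
      l2_error P h \<le> opt P (submodular_class n) + \<epsilon>} \<ge> 2 / 3" (is "measure samples ?G \<ge> _")
proof -
  interpret samples: prob_space samples by (rule prob_space_samples)
  let ?D = "50 * resolution \<epsilon>" and ?m = "sample_size n \<epsilon>"
  have M: "0 < 12 / \<epsilon>\<^sup>2 * (real n + 1) ^ ?D" using assms by simp
  have m: "?m \<ge> 1" "12 / \<epsilon>\<^sup>2 * (real n + 1) ^ ?D \<le> ?m"
    using M unfolding sample_size_def by linarith+
  have int: "integrable samples (coeff_error ?D ?m)"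
    unfolding coeff_error_def using estimate_error(1)[OF m(1)] by auto
  have [measurable]: "coeff_error ?D ?m \<in> borel_measurable samples" using int by simp
  have "(\<exists>h. outputs (train, evaluate) n \<epsilon> \<omega> h \<and> l2_error P h \<le> opt P (submodular_class n) + \<epsilon>)
      \<longleftrightarrow> sqrt (sq_err (\<lambda>x. \<Sum>S\<in>low ?D. corr S * chi S x) + coeff_error ?D ?m \<omega>)
        \<le> opt P (submodular_class n) + \<epsilon>" for \<omega>
  proof -
    have eq: "l2_error P h = l2_error P (hypothesis n ?D ?m \<omega>)" if "\<forall>x\<in>Pow {..<n}. h x = hypothesis n ?D ?m \<omega> x" for h
      unfolding l2_error_eq using that by (auto intro: sq_err_cong)
    have "(\<exists>h. (\<forall>x\<in>Pow {..<n}. h x = hypothesis n ?D ?m \<omega> x) \<and> l2_error P h \<le> c)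
        \<longleftrightarrow> l2_error P (hypothesis n ?D ?m \<omega>) \<le> c" for c
    proof
      assume "\<exists>h. (\<forall>x\<in>Pow {..<n}. h x = hypothesis n ?D ?m \<omega> x) \<and> l2_error P h \<le> c"
      then obtain h where "\<forall>x\<in>Pow {..<n}. h x = hypothesis n ?D ?m \<omega> x" "l2_error P h \<le> c" by blast
      from this(2)[unfolded eq[OF this(1)]] show "l2_error P (hypothesis n ?D ?m \<omega>) \<le> c" .
    qed blast
    then show ?thesis
      unfolding outputs_iff[OF assms] l2_error_eq sq_err_hypothesis .
  qed
  then have G: "?G = {\<omega> \<in> space samples. sqrt (sq_err (\<lambda>x. \<Sum>S\<in>low ?D. corr S * chi S x) + coeff_error ?D ?m \<omega>)
        \<le> opt P (submodular_class n) + \<epsilon>}" by simp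
  \<comment> \<open>\<open>measure\<close> is 0 on nonmeasurable sets, so the inclusion below gives
    a lower bound only together with this fact. The form \<open>G\<close> of the event makes it
    evident.\<close>
  have "?G \<in> sets samples" unfolding G by measurable
  moreover have "{\<omega> \<in> space samples. coeff_error ?D ?m \<omega> < \<epsilon>\<^sup>2 / 4} \<subseteq> ?G"
  proof -
    have "sqrt (sq_err (\<lambda>x. \<Sum>S\<in>low ?D. corr S * chi S x) + coeff_error ?D ?m \<omega>)
        \<le> opt P (submodular_class n) + \<epsilon>" if \<omega>: "coeff_error ?D ?m \<omega> < \<epsilon>\<^sup>2 / 4" for \<omega>
    proof -
      let ?R = "sq_err (\<lambda>x. \<Sum>S\<in>low ?D. corr S * chi S x)"
      have "sqrt (?R + coeff_error ?D ?m \<omega>) \<le> sqrt ?R + sqrt (coeff_error ?D ?m \<omega>)"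
        by (intro sqrt_add_le_add_sqrt sq_err_nonneg) (rule coeff_error_nonneg)
      also have "sqrt (coeff_error ?D ?m \<omega>) \<le> sqrt ((\<epsilon> / 2)\<^sup>2)"
        using \<omega> by (intro real_sqrt_le_mono) (simp add: power_divide)
      also have "\<dots> = \<epsilon> / 2" using assms by simp
      finally have 1: "sqrt (?R + coeff_error ?D ?m \<omega>) \<le> sqrt ?R + \<epsilon> / 2" by simp
      have "sqrt ?R - \<epsilon> / 2 \<le> opt P (submodular_class n)"
        unfolding opt_def
      proof (rule cINF_greatest)
        \<comment> \<open>The infimum of real numbers is meaningful only over a nonempty class; the
          zero function is a member.\<close>
        have "(\<lambda>_. 0) \<in> submodular_class n" by (simp add: submodular_class_def submodular_def)
        then show "submodular_class n \<noteq> {}" by blast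
        fix f assume f: "f \<in> submodular_class n"
        have "ftail {..<n} ?D f \<le> (\<epsilon> / 2)\<^sup>2"
          using submodular_fourier_concentration[OF f assms resolution_works(3,1)[OF assms]]
          by (simp add: power_divide)
        from sq_err_projection_le[OF this] assms show "sqrt ?R - \<epsilon> / 2 \<le> l2_error P f"
          by (simp add: l2_error_eq)
      qed
      with 1 show ?thesis by linarith
    qed
    then show ?thesis unfolding G by auto
  qed
  ultimately have "measure samples {\<omega> \<in> space samples. coeff_error ?D ?m \<omega> < \<epsilon>\<^sup>2 / 4} \<le> measure samples ?G"
    by (intro samples.finite_measure_mono)
  then show ?thesis using coeff_error_prob[OF m assms] by linarith
qed

end

theorem theorem5p12:
  "\<exists>(L :: learner) (C :: real). C > 0 \<and>
     learns_agnostically L submodular_class \<and>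
     runs_in_time L (\<lambda>n \<epsilon>. real n powr (C * learning_exponent \<epsilon>))"
proof (intro exI conjI)
  show "learns_agnostically (train, evaluate) submodular_class"
    unfolding learns_agnostically_def
    using uniform_examples.learner_prob uniform_examples.intro by blast
  show "runs_in_time (train, evaluate) (\<lambda>n \<epsilon>. real n powr (480 * learning_exponent \<epsilon>))"
    by (rule runs_in_time_learner)
qed simp

end
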